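(* Let $\{W_\gamma:\gamma\in T^*\}$ be a cascade generator, with dependent cascade $\lambda_n(dt)=\big(\prod_{j=0}^nW_{t|j}\big)\lambda(dt)$ and limit $\lambda_\infty$, and let $\lambda_\infty=\int(\lambda_\infty)_\alpha\,\nu(d\alpha)$ be the dimension disintegration of $\lambda_\infty$. For $\gamma\in T^*$ and $s\in[0,1]$ put $$\nu_\gamma([0,s])=\int_{[0,s]}(\lambda_\infty)_\alpha(\Delta_\gamma)\,\nu(d\alpha),\qquad F_{s,\gamma}=\frac{E[\nu_\gamma([0,s])\,|\,\mathcal F_n]}{\lambda_n(\Delta_\gamma)},\quad n=|\gamma|$$ (with $F_{s,\gamma}=0$ where $\lambda_n(\Delta_\gamma)=0$). Then the dimension disintegration is given by weight decompositions with respect to the families $\mathbf F_s=\{F_{s,\gamma}:\gamma\in T^*\}$, $s\in[0,1]$: for each $s\in[0,1]$ and suitable versions of the conditional expectations, $\mathbf F_s$ is a weight decomposition, and the limit $\lambda_{\mathbf F_s,\infty}$ of the corresponding weighted cascade satisfies $$\lambda_{\mathbf F_s,\infty}(\cdot)=\int_{[0,s]}(\lambda_\infty)_\alpha(\cdot)\,\nu(d\alpha)\quad\text{a.s.}$$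
   Context: Tree. Fix an integer $b\ge2$. $T=\{0,\dots,b-1\}^{\mathbb N}$ is a compact metric space with ultrametric $\rho(s,t)=b^{-a(s,t)}$, $a(s,t)=\inf\{n:s_n\ne t_n\}$; Hausdorff dimension, denoted $\dim$, is with respect to $\rho$. $\lambda$ is the normalized Haar measure on $T$ (the product of uniform measures). $T^*$ is the set of all finite words over $\{0,\dots,b-1\}$, including the empty word $\emptyset$ (the root). $|\gamma|$ is the length of $\gamma\in T^*$. For $t\in T$, $t|n=(t_1,\dots,t_n)$, $t|0=\emptyset$; for $\gamma\in T^*$ and $j\le|\gamma|$, $\gamma|j$ is the prefix of length $j$. $\Delta_\gamma=\{t\in T:t|{|\gamma|}=\gamma\}$. Cascade generator. Given a probability measure $p_0(dx)$ on $[0,\infty)$ with finite positive mean and transition probability kernels $q_n(dx|x_0,\dots,x_{n-1})$, $n\ge1$, on $[0,\infty)$, each of mean one, let $\Omega=[0,\infty)^{T^*}$ with product $\sigma$-field $\mathcal F$, let $W_\gamma(\omega)=\omega_\gamma$ and $\mathcal F_n=\sigma\{W_\gamma:|\gamma|\le n\}$, and let $P$ be the probability on $(\Omega,\mathcal F)$ such that: $W_\emptyset$ has law $p_0$; for every $t\in T$ and $n\ge0$ the conditional law of $W_{t|n+1}$ given $\mathcal F_n$ is $q_{n+1}(dx|W_{t|0},\dots,W_{t|n})$; and the variables $W_\gamma$, $|\gamma|=n+1$, are conditionally independent given $\mathcal F_n$. Positive $T$-martingale. A sequence $\{Q_n(t)\}$ of nonnegative functions on $T\times\Omega$ such that for every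 $t\in T$, $\{Q_n(t)\}_n$ is a martingale with respect to $(\mathcal F_n)$ under $P$, and for $P$-a.e. $\omega$ the functions $Q_n(\cdot,\omega)$ are Borel. The random measures $Q_n(t)\lambda(dt)$ then converge weakly a.s. to a random Borel measure $Q_\infty\lambda$. For $Q_n(t)=\prod_{j=0}^nW_{t|j}$ this limit is $\lambda_\infty$. Weight system and weight decomposition. A weight system is a family $\mathbf F=\{F_\gamma:\gamma\in T^*\}$ of functions $F_\gamma:\Omega\to[0,\infty)$, $F_\gamma$ measurable with respect to $\sigma\{W_{\gamma|j}:0\le j\le|\gamma|\}$, such that the weighted cascade $Q_{\mathbf F,n}(t)=\big(\prod_{j=0}^nW_{t|j}\big)F_{t|n}$ is a positive $T$-martingale; $\lambda_{\mathbf F,\infty}:=Q_{\mathbf F,\infty}\lambda$ is the a.s. weak limit of $Q_{\mathbf F,n}(t)\lambda(dt)$. It is a weight decomposition if $\mathbf F^c=\{1-F_\gamma:\gamma\in T^*\}$ is also a weight system. Dimension disintegration. Every finite Borel measure $\sigma$ on $T$ has a unique disintegration $\sigma(\cdot)=\int\sigma_\alpha(\cdot)\,\nu(d\alpha)$ over $\alpha\ge0$ such that for each $\beta\ge0$: the measure $\int_{[0,\beta]}\sigma_\alpha\,\nu(d\alpha)$ is supported by (i.e. gives full mass to) a Borel set of Hausdorff dimension at most $\beta$, and for Borel $B$, $\int_{(\beta,\infty]}\sigma_\alpha(B)\,\nu(d\alpha)>0$ implies $\dim(B)>\beta$. Uniqueness is in the sense that the measures $\int_{[0,\beta]}\sigma_\alpha\,\nu(d\alpha)$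 are uniquely determined by $\sigma$. Here it is applied to $\sigma=\lambda_\infty(\omega)$ for a.e. $\omega$, so $\nu$ is random. *)

theory Defs
  imports "HOL-Probability.Probability"
begin

section \<open>The tree and its boundary\<close>

text \<open>
  Letters are indexed from 0, so the n-th letter of t in the 1-based notation
  t = (t_1, t_2, ...) is \<open>t (n - 1)\<close>.
\<close>

definition tree_boundary :: "nat \<Rightarrow> (nat \<Rightarrow> nat) set" where
  "tree_boundary b = {t. \<forall>n. t n < b}"

definition tree_words :: "nat \<Rightarrow> nat list set" where
  "tree_words b = {\<gamma>. set \<gamma> \<subseteq> {..<b}}"

definition pre :: "(nat \<Rightarrow> nat) \<Rightarrow> nat \<Rightarrow> nat list" where
  "pre t n = map t [0..<n]"

definition cyl :: "nat \<Rightarrow> nat list \<Rightarrow> (nat \<Rightarrow> nat) set" where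
  "cyl b \<gamma> = {t \<in> tree_boundary b. pre t (length \<gamma>) = \<gamma>}"

text \<open>The successor accounts for the 0-based indexing of letters.\<close>

definition tree_dist :: "nat \<Rightarrow> (nat \<Rightarrow> nat) \<Rightarrow> (nat \<Rightarrow> nat) \<Rightarrow> real" where
  "tree_dist b s t = (if s = t then 0 else 1 / real b ^ Suc (LEAST n. s n \<noteq> t n))"

text \<open>
  The library topology on \<open>nat \<Rightarrow> nat\<close> is the product of the discrete topologies. On the
  boundary it is the topology of \<open>tree_dist\<close> (lemma \<open>openin_tree_boundary_iff\<close> below), so
  the following is the Borel sigma-algebra of the metric space.
\<close>

definition tree_borel :: "nat \<Rightarrow> (nat \<Rightarrow> nat) measure" where
  "tree_borel b = restrict_space borel (tree_boundary b)"

definition tree_haar :: "nat \<Rightarrow> (nat \<Rightarrow> nat) measure" where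
  "tree_haar b = (\<Pi>\<^sub>M n\<in>UNIV. uniform_count_measure {..<b})"

definition tree_weak_conv ::
    "nat \<Rightarrow> (nat \<Rightarrow> (nat \<Rightarrow> nat) measure) \<Rightarrow> (nat \<Rightarrow> nat) measure \<Rightarrow> bool" where
  "tree_weak_conv b M \<mu> \<longleftrightarrow>
     sets \<mu> = sets (tree_borel b) \<and> finite_measure \<mu> \<and>
     (\<forall>f :: (nat \<Rightarrow> nat) \<Rightarrow> real. continuous_on (tree_boundary b) f \<longrightarrow>
        (\<lambda>n. \<integral>t. f t \<partial>M n) \<longlonglongrightarrow> (\<integral>t. f t \<partial>\<mu>))"

section \<open>Hausdorff dimension\<close>

definition tree_diam :: "nat \<Rightarrow> (nat \<Rightarrow> nat) set \<Rightarrow> real" where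
  "tree_diam b U = enn2real (SUP s\<in>U. SUP t\<in>U. ennreal (tree_dist b s t))"

definition hausdorff_premeasure :: "nat \<Rightarrow> real \<Rightarrow> real \<Rightarrow> (nat \<Rightarrow> nat) set \<Rightarrow> ennreal" where
  "hausdorff_premeasure b s \<delta> A =
     (INF U \<in> {U :: nat \<Rightarrow> (nat \<Rightarrow> nat) set.
          (\<forall>i. U i \<subseteq> tree_boundary b \<and> tree_diam b (U i) \<le> \<delta>) \<and> A \<subseteq> (\<Union>i. U i)}.
        \<Sum>i. ennreal (tree_diam b (U i) powr s))"

definition hausdorff_measure :: "nat \<Rightarrow> real \<Rightarrow> (nat \<Rightarrow> nat) set \<Rightarrow> ennreal" where
  "hausdorff_measure b s A = (SUP \<delta>\<in>{0<..}. hausdorff_premeasure b s \<delta> A)"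

text \<open>
  Only exponents s > 0 are used, because \<open>0 powr 0 = 0\<close> in HOL. The infimum is not
  affected by omitting s = 0. The empty set has dimension 0.
\<close>

definition hausdorff_dim :: "nat \<Rightarrow> (nat \<Rightarrow> nat) set \<Rightarrow> ennreal" where
  "hausdorff_dim b A = (INF s \<in> {s :: real. 0 < s \<and> hausdorff_measure b s A = 0}. ennreal s)"

section \<open>Dimension disintegration\<close>

definition disint_part ::
    "ennreal measure \<Rightarrow> (ennreal \<Rightarrow> (nat \<Rightarrow> nat) measure) \<Rightarrow> ennreal set \<Rightarrow> (nat \<Rightarrow> nat) set \<Rightarrow> ennreal"
  where
  "disint_part \<nu> \<kappa> I B = (\<integral>\<^sup>+\<alpha>\<in>I. emeasure (\<kappa> \<alpha>) B \<partial>\<nu>)"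

text \<open>The index \<open>\<alpha>\<close> ranges over \<open>[0, \<infinity>]\<close>, i.e. the type \<open>ennreal\<close>.\<close>

definition dim_disintegration ::
    "nat \<Rightarrow> (nat \<Rightarrow> nat) measure \<Rightarrow> ennreal measure \<Rightarrow> (ennreal \<Rightarrow> (nat \<Rightarrow> nat) measure) \<Rightarrow> bool"
  where
  "dim_disintegration b \<sigma> \<nu> \<kappa> \<longleftrightarrow>
     sets \<nu> = sets borel \<and>
     (\<forall>\<alpha>. sets (\<kappa> \<alpha>) = sets (tree_borel b)) \<and>
     (\<forall>B \<in> sets (tree_borel b). (\<lambda>\<alpha>. emeasure (\<kappa> \<alpha>) B) \<in> borel_measurable \<nu>) \<and>
     (\<forall>B \<in> sets (tree_borel b). emeasure \<sigma> B = (\<integral>\<^sup>+\<alpha>. emeasure (\<kappa> \<alpha>) B \<partial>\<nu>)) \<and>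
     (\<forall>\<beta>::real. 0 \<le> \<beta> \<longrightarrow>
        (\<exists>A \<in> sets (tree_borel b). hausdorff_dim b A \<le> ennreal \<beta> \<and>
            disint_part \<nu> \<kappa> {0..ennreal \<beta>} (tree_boundary b - A) = 0) \<and>
        (\<forall>B \<in> sets (tree_borel b). disint_part \<nu> \<kappa> {ennreal \<beta><..\<infinity>} B > 0 \<longrightarrow>
            hausdorff_dim b B > ennreal \<beta>))"

section \<open>Cascade generators\<close>

abbreviation nonneg_borel :: "real measure" where
  "nonneg_borel \<equiv> restrict_space borel {0..}"

abbreviation cascade_space :: "nat \<Rightarrow> (nat list \<Rightarrow> real) measure" where
  "cascade_space b \<equiv> (\<Pi>\<^sub>M \<gamma>\<in>tree_words b. nonneg_borel)"

text \<open>The sigma-algebra generated by the coordinates \<open>W\<^sub>\<gamma>(\<omega>) = \<omega> \<gamma>\<close>, \<open>\<gamma> \<in> I\<close>.\<close>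

definition coord_algebra :: "nat \<Rightarrow> nat list set \<Rightarrow> (nat list \<Rightarrow> real) measure" where
  "coord_algebra b I =
     sigma (space (cascade_space b))
       (\<Union>\<gamma>\<in>I. {(\<lambda>\<omega>. \<omega> \<gamma>) -` A \<inter> space (cascade_space b) | A. A \<in> sets nonneg_borel})"

definition level_algebra :: "nat \<Rightarrow> nat \<Rightarrow> (nat list \<Rightarrow> real) measure" where
  "level_algebra b n = coord_algebra b {\<gamma> \<in> tree_words b. length \<gamma> \<le> n}"

definition path_algebra :: "nat \<Rightarrow> nat list \<Rightarrow> (nat list \<Rightarrow> real) measure" where
  "path_algebra b \<gamma> = coord_algebra b {take j \<gamma> | j. j \<le> length \<gamma>}"

definition cond_indep_vars ::
    "'a measure \<Rightarrow> 'a measure \<Rightarrow> 'b measure \<Rightarrow> ('i \<Rightarrow> 'a \<Rightarrow> 'b) \<Rightarrow> 'i set \<Rightarrow> bool" where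
  "cond_indep_vars M G N X I \<longleftrightarrow>
     (\<forall>J A. finite J \<longrightarrow> J \<noteq> {} \<longrightarrow> J \<subseteq> I \<longrightarrow> (\<forall>j\<in>J. A j \<in> sets N) \<longrightarrow>
        (AE \<omega> in M. real_cond_exp M G (indicator {x \<in> space M. \<forall>j\<in>J. X j x \<in> A j}) \<omega> =
           (\<Prod>j\<in>J. real_cond_exp M G (indicator {x \<in> space M. X j x \<in> A j}) \<omega>)))"

text \<open>
  In \<open>cascade_generator b p q P\<close>, the measure \<open>q n x\<close> is the transition probability
  \<open>q\<^sub>n(\<cdot> | x\<^sub>0, \<dots>, x\<^sub>n\<^sub>-\<^sub>1)\<close>, the past being encoded as an element of the product over \<open>{..<n}\<close>.
\<close>

definition cascade_generator ::
    "nat \<Rightarrow> real measure \<Rightarrow> (nat \<Rightarrow> (nat \<Rightarrow> real) \<Rightarrow> real measure) \<Rightarrow>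
     (nat list \<Rightarrow> real) measure \<Rightarrow> bool" where
  "cascade_generator b p q P \<longleftrightarrow>
     prob_space p \<and> sets p = sets nonneg_borel \<and>
     0 < (\<integral>\<^sup>+x. ennreal x \<partial>p) \<and> (\<integral>\<^sup>+x. ennreal x \<partial>p) < \<infinity> \<and>
     (\<forall>n\<ge>1. q n \<in> (\<Pi>\<^sub>M i\<in>{..<n}. nonneg_borel) \<rightarrow>\<^sub>M prob_algebra nonneg_borel) \<and>
     (\<forall>n\<ge>1. \<forall>x \<in> space (\<Pi>\<^sub>M i\<in>{..<n}. nonneg_borel). (\<integral>\<^sup>+y. ennreal y \<partial>q n x) = 1) \<and>
     prob_space P \<and> sets P = sets (cascade_space b) \<and>
     distr P nonneg_borel (\<lambda>\<omega>. \<omega> []) = p \<and>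
     (\<forall>t \<in> tree_boundary b. \<forall>n. \<forall>A \<in> sets nonneg_borel.
        AE \<omega> in P.
          real_cond_exp P (level_algebra b n)
            (indicator {x \<in> space P. x (pre t (Suc n)) \<in> A}) \<omega> =
          measure (q (Suc n) (\<lambda>j\<in>{..<Suc n}. \<omega> (pre t j))) A) \<and>
     (\<forall>n. cond_indep_vars P (level_algebra b n) nonneg_borel (\<lambda>\<gamma> \<omega>. \<omega> \<gamma>)
            {\<gamma> \<in> tree_words b. length \<gamma> = Suc n})"

section \<open>Positive T-martingales and weighted cascades\<close>

definition martingale :: "'a measure \<Rightarrow> (nat \<Rightarrow> 'a measure) \<Rightarrow> (nat \<Rightarrow> 'a \<Rightarrow> real) \<Rightarrow> bool" where
  "martingale M G X \<longleftrightarrow>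
     (\<forall>n. X n \<in> borel_measurable (G n) \<and> integrable M (X n)) \<and>
     (\<forall>m n. m \<le> n \<longrightarrow> (AE \<omega> in M. real_cond_exp M (G m) (X n) \<omega> = X m \<omega>))"

definition positive_T_martingale ::
    "nat \<Rightarrow> (nat list \<Rightarrow> real) measure \<Rightarrow> (nat \<Rightarrow> (nat \<Rightarrow> nat) \<Rightarrow> (nat list \<Rightarrow> real) \<Rightarrow> real) \<Rightarrow> bool"
  where
  "positive_T_martingale b P Q \<longleftrightarrow>
     (\<forall>n. \<forall>t \<in> tree_boundary b. \<forall>\<omega> \<in> space P. 0 \<le> Q n t \<omega>) \<and>
     (\<forall>t \<in> tree_boundary b. martingale P (level_algebra b) (\<lambda>n. Q n t)) \<and>
     (AE \<omega> in P. \<forall>n. (\<lambda>t. Q n t \<omega>) \<in> borel_measurable (tree_borel b))"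

definition random_density ::
    "nat \<Rightarrow> (nat \<Rightarrow> (nat \<Rightarrow> nat) \<Rightarrow> (nat list \<Rightarrow> real) \<Rightarrow> real) \<Rightarrow>
     (nat list \<Rightarrow> real) \<Rightarrow> nat \<Rightarrow> (nat \<Rightarrow> nat) measure" where
  "random_density b Q \<omega> n = density (tree_haar b) (\<lambda>t. ennreal (Q n t \<omega>))"

text \<open>\<open>L\<close> is (a version of) the a.s. weak limit of the random measures \<open>Q\<^sub>n(t) \<lambda>(dt)\<close>.\<close>

definition T_martingale_limit ::
    "nat \<Rightarrow> (nat list \<Rightarrow> real) measure \<Rightarrow>
     (nat \<Rightarrow> (nat \<Rightarrow> nat) \<Rightarrow> (nat list \<Rightarrow> real) \<Rightarrow> real) \<Rightarrow>
     ((nat list \<Rightarrow> real) \<Rightarrow> (nat \<Rightarrow> nat) measure) \<Rightarrow> bool" where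
  "T_martingale_limit b P Q L \<longleftrightarrow>
     (AE \<omega> in P. tree_weak_conv b (random_density b Q \<omega>) (L \<omega>))"

definition cascade :: "nat \<Rightarrow> (nat \<Rightarrow> nat) \<Rightarrow> (nat list \<Rightarrow> real) \<Rightarrow> real" where
  "cascade n t \<omega> = (\<Prod>j\<le>n. \<omega> (pre t j))"

definition weighted_cascade ::
    "(nat list \<Rightarrow> (nat list \<Rightarrow> real) \<Rightarrow> real) \<Rightarrow>
     nat \<Rightarrow> (nat \<Rightarrow> nat) \<Rightarrow> (nat list \<Rightarrow> real) \<Rightarrow> real" where
  "weighted_cascade F n t \<omega> = (\<Prod>j\<le>n. \<omega> (pre t j)) * F (pre t n) \<omega>"

definition weight_system ::
    "nat \<Rightarrow> (nat list \<Rightarrow> real) measure \<Rightarrow> (nat list \<Rightarrow> (nat list \<Rightarrow> real) \<Rightarrow> real) \<Rightarrow> bool" where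
  "weight_system b P F \<longleftrightarrow>
     (\<forall>\<gamma> \<in> tree_words b. F \<gamma> \<in> borel_measurable (path_algebra b \<gamma>) \<and>
        (\<forall>\<omega> \<in> space P. 0 \<le> F \<gamma> \<omega>)) \<and>
     positive_T_martingale b P (weighted_cascade F)"

definition weight_decomposition ::
    "nat \<Rightarrow> (nat list \<Rightarrow> real) measure \<Rightarrow> (nat list \<Rightarrow> (nat list \<Rightarrow> real) \<Rightarrow> real) \<Rightarrow> bool" where
  "weight_decomposition b P F \<longleftrightarrow>
     weight_system b P F \<and> weight_system b P (\<lambda>\<gamma> \<omega>. 1 - F \<gamma> \<omega>)"

text \<open>
  \<open>Z\<close> is a version of \<open>E[X | G]\<close>. Integrability of \<open>X\<close> is included, since
  \<open>real_cond_exp\<close> is meaningless without it.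
\<close>

definition cond_exp_version ::
    "'a measure \<Rightarrow> 'a measure \<Rightarrow> ('a \<Rightarrow> real) \<Rightarrow> ('a \<Rightarrow> real) \<Rightarrow> bool" where
  "cond_exp_version M G X Z \<longleftrightarrow>
     integrable M X \<and> Z \<in> borel_measurable G \<and> (AE \<omega> in M. Z \<omega> = real_cond_exp M G X \<omega>)"

text \<open>
  The quotient of a version \<open>Z \<gamma>\<close> of \<open>E[\<nu>\<^sub>\<gamma>([0,s]) | F\<^sub>n]\<close>, \<open>n = |\<gamma>|\<close>, by \<open>\<lambda>\<^sub>n(\<Delta>\<^sub>\<gamma>)\<close>.
  Division by zero yields 0 in HOL, which is the required convention.
\<close>

definition quotient_weight ::
    "nat \<Rightarrow> (nat list \<Rightarrow> (nat list \<Rightarrow> real) \<Rightarrow> real) \<Rightarrow>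
     nat list \<Rightarrow> (nat list \<Rightarrow> real) \<Rightarrow> real" where
  "quotient_weight b Z \<gamma> \<omega> =
     Z \<gamma> \<omega> / measure (random_density b cascade \<omega> (length \<gamma>)) (cyl b \<gamma>)"

section \<open>Agreement of topologies and of sigma-algebras\<close>

lemma tree_dist_less_iff:
  assumes "b \<ge> 2"
  shows "tree_dist b s t < 1 / real b ^ n \<longleftrightarrow> (\<forall>i<n. s i = t i)"
proof (cases "s = t")
  case False
  define k where "k = (LEAST n. s n \<noteq> t n)"
  from False obtain m where "s m \<noteq> t m" by blast
  then have k: "s k \<noteq> t k"
    unfolding k_def by (rule LeastI)
  have k': "s i = t i" if "i < k" for i
    using that not_less_Least unfolding k_def by blast
  have "tree_dist b s t < 1 / real b ^ n \<longleftrightarrow> real b ^ n < real b ^ Suc k"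
    unfolding tree_dist_def k_def[symmetric] using False assms
    by (simp add: divide_simps del: power_Suc)
  also have "\<dots> \<longleftrightarrow> n < Suc k"
    using assms by (intro power_strict_increasing_iff) simp
  also have "\<dots> \<longleftrightarrow> (\<forall>i<n. s i = t i)"
    using k k' by (metis less_Suc_eq_le less_le_trans not_less)
  finally show ?thesis .
qed (use assms in \<open>simp add: tree_dist_def\<close>)

lemma openin_tree_boundary_iff:
  assumes b: "b \<ge> 2"
  shows "openin (top_of_set (tree_boundary b)) U \<longleftrightarrow>
     U \<subseteq> tree_boundary b \<and>
     (\<forall>s\<in>U. \<exists>e>0. \<forall>t\<in>tree_boundary b. tree_dist b s t < e \<longrightarrow> t \<in> U)"
    (is "?L \<longleftrightarrow> ?R")
proof
  assume ?L
  then obtain V where V: "open V" "U = tree_boundary b \<inter> V"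
    by (auto simp: openin_open)
  have "\<exists>e>0. \<forall>t\<in>tree_boundary b. tree_dist b s t < e \<longrightarrow> t \<in> U" if "s \<in> U" for s
  proof -
    from V that obtain X where X: "s \<in> Pi\<^sub>E UNIV X" "\<And>i. open (X i)"
        "finite {i. X i \<noteq> UNIV}" "Pi\<^sub>E UNIV X \<subseteq> V"
      using product_topology_open_contains_basis[of "\<lambda>_. euclidean" UNIV V s]
      by (auto simp: open_fun_def simp del: PiE_UNIV_domain)
    obtain n where n: "\<And>i. X i \<noteq> UNIV \<Longrightarrow> i < n"
      using X(3) unfolding finite_nat_set_iff_bounded by blast
    show ?thesis
    proof (intro exI[of _ "1 / real b ^ n"] conjI ballI impI)
      fix t assume t: "t \<in> tree_boundary b" "tree_dist b s t < 1 / real b ^ n"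
      then have "\<forall>i<n. s i = t i"
        using tree_dist_less_iff[OF b] by blast
      then have "t i \<in> X i" for i
        using n[of i] X(1) by (cases "i < n") (auto simp: PiE_iff dest: spec[of _ i])
      then show "t \<in> U"
        using X(4) V t(1) by (auto simp: PiE_iff subset_iff)
    qed (use b in simp)
  qed
  then show ?R using V by blast
next
  assume R: ?R
  show ?L
  proof (subst openin_subopen, intro ballI)
    fix s assume s: "s \<in> U"
    with R obtain e where e: "e > 0" "\<And>t. t \<in> tree_boundary b \<Longrightarrow> tree_dist b s t < e \<Longrightarrow> t \<in> U"
      by blast
    obtain n where n: "(1 / real b) ^ n < e"
      using real_arch_pow_inv[of e "1 / real b"] e(1) b by auto
    define V where "V = Pi\<^sub>E UNIV (\<lambda>i. if i < n then {s i} else UNIV)"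
    have "open V"
      unfolding V_def by (rule open_PiE) (simp_all add: discrete_topology_class.open_discrete)
    moreover have "tree_boundary b \<inter> V \<subseteq> U"
    proof
      fix t assume t: "t \<in> tree_boundary b \<inter> V"
      then have "\<forall>i<n. s i = t i"
        unfolding V_def by (auto simp: PiE_iff split: if_splits)
      then have "tree_dist b s t < 1 / real b ^ n"
        using tree_dist_less_iff[OF b] by blast
      with n e(2) t show "t \<in> U"
        by (auto simp: power_one_over)
    qed
    moreover have "s \<in> tree_boundary b \<inter> V"
      using s R by (auto simp: V_def)
    ultimately show "\<exists>T. openin (top_of_set (tree_boundary b)) T \<and> s \<in> T \<and> T \<subseteq> U"
      by (meson openin_open_Int)
  qed
qed

lemma sets_tree_haar: "sets (tree_haar b) = sets (tree_borel b)"
proof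
  have space_haar: "space (tree_haar b) = tree_boundary b"
    by (auto simp: tree_haar_def space_PiM space_uniform_count_measure tree_boundary_def PiE_iff)
  have space_borel: "space (tree_borel b) = tree_boundary b"
    by (simp add: tree_borel_def space_restrict_space)
  have coord: "(\<lambda>x :: nat \<Rightarrow> nat. x i) \<in> borel \<rightarrow>\<^sub>M count_space UNIV" for i
    by (simp add: measurable_cong_sets[OF refl sets_borel_eq_count_space[symmetric]]
        borel_measurable_continuous_onI)
  show "sets (tree_haar b) \<subseteq> sets (tree_borel b)"
    unfolding tree_haar_def
  proof (rule sets_PiM_in_sets)
    show "space (tree_borel b) = (\<Pi>\<^sub>E i\<in>UNIV. space (uniform_count_measure {..<b}))"
      using space_haar by (simp add: space_borel tree_haar_def space_PiM)
    fix i A assume "A \<in> sets (uniform_count_measure {..<b})"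
    have "(\<lambda>x. x i) -` A \<inter> space borel \<in> sets (borel :: (nat \<Rightarrow> nat) measure)"
      by (rule measurable_sets[OF coord]) simp
    then show "{x \<in> space (tree_borel b). x i \<in> A} \<in> sets (tree_borel b)"
      unfolding space_borel tree_borel_def sets_restrict_space
      by (intro image_eqI[of _ _ "(\<lambda>x. x i) -` A"]) (auto simp: space_restrict_space)
  qed
  show "sets (tree_borel b) \<subseteq> sets (tree_haar b)"
  proof
    fix B assume "B \<in> sets (tree_borel b)"
    then obtain C where C: "C \<in> sets borel" "B = tree_boundary b \<inter> C"
      by (auto simp: tree_borel_def sets_restrict_space)
    have "(\<lambda>x. x) \<in> tree_haar b \<rightarrow>\<^sub>M (\<Pi>\<^sub>M n\<in>UNIV. (borel :: nat measure))"
    proof (rule measurable_PiM_single')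
      fix i :: nat
      have "(\<lambda>x. x i) \<in> tree_haar b \<rightarrow>\<^sub>M uniform_count_measure {..<b}"
        unfolding tree_haar_def by (rule measurable_component_singleton) simp
      also have "(tree_haar b \<rightarrow>\<^sub>M uniform_count_measure {..<b}) = (tree_haar b \<rightarrow>\<^sub>M count_space {..<b})"
        by (rule measurable_cong_sets) (simp_all add: sets_uniform_count_measure)
      finally have "(\<lambda>x. x i) \<in> tree_haar b \<rightarrow>\<^sub>M count_space {..<b}" .
      then show "(\<lambda>x. x i) \<in> tree_haar b \<rightarrow>\<^sub>M borel"
        by (rule measurable_compose) simp
    qed (simp add: PiE_iff)
    then have "(\<lambda>x. x) \<in> tree_haar b \<rightarrow>\<^sub>M borel"
      by (simp add: measurable_cong_sets[OF refl sets_PiM_equal_borel])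
    from measurable_sets[OF this C(1)] show "B \<in> sets (tree_haar b)"
      using C(2) by (simp add: space_haar Int_commute)
  qed
qed

end

theory Submission
  imports Defs
begin

text \<open>
  The dimension disintegration of a finite measure \<open>\<sigma>\<close> on the boundary can be written down. Call a
  point t heavy if \<open>\<sigma>(\<Delta>\<^bsub>t|n\<^esub>)\<close> is, for infinitely many n, nearly as large as \<open>b\<^bsup>- n s\<^esup>\<close>, i.e. if the
  lower local dimension of \<open>\<sigma>\<close> at t is at most s. Counting cylinders shows that the heavy points form
  a set of dimension at most s, and the mass distribution principle shows that a set of positive mass
  without heavy points has dimension larger than s. Therefore the part of index at most s of any
  dimension disintegration of \<open>\<sigma>\<close> is the restriction of \<open>\<sigma>\<close> to its heavy points
  (\<open>disint_part_eq_heavy_points\<close>).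

  This makes the random variable \<open>Y\<^sub>\<gamma> = \<nu>\<^sub>\<gamma>([0,s])\<close> tractable. It is almost surely a countable limit
  of expressions in the masses \<open>\<lambda>\<^sub>\<infinity>(\<Delta>\<^sub>\<tau>)\<close> of the cylinders inside \<open>\<Delta>\<^sub>\<gamma>\<close> (\<open>heavy_mass\<close>), which are
  limits of sums of products of weights. So, up to a null set, \<open>Y\<^sub>\<gamma>\<close> is measurable, it only involves
  the weights on the path to \<open>\<gamma>\<close> and below \<open>\<gamma>\<close>, and an automorphism of the tree permutes the \<open>Y\<^sub>\<gamma>\<close> as it permutes the
  words. The generator draws each level independently, with kernels that depend on the path only;
  by induction on the levels (\<open>nn_integral_pull_eq\<close>) this has two consequences. Given the first
  \<open>n = |\<gamma>|\<close> levels, the expectation of \<open>Y\<^sub>\<gamma>\<close> depends on the path to \<open>\<gamma>\<close> alone (\<open>nn_integral_line_of\<close>),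
  and the expectations of \<open>Y\<^sub>\<gamma>\<^sub>i\<close> agree for all children \<open>\<gamma>i\<close> of \<open>\<gamma>\<close> (\<open>nn_integral_heavy_limit_sibling\<close>).

  The first consequence makes \<open>F\<^sub>\<gamma>\<close> a function of the path. The second one, with the additivity
  \<open>Y\<^sub>\<gamma> = \<Sum>\<^sub>i Y\<^sub>\<gamma>\<^sub>i\<close>, says that \<open>E[Y\<^sub>\<gamma> | \<F>\<^sub>n]\<close> is split evenly among the b children in conditional mean, so
  that the density \<open>b\<^sup>n E[Y\<^bsub>t|n\<^esub> | \<F>\<^sub>n]\<close> of the weighted cascade is a martingale. Fatou's lemma gives
  \<open>E[Y\<^sub>\<gamma> | \<F>\<^sub>n] \<le> \<lambda>\<^sub>n(\<Delta>\<^sub>\<gamma>)\<close>, i.e. \<open>F\<^sub>\<gamma> \<le> 1\<close>, and subtraction from the unweighted cascade takes care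
  of the complementary weights. Finally, the mass of \<open>\<Delta>\<^sub>\<gamma>\<close> under the weighted cascade at level n is
  \<open>E[Y\<^sub>\<gamma> | \<F>\<^sub>n]\<close>, which converges to \<open>Y\<^sub>\<gamma>\<close> by Levy's upward theorem (\<open>cond_exp_converges\<close>), and on
  the compact boundary convergence on cylinders is weak convergence (\<open>tree_weak_convI\<close>).
\<close>

section \<open>Words, cylinders and locally constant functions\<close>

definition descendants :: "nat \<Rightarrow> nat list \<Rightarrow> nat \<Rightarrow> nat list set" where
  "descendants b \<gamma> m = {\<tau> \<in> tree_words b. length \<tau> = m \<and> take (length \<gamma>) \<tau> = \<gamma>}"

lemma length_pre [simp]: "length (pre t n) = n"
  by (simp add: pre_def)

lemma nth_pre [simp]: "i < n \<Longrightarrow> pre t n ! i = t i"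
  by (simp add: pre_def)

lemma take_pre [simp]: "take k (pre t n) = pre t (min k n)"
  by (simp add: pre_def take_map take_upt min_def)

lemma pre_Suc: "pre t (Suc n) = pre t n @ [t n]"
  by (simp add: pre_def)

lemma pre_0 [simp]: "pre t 0 = []"
  by (simp add: pre_def)

lemma pre_eq_iff: "pre s n = pre t n \<longleftrightarrow> (\<forall>i<n. s i = t i)"
  by (auto simp: pre_def)

lemma pre_in_tree_words: "t \<in> tree_boundary b \<Longrightarrow> pre t n \<in> tree_words b"
  by (auto simp: tree_words_def tree_boundary_def pre_def)

lemma take_in_tree_words: "\<gamma> \<in> tree_words b \<Longrightarrow> take k \<gamma> \<in> tree_words b"
  by (auto simp: tree_words_def dest: in_set_takeD)

lemma Nil_in_tree_words [simp]: "[] \<in> tree_words b"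
  by (simp add: tree_words_def)

lemma append_in_tree_words: "\<gamma> \<in> tree_words b \<Longrightarrow> i < b \<Longrightarrow> \<gamma> @ [i] \<in> tree_words b"
  by (auto simp: tree_words_def)

lemma nth_tree_words: "\<gamma> \<in> tree_words b \<Longrightarrow> i < length \<gamma> \<Longrightarrow> \<gamma> ! i < b"
  using nth_mem[of i \<gamma>] unfolding tree_words_def by blast

lemma finite_words_length: "finite {\<tau> \<in> tree_words b. length \<tau> = m}"
  using finite_lists_length_eq[of "{..<b}" m] by (auto simp: tree_words_def)

lemma finite_words_le: "finite {\<tau> \<in> tree_words b. length \<tau> \<le> m}"
  using finite_lists_length_le[of "{..<b}" m] by (auto simp: tree_words_def)

lemma countable_tree_words: "countable (tree_words b)"
  by simp

lemma finite_descendants [simp]: "finite (descendants b \<gamma> m)"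
  by (rule finite_subset[OF _ finite_words_length[of b m]]) (auto simp: descendants_def)

lemma descendants_words: "\<tau> \<in> descendants b \<gamma> m \<Longrightarrow> \<tau> \<in> tree_words b"
  and descendants_length: "\<tau> \<in> descendants b \<gamma> m \<Longrightarrow> length \<tau> = m"
  by (auto simp: descendants_def)

lemma descendants_self: "\<gamma> \<in> tree_words b \<Longrightarrow> descendants b \<gamma> (length \<gamma>) = {\<gamma>}"
  by (auto simp: descendants_def)

lemma descendants_short: "m < length \<gamma> \<Longrightarrow> descendants b \<gamma> m = {}"
  by (auto simp: descendants_def dest: arg_cong[of _ _ length])

lemma descendants_children:
  assumes "\<gamma> \<in> tree_words b"
  shows "descendants b \<gamma> (Suc (length \<gamma>)) = (\<lambda>i. \<gamma> @ [i]) ` {..<b}"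
proof
  show "descendants b \<gamma> (Suc (length \<gamma>)) \<subseteq> (\<lambda>i. \<gamma> @ [i]) ` {..<b}"
  proof
    fix \<tau> assume \<tau>: "\<tau> \<in> descendants b \<gamma> (Suc (length \<gamma>))"
    then have "\<tau> = take (length \<gamma>) \<tau> @ [\<tau> ! length \<gamma>]"
      by (metis descendants_length take_Suc_conv_app_nth lessI order_refl take_all)
    with \<tau> show "\<tau> \<in> (\<lambda>i. \<gamma> @ [i]) ` {..<b}"
      by (intro image_eqI[of _ _ "\<tau> ! length \<gamma>"])
        (auto simp: descendants_def tree_words_def subset_iff)
  qed
qed (use assms in \<open>auto simp: descendants_def tree_words_def\<close>)

lemma descendants_UN:
  assumes "length \<gamma> \<le> k" "k \<le> m"
  shows "descendants b \<gamma> m = (\<Union>\<tau>\<in>descendants b \<gamma> k. descendants b \<tau> m)"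
proof
  show "descendants b \<gamma> m \<subseteq> (\<Union>\<tau>\<in>descendants b \<gamma> k. descendants b \<tau> m)"
  proof
    fix \<tau> assume "\<tau> \<in> descendants b \<gamma> m"
    then show "\<tau> \<in> (\<Union>\<tau>\<in>descendants b \<gamma> k. descendants b \<tau> m)"
      using assms by (intro UN_I[of "take k \<tau>"])
        (auto simp: descendants_def take_in_tree_words min_def)
  qed
qed (use assms in \<open>auto simp: descendants_def min_def dest: arg_cong[of _ _ "take (length \<gamma>)"]\<close>)

lemma sum_descendants:
  fixes f :: "nat list \<Rightarrow> 'a::comm_monoid_add"
  assumes "length \<gamma> \<le> k" "k \<le> m"
  shows "(\<Sum>\<tau>\<in>descendants b \<gamma> m. f \<tau>) = (\<Sum>\<tau>\<in>descendants b \<gamma> k. \<Sum>\<tau>'\<in>descendants b \<tau> m. f \<tau>')"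
  unfolding descendants_UN[OF assms]
  by (rule sum.UNION_disjoint) (simp, simp, auto simp: descendants_def)

lemma space_tree_borel [simp]: "space (tree_borel b) = tree_boundary b"
  by (simp add: tree_borel_def space_restrict_space)

lemma cyl_subset: "cyl b \<gamma> \<subseteq> tree_boundary b"
  by (auto simp: cyl_def)

lemma mem_cyl_pre: "t \<in> tree_boundary b \<Longrightarrow> t \<in> cyl b (pre t n)"
  by (simp add: cyl_def)

lemma cyl_Nil: "cyl b [] = tree_boundary b"
  by (simp add: cyl_def)

lemma cyl_UN:
  assumes "length \<gamma> \<le> m"
  shows "cyl b \<gamma> = (\<Union>\<tau>\<in>descendants b \<gamma> m. cyl b \<tau>)"
proof
  show "cyl b \<gamma> \<subseteq> (\<Union>\<tau>\<in>descendants b \<gamma> m. cyl b \<tau>)"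
  proof
    fix t assume "t \<in> cyl b \<gamma>"
    then show "t \<in> (\<Union>\<tau>\<in>descendants b \<gamma> m. cyl b \<tau>)"
      using assms
      by (intro UN_I[of "pre t m"]) (auto simp: cyl_def descendants_def pre_in_tree_words min_def)
  qed
next
  show "(\<Union>\<tau>\<in>descendants b \<gamma> m. cyl b \<tau>) \<subseteq> cyl b \<gamma>"
    using assms by (auto simp: cyl_def descendants_def min_def dest: arg_cong[of _ _ "take (length \<gamma>)"])
qed

lemma disjoint_cyl: "disjoint_family_on (cyl b) (descendants b \<gamma> m)"
  by (auto simp: disjoint_family_on_def cyl_def descendants_def)

lemma open_pre_eq: "open {t. pre t n = \<gamma>}"
proof (cases "length \<gamma> = n")
  case True
  then have "{t. pre t n = \<gamma>} = Pi\<^sub>E UNIV (\<lambda>i. if i < n then {\<gamma> ! i} else UNIV)"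
    by (fastforce simp: list_eq_iff_nth_eq PiE_iff split: if_splits)
  also have "open \<dots>"
    by (rule open_PiE) (simp_all add: discrete_topology_class.open_discrete)
  finally show ?thesis .
next
  case False
  then have "{t. pre t n = \<gamma>} = {}" by auto
  then show ?thesis by simp
qed

lemma continuous_on_pre:
  fixes h :: "nat list \<Rightarrow> 'a::topological_space"
  shows "continuous_on S (\<lambda>t. h (pre t n))"
proof (rule continuous_on_subset[of UNIV])
  have "(\<lambda>t. h (pre t n)) -` B = (\<Union>\<gamma>\<in>h -` B. {t. pre t n = \<gamma>})" for B
    by auto
  then show "continuous_on UNIV (\<lambda>t. h (pre t n))"
    unfolding continuous_on_open_vimage[OF open_UNIV] by (auto intro!: open_UN open_pre_eq)
qed simp

lemma borel_measurable_tree_continuous: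
  "continuous_on (tree_boundary b) f \<Longrightarrow> f \<in> borel_measurable (tree_borel b)"
  unfolding tree_borel_def by (rule borel_measurable_continuous_on_restrict)

lemma measurable_pre:
  "(\<lambda>t. h (pre t n) :: 'a::topological_space) \<in> borel_measurable (tree_borel b)"
  by (intro borel_measurable_tree_continuous continuous_on_pre)

lemma pred_pre: "Measurable.pred (tree_borel b) (\<lambda>t. R (pre t n))"
proof -
  have "(\<lambda>t. if R (pre t n) then 1 else 0::real) \<in> borel_measurable (tree_borel b)"
    by (rule measurable_pre)
  then have "Measurable.pred (tree_borel b) (\<lambda>t. (if R (pre t n) then 1 else 0::real) = 1)"
    by measurable
  then show ?thesis by (simp split: if_splits)
qed

lemma cyl_in_sets [simp, intro]: "cyl b \<gamma> \<in> sets (tree_borel b)"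
proof -
  have "{t \<in> space (tree_borel b). pre t (length \<gamma>) = \<gamma>} \<in> sets (tree_borel b)"
    using pred_pre[where b = b and n = "length \<gamma>" and R = "\<lambda>\<tau>. \<tau> = \<gamma>"] by (simp add: pred_def)
  then show ?thesis by (simp add: cyl_def)
qed

lemma indicator_cyl_pre:
  "t \<in> tree_boundary b \<Longrightarrow> indicator (cyl b \<gamma>) t = of_bool (pre t (length \<gamma>) = \<gamma>)"
  by (simp add: cyl_def indicator_def)

text \<open>The indicator of a cylinder is an admissible test function for weak convergence.\<close>

lemma continuous_on_indicator_cyl:
  "continuous_on (tree_boundary b) (indicator (cyl b \<gamma>) :: _ \<Rightarrow> real)"
  by (rule continuous_on_eq[OF continuous_on_pre[of _ "\<lambda>\<tau>. of_bool (\<tau> = \<gamma>)" "length \<gamma>"]])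
    (simp add: indicator_cyl_pre)

lemma emeasure_cyl_UN:
  assumes "sets M = sets (tree_borel b)"
    and B: "\<And>\<tau>. \<tau> \<in> descendants b \<gamma> m \<Longrightarrow> B \<tau> \<subseteq> cyl b \<tau> \<and> B \<tau> \<in> sets M"
  shows "emeasure M (\<Union>\<tau>\<in>descendants b \<gamma> m. B \<tau>) = (\<Sum>\<tau>\<in>descendants b \<gamma> m. emeasure M (B \<tau>))"
proof (rule sum_emeasure[symmetric])
  show "disjoint_family_on B (descendants b \<gamma> m)"
    unfolding disjoint_family_on_def
  proof (intro ballI impI)
    fix \<sigma> \<tau> assume *: "\<sigma> \<in> descendants b \<gamma> m" "\<tau> \<in> descendants b \<gamma> m" "\<sigma> \<noteq> \<tau>"
    then have "cyl b \<sigma> \<inter> cyl b \<tau> = {}"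
      by (rule disjoint_family_onD[OF disjoint_cyl])
    with B[OF *(1)] B[OF *(2)] show "B \<sigma> \<inter> B \<tau> = {}"
      by blast
  qed
  show "B ` descendants b \<gamma> m \<subseteq> sets M"
    using B by blast
qed simp

lemma emeasure_cyl_descendants:
  assumes "sets M = sets (tree_borel b)" "length \<gamma> \<le> m"
  shows "emeasure M (cyl b \<gamma>) = (\<Sum>\<tau>\<in>descendants b \<gamma> m. emeasure M (cyl b \<tau>))"
proof -
  have "emeasure M (\<Union>\<tau>\<in>descendants b \<gamma> m. cyl b \<tau>) = (\<Sum>\<tau>\<in>descendants b \<gamma> m. emeasure M (cyl b \<tau>))"
    by (rule emeasure_cyl_UN) (simp_all add: assms(1))
  then show ?thesis
    by (simp only: cyl_UN[OF assms(2), of b])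
qed

section \<open>Hausdorff dimension and the heavy points of a measure\<close>

definition heavy_bound :: "nat \<Rightarrow> real \<Rightarrow> nat \<Rightarrow> nat \<Rightarrow> real" where
  "heavy_bound b s N n = 1 / real b powr (real n * (s + 1 / real (Suc N)))"

text \<open>
  The points at which the lower local dimension
  \<open>liminf log \<sigma>(\<Delta>\<^bsub>t|n\<^esub>) / (- n log b)\<close> is at most s. The tolerance \<open>1 / (N + 1)\<close> in the exponent is
  tied to the starting level N, so that a single quantifier covers both limits.
\<close>

definition heavy_points :: "nat \<Rightarrow> real \<Rightarrow> (nat \<Rightarrow> nat) measure \<Rightarrow> (nat \<Rightarrow> nat) set" where
  "heavy_points b s \<sigma> = {t \<in> tree_boundary b.
     \<forall>N. \<exists>n\<ge>N. ennreal (heavy_bound b s N n) \<le> emeasure \<sigma> (cyl b (pre t n))}"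

lemma heavy_points_in_sets [simp]: "heavy_points b s \<sigma> \<in> sets (tree_borel b)"
proof -
  have "Measurable.pred (tree_borel b)
      (\<lambda>t. N \<le> n \<and> ennreal (heavy_bound b s N n) \<le> emeasure \<sigma> (cyl b (pre t n)))" for N n
    by (rule pred_pre[where R = "\<lambda>\<tau>. N \<le> n \<and> ennreal (heavy_bound b s N n) \<le> emeasure \<sigma> (cyl b \<tau>)"])
  then have "Measurable.pred (tree_borel b)
      (\<lambda>t. \<forall>N. \<exists>n. N \<le> n \<and> ennreal (heavy_bound b s N n) \<le> emeasure \<sigma> (cyl b (pre t n)))"
    by (intro pred_intros_countable)
  then show ?thesis
    unfolding heavy_points_def pred_def space_tree_borel .
qed

lemma tree_dist_le_imp_pre_eq:
  assumes "b \<ge> 2" "tree_dist b u v \<le> 1 / real b ^ Suc n"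
  shows "pre u n = pre v n"
proof -
  have "1 / real b ^ Suc n < 1 / real b ^ n"
    using assms(1) by (simp add: divide_simps)
  with assms have "tree_dist b u v < 1 / real b ^ n" by simp
  then show ?thesis
    unfolding pre_eq_iff using tree_dist_less_iff[OF assms(1)] by blast
qed

lemma tree_dist_nonneg: "0 \<le> tree_dist b u v"
  by (simp add: tree_dist_def)

lemma tree_diam_nonneg: "0 \<le> tree_diam b U"
  by (simp add: tree_diam_def)

lemma tree_diam_le:
  assumes "\<And>u v. u \<in> U \<Longrightarrow> v \<in> U \<Longrightarrow> tree_dist b u v \<le> r" "0 \<le> r"
  shows "tree_diam b U \<le> r"
  unfolding tree_diam_def
  by (intro enn2real_leI SUP_least) (use assms in \<open>auto intro: ennreal_leI\<close>)

lemma tree_dist_le_tree_diam: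
  assumes "b \<ge> 2" "u \<in> U" "v \<in> U"
  shows "tree_dist b u v \<le> tree_diam b U"
proof -
  have le1: "tree_dist b s t \<le> 1" for s t
    using one_le_power[of "real b" "Suc (LEAST n. s n \<noteq> t n)"] assms(1)
    by (simp add: tree_dist_def divide_le_eq_1 del: power_Suc)
  have "(SUP s\<in>U. SUP t\<in>U. ennreal (tree_dist b s t)) \<le> ennreal 1"
    by (intro SUP_least) (use le1 in \<open>auto intro!: ennreal_leI simp del: ennreal_1\<close>)
  then have fin: "(SUP s\<in>U. SUP t\<in>U. ennreal (tree_dist b s t)) < top"
    by (rule le_less_trans) simp
  have "ennreal (tree_dist b u v) \<le> (SUP s\<in>U. SUP t\<in>U. ennreal (tree_dist b s t))"
    by (rule SUP_upper2[OF assms(2)], rule SUP_upper2[OF assms(3)]) simp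
  from enn2real_mono[OF this fin] show ?thesis
    by (simp add: tree_diam_def tree_dist_nonneg)
qed

lemma tree_diam_cyl_le:
  assumes "b \<ge> 2"
  shows "tree_diam b (cyl b \<gamma>) \<le> 1 / real b ^ length \<gamma>"
proof (rule tree_diam_le)
  fix u v assume "u \<in> cyl b \<gamma>" "v \<in> cyl b \<gamma>"
  then have "pre u (length \<gamma>) = pre v (length \<gamma>)" by (simp add: cyl_def)
  then show "tree_dist b u v \<le> 1 / real b ^ length \<gamma>"
    using tree_dist_less_iff[OF assms, of u v "length \<gamma>"] by (simp add: pre_eq_iff less_imp_le)
qed simp

text \<open>
  Covers by cylinders come indexed by words, while those in the Hausdorff premeasure are sequences.
\<close>

lemma suminf_countable_reindex:
  fixes f :: "'a::countable \<Rightarrow> ennreal"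
  shows "(\<Sum>i. if i \<in> to_nat ` G then f (from_nat i) else 0) = (\<integral>\<^sup>+x. f x \<partial>count_space G)"
proof -
  have "(\<Sum>i. if i \<in> to_nat ` G then f (from_nat i) else 0) =
      (\<integral>\<^sup>+i. (if i \<in> to_nat ` G then f (from_nat i) else 0) \<partial>count_space UNIV)"
    by (simp add: nn_integral_count_space_nat)
  also have "\<dots> = (\<integral>\<^sup>+i. f (from_nat i) * indicator (to_nat ` G) i \<partial>count_space UNIV)"
    by (intro nn_integral_cong) (simp split: split_indicator)
  also have "\<dots> = (\<integral>\<^sup>+i. f (from_nat i) \<partial>count_space (to_nat ` G))"
    by (simp add: nn_integral_count_space_indicator)
  also have "\<dots> = (\<integral>\<^sup>+x. f x \<partial>count_space G)"
    by (subst nn_integral_bij_count_space[symmetric, of to_nat G "to_nat ` G"])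
      (auto simp: bij_betw_def intro: inj_on_subset[OF inj_to_nat])
  finally show ?thesis .
qed

text \<open>
  A measure of total mass m has at most \<open>m b\<^bsup>n a\<^esup>\<close> cylinders of level n with mass at least
  \<open>b\<^bsup>- n a\<^esup>\<close>. Covering by these cylinders, for all n from some M on, leaves a geometric tail for
  every exponent larger than a.
\<close>

lemma hausdorff_measure_heavy_zero:
  assumes b: "b \<ge> 2" and \<sigma>: "finite_measure \<sigma>" "sets \<sigma> = sets (tree_borel b)"
    and a: "a < s'" "0 \<le> a"
    and E: "E \<subseteq> tree_boundary b"
      "\<And>t M. t \<in> E \<Longrightarrow> \<exists>n\<ge>M. ennreal (1 / real b powr (real n * a)) \<le> emeasure \<sigma> (cyl b (pre t n))"
  shows "hausdorff_measure b s' E = 0"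
proof -
  interpret finite_measure \<sigma> by fact
  define c where "c = real b powr (a - s')"
  have c: "0 \<le> c" "c < 1"
    using b a by (auto simp: c_def powr_less_one)
  define mT where "mT = measure \<sigma> (tree_boundary b)"
  define G where "G M = {\<gamma> \<in> tree_words b. M \<le> length \<gamma> \<and>
     ennreal (1 / real b powr (real (length \<gamma>) * a)) \<le> emeasure \<sigma> (cyl b \<gamma>)}" for M
  \<comment> \<open>Paying for each cylinder of the cover with its mass avoids counting cylinders explicitly.\<close>
  have each: "ennreal (tree_diam b (cyl b \<gamma>) powr s') \<le> emeasure \<sigma> (cyl b \<gamma>) * ennreal (c ^ length \<gamma>)"
    if "\<gamma> \<in> G M" for \<gamma> M
  proof -
    let ?n = "length \<gamma>"
    have "tree_diam b (cyl b \<gamma>) powr s' \<le> (1 / real b ^ ?n) powr s'"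
      using a by (intro powr_mono2 tree_diam_nonneg tree_diam_cyl_le b) auto
    also have "(1 / real b ^ ?n) powr s' = (1 / real b powr (real ?n * a)) * c ^ ?n"
      using b by (simp add: c_def powr_divide powr_powr powr_realpow[symmetric] powr_minus_divide
          powr_diff divide_simps right_diff_distrib powr_add[symmetric] algebra_simps flip: powr_add)
    finally have "ennreal (tree_diam b (cyl b \<gamma>) powr s') \<le> ennreal (1 / real b powr (real ?n * a)) * ennreal (c ^ ?n)"
      using c by (subst ennreal_mult[symmetric]) (auto intro: ennreal_leI)
    also have "\<dots> \<le> emeasure \<sigma> (cyl b \<gamma>) * ennreal (c ^ ?n)"
      using that by (intro mult_right_mono) (auto simp: G_def)
    finally show ?thesis .
  qed
  have tail: "(\<integral>\<^sup>+\<gamma>. ennreal (tree_diam b (cyl b \<gamma>) powr s') \<partial>count_space (G M)) \<le> ennreal (mT * (c ^ M / (1 - c)))" for M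
  proof -
    have lev: "(\<integral>\<^sup>+\<gamma>. emeasure \<sigma> (cyl b \<gamma>) * indicator (descendants b [] n) \<gamma> \<partial>count_space UNIV) = ennreal mT" for n
    proof -
      have "(\<integral>\<^sup>+\<gamma>. emeasure \<sigma> (cyl b \<gamma>) * indicator (descendants b [] n) \<gamma> \<partial>count_space UNIV) =
          (\<integral>\<^sup>+\<gamma>. emeasure \<sigma> (cyl b \<gamma>) \<partial>count_space (descendants b [] n))"
        by (simp add: nn_integral_count_space_indicator)
      also have "\<dots> = (\<Sum>\<gamma>\<in>descendants b [] n. emeasure \<sigma> (cyl b \<gamma>))"
        by (rule nn_integral_count_space_finite) simp
      also have "\<dots> = ennreal mT"
        using emeasure_cyl_descendants[OF \<sigma>(2), of "[]" n] by (simp add: cyl_Nil mT_def emeasure_eq_measure)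
      finally show ?thesis .
    qed
    have "(\<integral>\<^sup>+\<gamma>. ennreal (tree_diam b (cyl b \<gamma>) powr s') \<partial>count_space (G M)) =
        (\<integral>\<^sup>+\<gamma>. ennreal (tree_diam b (cyl b \<gamma>) powr s') * indicator (G M) \<gamma> \<partial>count_space UNIV)"
      by (simp add: nn_integral_count_space_indicator)
    also have "\<dots> \<le> (\<integral>\<^sup>+\<gamma>. (\<Sum>n. ennreal (c ^ (n + M)) *
        (emeasure \<sigma> (cyl b \<gamma>) * indicator (descendants b [] (n + M)) \<gamma>)) \<partial>count_space UNIV)"
    proof (intro nn_integral_mono)
      fix \<gamma>
      show "ennreal (tree_diam b (cyl b \<gamma>) powr s') * indicator (G M) \<gamma> \<le> (\<Sum>n. ennreal (c ^ (n + M)) *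
        (emeasure \<sigma> (cyl b \<gamma>) * indicator (descendants b [] (n + M)) \<gamma>))" (is "_ \<le> (\<Sum>n. ?h n)")
      proof (cases "\<gamma> \<in> G M")
        case True
        then have "\<gamma> \<in> descendants b [] (length \<gamma> - M + M)"
          by (auto simp: G_def descendants_def)
        with True each[OF True] have "ennreal (tree_diam b (cyl b \<gamma>) powr s') * indicator (G M) \<gamma> \<le> ?h (length \<gamma> - M)"
          by (simp add: mult.commute G_def)
        also have "?h (length \<gamma> - M) \<le> (\<Sum>n. ?h n)"
          using sum_le_suminf[OF summableI, of "{length \<gamma> - M}" ?h] by simp
        finally show ?thesis .
      qed simp
    qed
    also have "\<dots> = (\<Sum>n. ennreal (c ^ (n + M)) * ennreal mT)"
      by (subst nn_integral_suminf) (simp_all add: nn_integral_cmult lev)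
    also have "\<dots> = (\<Sum>n. ennreal (mT * c ^ M * c ^ n))"
      using c by (intro suminf_cong) (simp add: ennreal_mult[symmetric] mT_def power_add mult_ac)
    also have "\<dots> = ennreal (mT * c ^ M * (1 / (1 - c)))"
      using c by (intro suminf_ennreal_eq sums_mult geometric_sums) (auto simp: mT_def)
    finally show ?thesis by simp
  qed
  have "hausdorff_premeasure b s' \<delta> E = 0" if \<delta>: "\<delta> > 0" for \<delta>
  proof -
    have le: "hausdorff_premeasure b s' \<delta> E \<le> ennreal (mT * (c ^ M / (1 - c)))"
      if M: "1 / real b ^ M \<le> \<delta>" for M
    proof -
      define U where "U i = (if i \<in> to_nat ` G M then cyl b (from_nat i) else {})" for i :: nat
      have diam_empty: "tree_diam b {} = 0"
        by (simp add: tree_diam_def bot_ennreal)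
      have "tree_diam b (U i) \<le> \<delta>" for i
      proof (cases "i \<in> to_nat ` G M")
        case True
        then obtain \<gamma> where \<gamma>: "\<gamma> \<in> G M" "i = to_nat \<gamma>" by auto
        have "tree_diam b (cyl b \<gamma>) \<le> 1 / real b ^ length \<gamma>"
          by (rule tree_diam_cyl_le[OF b])
        also have "\<dots> \<le> 1 / real b ^ M"
          using \<gamma> b by (intro divide_left_mono power_increasing) (auto simp: G_def)
        finally show ?thesis using M \<gamma> by (simp add: U_def)
      qed (use \<delta> in \<open>simp add: U_def diam_empty\<close>)
      moreover have "U i \<subseteq> tree_boundary b" for i
        by (auto simp: U_def dest: subsetD[OF cyl_subset])
      moreover have "E \<subseteq> (\<Union>i. U i)"
      proof
        fix t assume t: "t \<in> E"
        from E(2)[OF this, of M] obtain n where "n \<ge> M"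
            "ennreal (1 / real b powr (real n * a)) \<le> emeasure \<sigma> (cyl b (pre t n))" by blast
        then have "pre t n \<in> G M" using t E(1) by (auto simp: G_def pre_in_tree_words)
        then have "U (to_nat (pre t n)) = cyl b (pre t n)" by (simp add: U_def)
        moreover have "t \<in> cyl b (pre t n)" using t E(1) mem_cyl_pre by blast
        ultimately show "t \<in> (\<Union>i. U i)" by blast
      qed
      ultimately have "hausdorff_premeasure b s' \<delta> E \<le> (\<Sum>i. ennreal (tree_diam b (U i) powr s'))"
        unfolding hausdorff_premeasure_def by (intro INF_lower) auto
      also have "\<dots> = (\<Sum>i. if i \<in> to_nat ` G M then ennreal (tree_diam b (cyl b (from_nat i)) powr s') else 0)"
        by (intro suminf_cong) (simp add: U_def diam_empty)
      also have "\<dots> = (\<integral>\<^sup>+\<gamma>. ennreal (tree_diam b (cyl b \<gamma>) powr s') \<partial>count_space (G M))"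
        by (rule suminf_countable_reindex)
      finally show ?thesis using tail[of M] by simp
    qed
    have "(\<lambda>M. mT * (c ^ M / (1 - c))) \<longlonglongrightarrow> mT * (0 / (1 - c))"
      using c by (intro tendsto_intros LIMSEQ_power_zero) auto
    then have lim: "(\<lambda>M. ennreal (mT * (c ^ M / (1 - c)))) \<longlonglongrightarrow> 0"
      using tendsto_ennrealI by fastforce
    have "(\<lambda>M. (1 / real b) ^ M) \<longlonglongrightarrow> 0"
      using b by (intro LIMSEQ_power_zero) simp
    from order_tendstoD(2)[OF this \<delta>] have "eventually (\<lambda>M. 1 / real b ^ M \<le> \<delta>) sequentially"
      by eventually_elim (simp add: power_one_over)
    then have "eventually (\<lambda>M. hausdorff_premeasure b s' \<delta> E \<le> ennreal (mT * (c ^ M / (1 - c)))) sequentially"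
      by eventually_elim (rule le)
    from tendsto_lowerbound[OF lim this] show ?thesis by simp
  qed
  then show ?thesis
    unfolding hausdorff_measure_def by (auto intro!: SUP_eqI)
qed

lemma hausdorff_dim_heavy_points:
  assumes b: "b \<ge> 2" and \<sigma>: "finite_measure \<sigma>" "sets \<sigma> = sets (tree_borel b)" and s: "0 \<le> s"
  shows "hausdorff_dim b (heavy_points b s \<sigma>) \<le> ennreal s"
proof (rule ennreal_le_epsilon)
  fix e :: real assume e: "0 < e"
  obtain K where K: "1 / real (Suc K) < e"
    using nat_approx_posE[OF e] .
  have "hausdorff_measure b (s + e) (heavy_points b s \<sigma>) = 0"
  proof (rule hausdorff_measure_heavy_zero[OF b \<sigma>])
    show "s + 1 / real (Suc K) < s + e" "0 \<le> s + 1 / real (Suc K)" using K s by auto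
    fix t M assume t: "t \<in> heavy_points b s \<sigma>"
    obtain n where n: "max K M \<le> n" "ennreal (heavy_bound b s (max K M) n) \<le> emeasure \<sigma> (cyl b (pre t n))"
      using t unfolding heavy_points_def by blast
    have "1 / real (Suc (max K M)) \<le> 1 / real (Suc K)"
      by (intro divide_left_mono) auto
    then have "real b powr (real n * (s + 1 / real (Suc (max K M)))) \<le> real b powr (real n * (s + 1 / real (Suc K)))"
      using b by (intro powr_mono mult_left_mono add_left_mono) auto
    then have "1 / real b powr (real n * (s + 1 / real (Suc K))) \<le> heavy_bound b s (max K M) n"
      using b by (auto simp: heavy_bound_def intro!: divide_left_mono)
    with n show "\<exists>n\<ge>M. ennreal (1 / real b powr (real n * (s + 1 / real (Suc K)))) \<le> emeasure \<sigma> (cyl b (pre t n))"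
      by (intro exI[of _ n]) (auto intro: order_trans[OF ennreal_leI])
  qed (auto simp: heavy_points_def)
  then have "hausdorff_dim b (heavy_points b s \<sigma>) \<le> ennreal (s + e)"
    unfolding hausdorff_dim_def using e s by (intro INF_lower) auto
  then show "hausdorff_dim b (heavy_points b s \<sigma>) \<le> ennreal s + ennreal e"
    using e s by simp
qed

text \<open>
  The mass distribution principle. A set of diameter \<open>r > 0\<close> lies in one cylinder of level n, where
  \<open>b\<^bsup>- n - 2\<^esup> < r \<le> b\<^bsup>- n - 1\<^esup>\<close>; the two levels lost in this comparison are the factor \<open>b\<^bsup>2 a\<^esup>\<close>. A set of
  diameter 0 is at most a point, and the bounds on E exclude point masses.
\<close>

lemma mass_distribution_cover:
  assumes b: "b \<ge> 2" and \<sigma>: "sets \<sigma> = sets (tree_borel b)"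
    and a: "0 < s'" "s' \<le> a"
    and E: "E \<subseteq> tree_boundary b"
      "\<And>t n. t \<in> E \<Longrightarrow> N \<le> n \<Longrightarrow> emeasure \<sigma> (cyl b (pre t n)) \<le> ennreal (1 / real b powr (real n * a))"
    and U: "U \<subseteq> tree_boundary b" "tree_diam b U \<le> 1 / real b ^ Suc N"
  shows "\<exists>C\<in>sets \<sigma>. U \<inter> E \<subseteq> C \<and>
     emeasure \<sigma> C \<le> ennreal (real b powr (2 * a)) * ennreal (tree_diam b U powr s')"
proof (cases "U \<inter> E = {}")
  case True
  then show ?thesis by (intro bexI[of _ "{}"]) auto
next
  case False
  then obtain u where u: "u \<in> U" "u \<in> E" by blast
  have sub: "U \<inter> E \<subseteq> cyl b (pre u n)" if "tree_diam b U \<le> 1 / real b ^ Suc n" for n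
  proof
    fix v assume v: "v \<in> U \<inter> E"
    have "tree_dist b v u \<le> tree_diam b U"
      using v u by (intro tree_dist_le_tree_diam[OF b]) auto
    then have "pre v n = pre u n"
      using that by (intro tree_dist_le_imp_pre_eq[OF b]) linarith
    then show "v \<in> cyl b (pre u n)" using v U by (auto simp: cyl_def)
  qed
  define r where "r = tree_diam b U"
  have r0: "0 \<le> r" by (simp add: r_def tree_diam_nonneg)
  show ?thesis
  proof (cases "r = 0")
    case True
    let ?C = "\<Inter>n. cyl b (pre u n)"
    have C: "?C \<in> sets \<sigma>" by (auto simp: \<sigma>)
    have "emeasure \<sigma> ?C \<le> ennreal (1 / real b powr (real n * a))" if "N \<le> n" for n
      using E(2)[OF u(2) that] by (rule order_trans[rotated]) (auto intro!: emeasure_mono simp: \<sigma>)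
    then have "eventually (\<lambda>n. emeasure \<sigma> ?C \<le> ennreal (1 / real b powr (real n * a))) sequentially"
      by (auto simp: eventually_sequentially)
    moreover have "(\<lambda>n. ennreal (1 / real b powr (real n * a))) \<longlonglongrightarrow> 0"
    proof -
      have "1 / real b powr (real n * a) = (1 / real b powr a) ^ n" for n
        using b by (simp add: power_one_over powr_powr[symmetric] powr_realpow mult.commute flip: powr_powr)
      moreover have "(\<lambda>n. (1 / real b powr a) ^ n) \<longlonglongrightarrow> 0"
        using b a by (intro LIMSEQ_power_zero) (simp add: divide_simps)
      ultimately show ?thesis
        using tendsto_ennrealI by fastforce
    qed
    ultimately have "emeasure \<sigma> ?C \<le> 0"
      by (intro tendsto_lowerbound) auto
    with C show ?thesis
      using sub True by (intro bexI[of _ ?C]) (auto simp: r_def)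
  next
    case False
    with r0 have r: "0 < r" by simp
    have "\<exists>n. 1 / real b ^ (n + 2) < r"
    proof -
      obtain n where "(1 / real b) ^ n < r"
        using real_arch_pow_inv[of r "1 / real b"] r b by auto
      moreover have "1 / real b ^ (n + 2) \<le> (1 / real b) ^ n"
        using b unfolding power_one_over by (intro divide_left_mono power_increasing) auto
      ultimately show ?thesis by (intro exI[of _ n]) linarith
    qed
    \<comment> \<open>Minimality of n gives \<open>r \<le> b\<^bsup>- n - 1\<^esup>\<close>; for \<open>n = 0\<close> this comes from the bound on the diameter.\<close>
    define n where "n = (LEAST n. 1 / real b ^ (n + 2) < r)"
    have n: "1 / real b ^ (n + 2) < r"
      unfolding n_def by (rule LeastI_ex) fact
    have n': "N \<le> n \<and> r \<le> 1 / real b ^ Suc n"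
    proof (cases n)
      case 0
      have "N = 0"
      proof (rule ccontr)
        assume "N \<noteq> 0"
        then have "1 / real b ^ Suc N \<le> 1 / real b ^ 2"
          using b by (intro divide_left_mono power_increasing) auto
        with U(2) n 0 show False by (simp add: r_def power2_eq_square)
      qed
      with U(2) 0 show ?thesis by (simp add: r_def)
    next
      case (Suc m)
      then have m: "r \<le> 1 / real b ^ (m + 2)"
        using not_less_Least[of m "\<lambda>n. 1 / real b ^ (n + 2) < r"] by (simp add: n_def)
      moreover have "N \<le> n"
      proof (rule ccontr)
        assume "\<not> N \<le> n"
        then have "1 / real b ^ Suc N \<le> 1 / real b ^ (n + 2)"
          using b by (intro divide_left_mono power_increasing) auto
        with U(2) n show False by (simp add: r_def)
      qed
      ultimately show ?thesis using Suc by simp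
    qed
    have r1: "r \<le> 1"
    proof -
      have "1 / real b ^ Suc n \<le> 1"
        using b one_le_power[of "real b" "Suc n"] by (simp add: divide_le_eq_1 del: power_Suc)
      with n' show ?thesis by linarith
    qed
    have "emeasure \<sigma> (cyl b (pre u n)) \<le> ennreal (1 / real b powr (real n * a))"
      using E(2)[OF u(2)] n' by blast
    also have "1 / real b powr (real n * a) = real b powr (2 * a) * (1 / real b ^ (n + 2)) powr a"
    proof -
      have "(1 / real b ^ (n + 2)) powr a = real b powr (- (real (n + 2) * a))"
        using b by (simp add: powr_divide powr_powr powr_realpow[symmetric] powr_minus_divide
            del: power_Suc add_2_eq_Suc' of_nat_add)
      then show ?thesis
        using b by (simp add: powr_minus_divide[symmetric] powr_add[symmetric] algebra_simps)
    qed
    also have "\<dots> \<le> real b powr (2 * a) * r powr s'"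
    proof (intro mult_left_mono)
      have "(1 / real b ^ (n + 2)) powr a \<le> r powr a"
        using n a b by (intro powr_mono2) auto
      also have "\<dots> \<le> r powr s'"
        using r r1 a by (intro powr_mono') auto
      finally show "(1 / real b ^ (n + 2)) powr a \<le> r powr s'" .
    qed simp
    finally show ?thesis
      using sub[of n] n' by (intro bexI[of _ "cyl b (pre u n)"])
        (auto simp: \<sigma> r_def ennreal_mult[symmetric] intro: order_trans ennreal_leI)
  qed
qed

text \<open>
  A point that is not heavy satisfies the bounds of the mass distribution principle from some level
  N on, with exponent \<open>s + 1 / (N + 1)\<close>. One N works on a part of E of positive mass.
\<close>

lemma hausdorff_dim_light_set:
  assumes b: "b \<ge> 2" and \<sigma>: "finite_measure \<sigma>" "sets \<sigma> = sets (tree_borel b)" and s: "0 \<le> s"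
    and E: "E \<in> sets (tree_borel b)" "E \<inter> heavy_points b s \<sigma> = {}" "emeasure \<sigma> E > 0"
  shows "hausdorff_dim b E > ennreal s"
proof -
  define L where "L N = {t \<in> tree_boundary b.
     \<forall>n\<ge>N. \<not> ennreal (heavy_bound b s N n) \<le> emeasure \<sigma> (cyl b (pre t n))}" for N
  have [simp]: "L N \<in> sets (tree_borel b)" for N
  proof -
    have "Measurable.pred (tree_borel b)
        (\<lambda>t. n \<ge> N \<longrightarrow> \<not> ennreal (heavy_bound b s N n) \<le> emeasure \<sigma> (cyl b (pre t n)))" for n
      by (rule pred_pre[where R = "\<lambda>\<tau>. n \<ge> N \<longrightarrow> \<not> ennreal (heavy_bound b s N n) \<le> emeasure \<sigma> (cyl b \<tau>)"])
    then have "Measurable.pred (tree_borel b)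
        (\<lambda>t. \<forall>n. n \<ge> N \<longrightarrow> \<not> ennreal (heavy_bound b s N n) \<le> emeasure \<sigma> (cyl b (pre t n)))"
      by (intro pred_intros_countable)
    then show ?thesis
      unfolding L_def pred_def space_tree_borel .
  qed
  have Esub: "E \<subseteq> tree_boundary b"
    using sets.sets_into_space[OF E(1)] by simp
  have "E = (\<Union>N. E \<inter> L N)"
  proof (intro equalityI subsetI)
    fix t assume t: "t \<in> E"
    then have "t \<in> tree_boundary b" "t \<notin> heavy_points b s \<sigma>"
      using E(2) Esub by blast+
    with t show "t \<in> (\<Union>N. E \<inter> L N)"
      unfolding heavy_points_def L_def by blast
  qed auto
  then have "emeasure \<sigma> (\<Union>N. E \<inter> L N) \<noteq> 0"
    using E(3) by simp
  then have "\<exists>N. emeasure \<sigma> (E \<inter> L N) \<noteq> 0"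
  proof (rule contrapos_np)
    assume "\<nexists>N. emeasure \<sigma> (E \<inter> L N) \<noteq> 0"
    then show "emeasure \<sigma> (\<Union>N. E \<inter> L N) = 0"
      by (intro emeasure_UN_eq_0) (use \<sigma> E(1) in auto)
  qed
  then obtain N where N: "emeasure \<sigma> (E \<inter> L N) \<noteq> 0" by blast
  define a where "a = s + 1 / real (Suc N)"
  have a: "s < a" by (simp add: a_def)
  have "a \<le> s'" if s': "0 < s'" "hausdorff_measure b s' E = 0" for s'
  proof (rule ccontr)
    assume "\<not> a \<le> s'"
    then have s'a: "s' \<le> a" by simp
    define K where "K = ennreal (real b powr (2 * a))"
    have K: "K \<noteq> 0" "K \<noteq> top" using b by (auto simp: K_def)
    define \<delta> where "\<delta> = 1 / real b ^ Suc N"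
    have "hausdorff_premeasure b s' \<delta> E \<le> hausdorff_measure b s' E"
      unfolding hausdorff_measure_def using b by (intro SUP_upper) (auto simp: \<delta>_def)
    then have zero: "hausdorff_premeasure b s' \<delta> E = 0" using s' by simp
    have "emeasure \<sigma> (E \<inter> L N) / K \<le> hausdorff_premeasure b s' \<delta> E"
      unfolding hausdorff_premeasure_def
    proof (rule INF_greatest, clarify)
      fix U :: "nat \<Rightarrow> (nat \<Rightarrow> nat) set"
      assume U: "\<forall>i. U i \<subseteq> tree_boundary b \<and> tree_diam b (U i) \<le> \<delta>" "E \<subseteq> (\<Union>i. U i)"
      have "\<exists>C\<in>sets \<sigma>. U i \<inter> (E \<inter> L N) \<subseteq> C \<and> emeasure \<sigma> C \<le> K * ennreal (tree_diam b (U i) powr s')" for i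
        unfolding K_def
      proof (rule mass_distribution_cover[OF b \<sigma>(2) s'(1) s'a])
        show "tree_diam b (U i) \<le> 1 / real b ^ Suc N" using U by (simp add: \<delta>_def)
        show "U i \<subseteq> tree_boundary b" using U by blast
        fix t n assume "t \<in> E \<inter> L N" "N \<le> n"
        then show "emeasure \<sigma> (cyl b (pre t n)) \<le> ennreal (1 / real b powr (real n * a))"
          by (auto simp: L_def heavy_bound_def a_def)
      qed (use Esub in auto)
      then obtain C where C: "\<And>i. C i \<in> sets \<sigma>" "\<And>i. U i \<inter> (E \<inter> L N) \<subseteq> C i"
          "\<And>i. emeasure \<sigma> (C i) \<le> K * ennreal (tree_diam b (U i) powr s')" by metis
      have "emeasure \<sigma> (E \<inter> L N) \<le> emeasure \<sigma> (\<Union>i. C i)"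
      proof (rule emeasure_mono)
        show "E \<inter> L N \<subseteq> (\<Union>i. C i)"
        proof
          fix t assume t: "t \<in> E \<inter> L N"
          then obtain i where "t \<in> U i" using U(2) by auto
          with t C(2)[of i] show "t \<in> (\<Union>i. C i)" by auto
        qed
      qed (use C(1) in auto)
      also have "\<dots> \<le> (\<Sum>i. emeasure \<sigma> (C i))"
        using C(1) by (intro emeasure_subadditive_countably) auto
      also have "\<dots> \<le> (\<Sum>i. K * ennreal (tree_diam b (U i) powr s'))"
        by (intro suminf_le C(3)) auto
      also have "\<dots> = K * (\<Sum>i. ennreal (tree_diam b (U i) powr s'))"
        by simp
      finally show "emeasure \<sigma> (E \<inter> L N) / K \<le> (\<Sum>i. ennreal (tree_diam b (U i) powr s'))"
        using K by (intro divide_le_posI_ennreal) (auto simp: mult.commute zero_less_iff_neq_zero)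
    qed
    with zero K N show False by (simp add: ennreal_divide_eq_0_iff)
  qed
  then have "ennreal a \<le> hausdorff_dim b E"
    unfolding hausdorff_dim_def by (intro INF_greatest) (auto intro: ennreal_leI)
  moreover have "ennreal s < ennreal a"
    using a s by (intro ennreal_lessI) auto
  ultimately show ?thesis by simp
qed

text \<open>
  Both halves of the disintegration see the same set: the part of index at most s lives on a
  set of dimension at most s, which carries no mass outside the heavy points, while the other
  part does not charge the heavy points, since these have dimension at most s.
\<close>

lemma disint_part_eq_heavy_points:
  assumes b: "b \<ge> 2" and \<sigma>: "finite_measure \<sigma>" "sets \<sigma> = sets (tree_borel b)" and s: "0 \<le> s"
    and D: "dim_disintegration b \<sigma> \<nu> \<kappa>" and B: "B \<in> sets (tree_borel b)"
  shows "disint_part \<nu> \<kappa> {0..ennreal s} B = emeasure \<sigma> (B \<inter> heavy_points b s \<sigma>)"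
proof -
  let ?lo = "disint_part \<nu> \<kappa> {0..ennreal s}" and ?hi = "disint_part \<nu> \<kappa> {ennreal s<..\<infinity>}"
  let ?H = "heavy_points b s \<sigma>"
  have [measurable_cong]: "sets \<nu> = sets borel" and sets\<kappa>: "\<And>\<alpha>. sets (\<kappa> \<alpha>) = sets (tree_borel b)"
    and meas: "\<And>B. B \<in> sets (tree_borel b) \<Longrightarrow> (\<lambda>\<alpha>. emeasure (\<kappa> \<alpha>) B) \<in> borel_measurable \<nu>"
    and total: "\<And>B. B \<in> sets (tree_borel b) \<Longrightarrow> emeasure \<sigma> B = (\<integral>\<^sup>+\<alpha>. emeasure (\<kappa> \<alpha>) B \<partial>\<nu>)"
    using D by (auto simp: dim_disintegration_def)
  obtain A where A: "A \<in> sets (tree_borel b)" "hausdorff_dim b A \<le> ennreal s" "?lo (tree_boundary b - A) = 0"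
    using D s unfolding dim_disintegration_def by blast
  have hi: "hausdorff_dim b C > ennreal s" if "C \<in> sets (tree_borel b)" "?hi C > 0" for C
    using D s that unfolding dim_disintegration_def by blast
  have split: "emeasure \<sigma> C = ?lo C + ?hi C" if C: "C \<in> sets (tree_borel b)" for C
  proof -
    note [measurable] = meas[OF C]
    have "emeasure \<sigma> C = (\<integral>\<^sup>+\<alpha>. emeasure (\<kappa> \<alpha>) C * indicator {0..ennreal s} \<alpha> +
        emeasure (\<kappa> \<alpha>) C * indicator {ennreal s<..\<infinity>} \<alpha> \<partial>\<nu>)"
      unfolding total[OF C] by (intro nn_integral_cong) (auto split: split_indicator)
    then show ?thesis
      unfolding disint_part_def by (subst (asm) nn_integral_add) auto
  qed
  have add: "?lo (C \<union> C') = ?lo C + ?lo C'"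
    if C: "C \<in> sets (tree_borel b)" "C' \<in> sets (tree_borel b)" "C \<inter> C' = {}" for C C'
  proof -
    note [measurable] = meas[OF C(1)] meas[OF C(2)]
    have "emeasure (\<kappa> \<alpha>) (C \<union> C') = emeasure (\<kappa> \<alpha>) C + emeasure (\<kappa> \<alpha>) C'" for \<alpha>
      using C by (intro plus_emeasure[symmetric]) (auto simp: sets\<kappa>)
    then show ?thesis
      unfolding disint_part_def by (simp add: distrib_right nn_integral_add)
  qed
  have mono: "?lo C \<le> ?lo C'" if "C \<subseteq> C'" "C' \<in> sets (tree_borel b)" for C C'
    unfolding disint_part_def using that
    by (intro nn_integral_mono mult_right_mono emeasure_mono) (auto simp: sets\<kappa>)
  have BH: "B \<inter> ?H \<in> sets (tree_borel b)" "B - ?H \<in> sets (tree_borel b)" using B by auto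
  have Bsub: "B \<subseteq> tree_boundary b" using sets.sets_into_space[OF B] by simp
  have "?hi (B \<inter> ?H) = 0"
  proof (rule ccontr)
    assume "?hi (B \<inter> ?H) \<noteq> 0"
    then have "?hi ?H > 0"
    proof -
      have "?hi (B \<inter> ?H) \<le> ?hi ?H"
        unfolding disint_part_def
        by (intro nn_integral_mono mult_right_mono emeasure_mono) (auto simp: sets\<kappa>)
      with \<open>?hi (B \<inter> ?H) \<noteq> 0\<close> show ?thesis
        by (metis le_zero_eq zero_less_iff_neq_zero)
    qed
    from hi[OF _ this] hausdorff_dim_heavy_points[OF b \<sigma> s] show False by simp
  qed
  moreover have "?lo (B - ?H) = 0"
  proof -
    have AH: "B \<inter> A - ?H \<in> sets (tree_borel b)" using A B by auto
    have "emeasure \<sigma> (B \<inter> A - ?H) = 0"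
    proof (rule ccontr)
      assume "emeasure \<sigma> (B \<inter> A - ?H) \<noteq> 0"
      then have "ennreal s < hausdorff_dim b (B \<inter> A - ?H)"
        using AH by (intro hausdorff_dim_light_set[OF b \<sigma> s]) (auto simp: zero_less_iff_neq_zero)
      also have "\<dots> \<le> hausdorff_dim b A"
      proof -
        have "hausdorff_measure b r (B \<inter> A - ?H) \<le> hausdorff_measure b r A" for r
          unfolding hausdorff_measure_def hausdorff_premeasure_def
          by (intro SUP_mono' INF_superset_mono) auto
        then show ?thesis
          unfolding hausdorff_dim_def
          by (intro INF_superset_mono) (auto, metis le_zero_eq)
      qed
      finally show False using A(2) by simp
    qed
    then have "?lo (B \<inter> A - ?H) = 0" using split[OF AH] by simp
    moreover have "?lo (B - A - ?H) = 0"
    proof -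
      have "?lo (B - A - ?H) \<le> ?lo (tree_boundary b - A)"
        using Bsub A(1) sets.top[of "tree_borel b"] by (intro mono) (auto simp del: sets.top)
      with A(3) show ?thesis by simp
    qed
    moreover have "?lo ((B \<inter> A - ?H) \<union> (B - A - ?H)) = ?lo (B \<inter> A - ?H) + ?lo (B - A - ?H)"
      using A(1) B by (intro add) auto
    moreover have "B - ?H = (B \<inter> A - ?H) \<union> (B - A - ?H)" by auto
    ultimately show ?thesis by (metis add_0)
  qed
  moreover have "?lo B = ?lo (B \<inter> ?H) + ?lo (B - ?H)"
  proof -
    have "?lo ((B \<inter> ?H) \<union> (B - ?H)) = ?lo (B \<inter> ?H) + ?lo (B - ?H)"
      using add[OF BH] by blast
    then show ?thesis by (simp only: Int_Diff_Un)
  qed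
  ultimately show ?thesis
    using split[OF BH(1)] by simp
qed

section \<open>Weak convergence from cylinders\<close>

lemma compact_tree_boundary: "compact (tree_boundary b)"
proof -
  have "compactin (product_topology (\<lambda>_. euclidean) UNIV) (Pi\<^sub>E UNIV (\<lambda>_::nat. {..<b::nat}))"
    unfolding compactin_PiE by (simp add: finite_imp_compact)
  then have "compact (Pi\<^sub>E UNIV (\<lambda>_::nat. {..<b}))"
    by (simp only: euclidean_product_topology compactin_euclidean_iff)
  moreover have "Pi\<^sub>E UNIV (\<lambda>_::nat. {..<b}) = tree_boundary b"
    by (auto simp: tree_boundary_def PiE_iff)
  ultimately show ?thesis by simp
qed

text \<open>
  Continuity gives at each point t a level at which f nearly equals \<open>f t\<close> on the cylinder of t.
  Finitely many of these cylinders cover the boundary, and the largest of their levels is uniform.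
\<close>

lemma tree_uniformly_continuous:
  fixes f :: "(nat \<Rightarrow> nat) \<Rightarrow> real"
  assumes b: "b \<ge> 2" and f: "continuous_on (tree_boundary b) f" and e: "0 < e"
  shows "\<exists>n. \<forall>u\<in>tree_boundary b. \<forall>v\<in>tree_boundary b. pre u n = pre v n \<longrightarrow> \<bar>f u - f v\<bar> < e"
proof -
  let ?T = "tree_boundary b"
  have "\<exists>n. \<forall>x\<in>?T. pre x n = pre t n \<longrightarrow> \<bar>f x - f t\<bar> < e / 2" if t: "t \<in> ?T" for t
  proof -
    have "openin (top_of_set ?T) (?T \<inter> f -` ball (f t) (e / 2))"
      using f by (intro continuous_openin_preimage_gen) auto
    moreover have "t \<in> ?T \<inter> f -` ball (f t) (e / 2)"
      using t e by simp
    ultimately obtain d where d: "d > 0"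
        "\<And>x. x \<in> ?T \<Longrightarrow> tree_dist b t x < d \<Longrightarrow> x \<in> f -` ball (f t) (e / 2)"
      unfolding openin_tree_boundary_iff[OF b] by blast
    obtain n where "(1 / real b) ^ n < d"
      using real_arch_pow_inv[of d "1 / real b"] d b by auto
    then have n: "1 / real b ^ n < d" by (simp add: power_one_over)
    show ?thesis
    proof (intro exI ballI impI)
      fix x assume x: "x \<in> ?T" "pre x n = pre t n"
      then have "tree_dist b t x < 1 / real b ^ n"
        unfolding tree_dist_less_iff[OF b] by (simp add: pre_eq_iff)
      with n d(2)[OF x(1)] show "\<bar>f x - f t\<bar> < e / 2"
        by (simp add: dist_real_def abs_minus_commute)
    qed
  qed
  then obtain m where m: "\<And>t x. t \<in> ?T \<Longrightarrow> x \<in> ?T \<Longrightarrow> pre x (m t) = pre t (m t) \<Longrightarrow> \<bar>f x - f t\<bar> < e / 2"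
    by metis
  obtain F where F: "F \<subseteq> ?T" "finite F" "?T \<subseteq> (\<Union>t\<in>F. {x. pre x (m t) = pre t (m t)})"
  proof (rule compactE_image[OF compact_tree_boundary[of b], of ?T "\<lambda>t. {x. pre x (m t) = pre t (m t)}"])
    show "open {x. pre x (m t) = pre t (m t)}" for t by (rule open_pre_eq)
  qed auto
  define n where "n = Max (insert 0 (m ` F))"
  show ?thesis
  proof (intro exI ballI impI)
    fix u v assume uv: "u \<in> ?T" "v \<in> ?T" "pre u n = pre v n"
    obtain t where t: "t \<in> F" "pre u (m t) = pre t (m t)" using F uv(1) by blast
    have "m t \<le> n" using F(2) t(1) by (simp add: n_def)
    then have "pre v (m t) = pre t (m t)"
      using uv(3) t(2) by (auto simp: pre_eq_iff)
    with t m[of t u] m[of t v] F(1) uv have "\<bar>f u - f t\<bar> < e / 2" "\<bar>f v - f t\<bar> < e / 2"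
      by auto
    then show "\<bar>f u - f v\<bar> < e" by linarith
  qed
qed

lemma integral_locally_constant:
  assumes M: "finite_measure M" "sets M = sets (tree_borel b)"
  shows "(\<integral>t. h (pre t n) \<partial>M) = (\<Sum>\<tau>\<in>descendants b [] n. (h \<tau> :: real) * measure M (cyl b \<tau>))"
proof -
  interpret finite_measure M by fact
  have sp: "space M = tree_boundary b" using sets_eq_imp_space_eq[OF M(2)] by simp
  have "(\<integral>t. h (pre t n) \<partial>M) = (\<integral>t. (\<Sum>\<tau>\<in>descendants b [] n. h \<tau> * indicator (cyl b \<tau>) t) \<partial>M)"
  proof (intro Bochner_Integration.integral_cong refl)
    fix t assume "t \<in> space M"
    then have t: "t \<in> tree_boundary b" by (simp add: sp)
    have "(\<Sum>\<tau>\<in>descendants b [] n. h \<tau> * indicator (cyl b \<tau>) t) =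
        (\<Sum>\<tau>\<in>descendants b [] n. if \<tau> = pre t n then h \<tau> else 0)"
      using t by (intro sum.cong) (auto simp: indicator_cyl_pre descendants_def)
    also have "\<dots> = h (pre t n)"
      using t by (subst sum.delta) (simp, simp add: descendants_def pre_in_tree_words)
    finally show "h (pre t n) = (\<Sum>\<tau>\<in>descendants b [] n. h \<tau> * indicator (cyl b \<tau>) t)" by simp
  qed
  also have "\<dots> = (\<Sum>\<tau>\<in>descendants b [] n. h \<tau> * measure M (cyl b \<tau>))"
    by (subst Bochner_Integration.integral_sum)
       (auto simp: M(2) emeasure_eq_measure intro!: integrable_mult_right integrable_real_indicator)
  finally show ?thesis .
qed

text \<open>
  The boundary is compact, so a continuous function is uniformly close to a function of the
  first n letters, whose integral is a finite combination of masses of cylinders.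
\<close>

lemma tree_weak_convI:
  assumes b: "b \<ge> 2"
    and M: "\<And>n. finite_measure (M n)" "\<And>n. sets (M n) = sets (tree_borel b)"
    and \<mu>: "finite_measure \<mu>" "sets \<mu> = sets (tree_borel b)"
    and lim: "\<And>\<gamma>. \<gamma> \<in> tree_words b \<Longrightarrow> (\<lambda>n. measure (M n) (cyl b \<gamma>)) \<longlonglongrightarrow> measure \<mu> (cyl b \<gamma>)"
  shows "tree_weak_conv b M \<mu>"
  unfolding tree_weak_conv_def
proof (intro conjI allI impI)
  fix f :: "(nat \<Rightarrow> nat) \<Rightarrow> real" assume f: "continuous_on (tree_boundary b) f"
  show "(\<lambda>n. \<integral>t. f t \<partial>M n) \<longlonglongrightarrow> (\<integral>t. f t \<partial>\<mu>)"
  proof -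
    have close: "\<bar>(\<integral>t. f t \<partial>K) - (\<integral>t. g t \<partial>K)\<bar> \<le> e * measure K (tree_boundary b)"
      if K: "finite_measure K" "sets K = sets (tree_borel b)"
        and fg: "\<And>t. t \<in> tree_boundary b \<Longrightarrow> \<bar>f t - g t\<bar> < e"
        and g: "continuous_on (tree_boundary b) g"
      for K and g :: "(nat \<Rightarrow> nat) \<Rightarrow> real" and e
    proof -
      interpret finite_measure K by fact
      have sp: "space K = tree_boundary b" using sets_eq_imp_space_eq[OF K(2)] by simp
      have int: "integrable K h" if h: "continuous_on (tree_boundary b) h" for h :: "_ \<Rightarrow> real"
      proof -
        obtain B where B: "\<And>t. t \<in> tree_boundary b \<Longrightarrow> norm (h t) \<le> B"
          using compact_imp_bounded[OF compact_continuous_image[OF h compact_tree_boundary]]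
          unfolding bounded_iff by blast
        show ?thesis
        proof (rule integrable_const_bound)
          show "AE t in K. norm (h t) \<le> B" using B by (intro AE_I2) (simp add: sp)
          show "h \<in> borel_measurable K"
            using borel_measurable_tree_continuous[OF h] by (simp cong: measurable_cong_sets add: K(2))
        qed
      qed
      have "\<bar>(\<integral>t. f t \<partial>K) - (\<integral>t. g t \<partial>K)\<bar> = \<bar>\<integral>t. f t - g t \<partial>K\<bar>"
        using int f g by simp
      also have "\<dots> \<le> (\<integral>t. \<bar>f t - g t\<bar> \<partial>K)"
        by (rule integral_abs_bound)
      also have "\<dots> \<le> (\<integral>t. e \<partial>K)"
        using int f g fg by (intro integral_mono) (auto simp: sp intro!: less_imp_le)
      finally show ?thesis by (simp add: sp mult.commute)
    qed
    have mass: "(\<lambda>n. measure (M n) (tree_boundary b)) \<longlonglongrightarrow> measure \<mu> (tree_boundary b)"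
      using lim[of "[]"] by (simp add: cyl_Nil)
    define B where "B = measure \<mu> (tree_boundary b) + 1"
    have B: "0 < B" "measure \<mu> (tree_boundary b) \<le> B"
      by (auto simp: B_def add_nonneg_pos)
    have evB: "eventually (\<lambda>n. measure (M n) (tree_boundary b) \<le> B) sequentially"
      using order_tendstoD(2)[OF mass, of B] by (auto simp: B_def elim: eventually_mono)
    show ?thesis
    proof (rule tendstoI)
      fix \<epsilon> :: real assume \<epsilon>: "0 < \<epsilon>"
      define e where "e = \<epsilon> / (3 * B)"
      have e: "0 < e" using \<epsilon> B by (simp add: e_def)
      obtain k where k: "\<And>u v. u \<in> tree_boundary b \<Longrightarrow> v \<in> tree_boundary b \<Longrightarrow> pre u k = pre v k \<Longrightarrow> \<bar>f u - f v\<bar> < e"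
        using tree_uniformly_continuous[OF b f e] by blast
      define h where "h \<tau> = f (SOME v. v \<in> tree_boundary b \<and> pre v k = \<tau>)" for \<tau>
      have h: "\<bar>f t - h (pre t k)\<bar> < e" if t: "t \<in> tree_boundary b" for t
      proof -
        have "(SOME v. v \<in> tree_boundary b \<and> pre v k = pre t k) \<in> tree_boundary b \<and>
           pre (SOME v. v \<in> tree_boundary b \<and> pre v k = pre t k) k = pre t k"
          by (rule someI[of _ t]) (use t in simp)
        then show ?thesis unfolding h_def using t by (intro k) auto
      qed
      have cont: "continuous_on (tree_boundary b) (\<lambda>t. h (pre t k))" by (rule continuous_on_pre)
      have "(\<lambda>n. \<integral>t. h (pre t k) \<partial>M n) \<longlonglongrightarrow> (\<integral>t. h (pre t k) \<partial>\<mu>)"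
        unfolding integral_locally_constant[OF M] integral_locally_constant[OF \<mu>]
        by (intro tendsto_intros lim) (auto dest: descendants_words)
      from tendstoD[OF this, of "\<epsilon> / 3"] \<epsilon>
      have "eventually (\<lambda>n. dist (\<integral>t. h (pre t k) \<partial>M n) (\<integral>t. h (pre t k) \<partial>\<mu>) < \<epsilon> / 3) sequentially"
        by simp
      with evB show "eventually (\<lambda>n. dist (\<integral>t. f t \<partial>M n) (\<integral>t. f t \<partial>\<mu>) < \<epsilon>) sequentially"
      proof eventually_elim
        case (elim n)
        have eB: "e * B = \<epsilon> / 3" using B by (simp add: e_def)
        have 1: "\<bar>(\<integral>t. f t \<partial>M n) - (\<integral>t. h (pre t k) \<partial>M n)\<bar> \<le> \<epsilon> / 3"
          using order_trans[OF close[OF M h cont, of n] mult_left_mono[OF elim(1), of e]] e eB by simp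
        have 2: "\<bar>(\<integral>t. f t \<partial>\<mu>) - (\<integral>t. h (pre t k) \<partial>\<mu>)\<bar> \<le> \<epsilon> / 3"
          using order_trans[OF close[OF \<mu> h cont] mult_left_mono[OF B(2), of e]] e eB by simp
        have triangle: "\<bar>x - y\<bar> < \<epsilon>"
          if "\<bar>x - x'\<bar> \<le> \<epsilon> / 3" "\<bar>y - y'\<bar> \<le> \<epsilon> / 3" "\<bar>x' - y'\<bar> < \<epsilon> / 3" for x y x' y'
          using that by linarith
        show ?case
          using triangle[OF 1 2] elim(2) by (simp only: dist_real_def)
      qed
    qed
  qed
qed (use \<mu> in auto)

lemma tree_weak_conv_cyl:
  assumes "tree_weak_conv b M \<mu>" "\<And>n. sets (M n) = sets (tree_borel b)"
  shows "(\<lambda>n. measure (M n) (cyl b \<gamma>)) \<longlonglongrightarrow> measure \<mu> (cyl b \<gamma>)"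
proof -
  have \<mu>: "sets \<mu> = sets (tree_borel b)" using assms(1) by (simp add: tree_weak_conv_def)
  have "\<And>f :: _ \<Rightarrow> real. continuous_on (tree_boundary b) f \<Longrightarrow> (\<lambda>n. \<integral>t. f t \<partial>M n) \<longlonglongrightarrow> (\<integral>t. f t \<partial>\<mu>)"
    using assms(1) unfolding tree_weak_conv_def by simp
  from this[OF continuous_on_indicator_cyl[of b \<gamma>]]
  have "(\<lambda>n. \<integral>t. indicat_real (cyl b \<gamma>) t \<partial>M n) \<longlonglongrightarrow> (\<integral>t. indicat_real (cyl b \<gamma>) t \<partial>\<mu>)" .
  moreover have "(\<integral>t. indicat_real (cyl b \<gamma>) t \<partial>K) = measure K (cyl b \<gamma>)" if "sets K = sets (tree_borel b)" for K
    using sets_eq_imp_space_eq[OF that] cyl_subset[of b \<gamma>] by (simp add: Int_absorb2)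
  ultimately show ?thesis using assms(2) \<mu> by simp
qed

section \<open>The heavy mass as a function of the masses of cylinders\<close>

text \<open>
  The mass of the heavy points in a cylinder, as a function of the masses \<open>\<mu> \<tau>\<close> of all cylinders.
  The points that pass the test of heaviness for some n between N and M form a union of cylinders
  of level M. Starting with \<open>N = length \<gamma>\<close> ensures that only words extending \<open>\<gamma>\<close> are tested.
\<close>

definition heavy_mass :: "nat \<Rightarrow> real \<Rightarrow> nat list \<Rightarrow> (nat list \<Rightarrow> ennreal) \<Rightarrow> ennreal" where
  "heavy_mass b s \<gamma> \<mu> = (INF N\<in>{length \<gamma>..}. SUP M. \<Sum>\<tau>\<in>descendants b \<gamma> M.
     if \<exists>n. N \<le> n \<and> n \<le> M \<and> ennreal (heavy_bound b s N n) \<le> \<mu> (take n \<tau>) then \<mu> \<tau> else 0)"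

lemma heavy_bound_mono:
  assumes "b \<ge> 2" "N \<le> N'"
  shows "heavy_bound b s N n \<le> heavy_bound b s N' n"
proof -
  have "1 / real (Suc N') \<le> 1 / real (Suc N)"
    using assms by (intro divide_left_mono) auto
  then have "real b powr (real n * (s + 1 / real (Suc N'))) \<le> real b powr (real n * (s + 1 / real (Suc N)))"
    using assms by (intro powr_mono mult_left_mono add_left_mono) auto
  then show ?thesis
    using assms by (auto simp: heavy_bound_def intro!: divide_left_mono)
qed

text \<open>
  The tested sets increase with M, and their unions decrease with N because the threshold grows
  with N, so that continuity of the measure from below and from above applies.
\<close>

lemma emeasure_heavy_points_eq_heavy_mass:
  assumes b: "b \<ge> 2" and \<sigma>: "finite_measure \<sigma>" "sets \<sigma> = sets (tree_borel b)"
  shows "emeasure \<sigma> (cyl b \<gamma> \<inter> heavy_points b s \<sigma>) = heavy_mass b s \<gamma> (\<lambda>\<tau>. emeasure \<sigma> (cyl b \<tau>))"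
proof -
  interpret finite_measure \<sigma> by fact
  define R where "R N n \<tau> \<longleftrightarrow> ennreal (heavy_bound b s N n) \<le> emeasure \<sigma> (cyl b \<tau>)" for N n \<tau>
  define A where "A N M = {t \<in> cyl b \<gamma>. \<exists>n. N \<le> n \<and> n \<le> M \<and> R N n (pre t n)}" for N M
  define V where "V N = {t \<in> cyl b \<gamma>. \<exists>n. N \<le> n \<and> R N n (pre t n)}" for N
  have A_eq: "A N M = (\<Union>\<tau>\<in>descendants b \<gamma> M.
      if \<exists>n. N \<le> n \<and> n \<le> M \<and> R N n (take n \<tau>) then cyl b \<tau> else {})" (is "_ = (\<Union>\<tau>\<in>_. ?B \<tau>)")
    if N: "length \<gamma> \<le> N" for N M
  proof (cases "length \<gamma> \<le> M")
    case True
    show ?thesis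
    proof (intro equalityI subsetI)
      fix t assume t: "t \<in> A N M"
      then obtain \<tau> where \<tau>: "\<tau> \<in> descendants b \<gamma> M" "t \<in> cyl b \<tau>"
        using cyl_UN[OF True, of b] by (auto simp: A_def)
      then have "pre t M = \<tau>" by (auto simp: cyl_def descendants_def)
      then have "pre t n = take n \<tau>" if "n \<le> M" for n using that by (auto simp: min_def)
      with t \<tau> show "t \<in> (\<Union>\<tau>\<in>descendants b \<gamma> M. ?B \<tau>)"
        by (intro UN_I[of \<tau>]) (auto simp: A_def)
    next
      fix t assume "t \<in> (\<Union>\<tau>\<in>descendants b \<gamma> M. ?B \<tau>)"
      then obtain \<tau> n where \<tau>: "\<tau> \<in> descendants b \<gamma> M" "t \<in> cyl b \<tau>"
          and n: "N \<le> n" "n \<le> M" "R N n (take n \<tau>)"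
        by (auto split: if_splits)
      then have "pre t M = \<tau>" by (auto simp: cyl_def descendants_def)
      then have "pre t n = take n \<tau>" using n by (auto simp: min_def)
      moreover have "t \<in> cyl b \<gamma>" using \<tau> cyl_UN[OF True, of b] by blast
      ultimately show "t \<in> A N M" using n by (auto simp: A_def)
    qed
  next
    case False
    then show ?thesis using N by (auto simp: A_def descendants_short)
  qed
  have A_sets: "A N M \<in> sets \<sigma>" if N: "length \<gamma> \<le> N" for N M
    unfolding A_eq[OF N] by (intro sets.finite_UN) (auto simp: \<sigma>)
  have V_UN: "V N = (\<Union>M. A N M)" for N
    by (auto simp: V_def A_def)
  have V_sets: "V N \<in> sets \<sigma>" if N: "length \<gamma> \<le> N" for N
    unfolding V_UN using A_sets[OF N] by auto
  have sumA: "(\<Sum>\<tau>\<in>descendants b \<gamma> M.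
     if \<exists>n. N \<le> n \<and> n \<le> M \<and> R N n (take n \<tau>) then emeasure \<sigma> (cyl b \<tau>) else 0) = emeasure \<sigma> (A N M)"
    if N: "length \<gamma> \<le> N" for N M
  proof -
    have "emeasure \<sigma> (A N M) = (\<Sum>\<tau>\<in>descendants b \<gamma> M.
        emeasure \<sigma> (if \<exists>n. N \<le> n \<and> n \<le> M \<and> R N n (take n \<tau>) then cyl b \<tau> else {}))"
      unfolding A_eq[OF N] by (rule emeasure_cyl_UN[OF \<sigma>(2)]) (auto simp: \<sigma>)
    also have "\<dots> = (\<Sum>\<tau>\<in>descendants b \<gamma> M.
        if \<exists>n. N \<le> n \<and> n \<le> M \<and> R N n (take n \<tau>) then emeasure \<sigma> (cyl b \<tau>) else 0)"
      by (intro sum.cong refl) (simp only: if_distrib[of "emeasure \<sigma>"] emeasure_empty)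
    finally show ?thesis by simp
  qed
  have supA: "(SUP M. emeasure \<sigma> (A N M)) = emeasure \<sigma> (V N)" if N: "length \<gamma> \<le> N" for N
    unfolding V_UN
  proof (rule SUP_emeasure_incseq)
    show "range (A N) \<subseteq> sets \<sigma>" using A_sets[OF N] by blast
    show "incseq (A N)"
    proof (intro monoI subsetI)
      fix M M' t assume "M \<le> M'" "t \<in> A N M"
      then show "t \<in> A N M'" unfolding A_def using order_trans by blast
    qed
  qed
  have V_mono: "V N' \<subseteq> V N" if "N \<le> N'" for N N'
  proof
    fix t assume "t \<in> V N'"
    then obtain n where n: "t \<in> cyl b \<gamma>" "N' \<le> n" "R N' n (pre t n)" by (auto simp: V_def)
    have "ennreal (heavy_bound b s N n) \<le> ennreal (heavy_bound b s N' n)"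
      by (intro ennreal_leI heavy_bound_mono b that)
    with n that show "t \<in> V N" by (auto simp: V_def R_def intro!: exI[of _ n])
  qed
  have "heavy_mass b s \<gamma> (\<lambda>\<tau>. emeasure \<sigma> (cyl b \<tau>)) = (INF N\<in>{length \<gamma>..}. emeasure \<sigma> (V N))"
    unfolding heavy_mass_def R_def[symmetric] by (intro INF_cong refl) (simp add: sumA supA)
  also have "\<dots> = (INF k. emeasure \<sigma> (V (length \<gamma> + k)))"
  proof (intro antisym INF_greatest)
    fix N assume "N \<in> {length \<gamma>..}"
    then show "(INF k. emeasure \<sigma> (V (length \<gamma> + k))) \<le> emeasure \<sigma> (V N)"
      by (intro INF_lower2[of "N - length \<gamma>"]) auto
  next
    fix k
    show "(INF N\<in>{length \<gamma>..}. emeasure \<sigma> (V N)) \<le> emeasure \<sigma> (V (length \<gamma> + k))"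
      by (rule INF_lower) simp
  qed
  also have "\<dots> = emeasure \<sigma> (\<Inter>k. V (length \<gamma> + k))"
  proof (rule INF_emeasure_decseq)
    show "range (\<lambda>k. V (length \<gamma> + k)) \<subseteq> sets \<sigma>" using V_sets by auto
    show "decseq (\<lambda>k. V (length \<gamma> + k))" unfolding decseq_def by (intro allI impI V_mono) simp
  qed simp
  also have "(\<Inter>k. V (length \<gamma> + k)) = cyl b \<gamma> \<inter> heavy_points b s \<sigma>"
  proof (intro equalityI subsetI)
    fix t assume t: "t \<in> (\<Inter>k. V (length \<gamma> + k))"
    then have "t \<in> V N" for N
      using V_mono[of N "length \<gamma> + N"] by auto
    then have V: "t \<in> cyl b \<gamma>" "\<And>N. \<exists>n\<ge>N. R N n (pre t n)"
      by (simp_all add: V_def)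
    moreover have "t \<in> tree_boundary b" using V(1) cyl_subset by blast
    ultimately show "t \<in> cyl b \<gamma> \<inter> heavy_points b s \<sigma>"
      unfolding heavy_points_def R_def by simp
  next
    fix t assume t: "t \<in> cyl b \<gamma> \<inter> heavy_points b s \<sigma>"
    then show "t \<in> (\<Inter>k. V (length \<gamma> + k))"
      unfolding V_def R_def heavy_points_def by simp
  qed
  finally show ?thesis ..
qed

text \<open>The heavy mass of a cylinder only involves the masses of the cylinders inside it.\<close>

lemma borel_measurable_heavy_mass:
  assumes "\<And>\<tau>. \<tau> \<in> tree_words b \<Longrightarrow> take (length \<gamma>) \<tau> = \<gamma> \<Longrightarrow> (\<lambda>\<omega>. \<mu> \<omega> \<tau>) \<in> borel_measurable K"
  shows "(\<lambda>\<omega>. heavy_mass b s \<gamma> (\<mu> \<omega>)) \<in> borel_measurable K"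
  unfolding heavy_mass_def
proof (intro borel_measurable_INF borel_measurable_SUP borel_measurable_sum)
  fix N M \<tau> assume N: "N \<in> {length \<gamma>..}" and \<tau>: "\<tau> \<in> descendants b \<gamma> M"
  have [measurable]: "(\<lambda>\<omega>. \<mu> \<omega> \<tau>) \<in> borel_measurable K"
    using \<tau> by (intro assms) (auto simp: descendants_def)
  have "Measurable.pred K (\<lambda>\<omega>. \<exists>n. N \<le> n \<and> n \<le> M \<and> ennreal (heavy_bound b s N n) \<le> \<mu> \<omega> (take n \<tau>))"
  proof (intro pred_intros_countable)
    fix n
    show "Measurable.pred K (\<lambda>\<omega>. N \<le> n \<and> n \<le> M \<and> ennreal (heavy_bound b s N n) \<le> \<mu> \<omega> (take n \<tau>))"
    proof (cases "N \<le> n \<and> n \<le> M")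
      case True
      have [measurable]: "(\<lambda>\<omega>. \<mu> \<omega> (take n \<tau>)) \<in> borel_measurable K"
        using \<tau> N True by (intro assms) (auto simp: descendants_def take_in_tree_words min_def)
      show ?thesis by measurable
    next
      case False
      then have "(\<lambda>\<omega>. N \<le> n \<and> n \<le> M \<and> ennreal (heavy_bound b s N n) \<le> \<mu> \<omega> (take n \<tau>)) = (\<lambda>_. False)"
        by (simp only: simp_thms conj_assoc[symmetric])
      then show ?thesis by (simp only: measurable_const UNIV_I space_count_space)
    qed
  qed
  then show "(\<lambda>\<omega>. if \<exists>n. N \<le> n \<and> n \<le> M \<and> ennreal (heavy_bound b s N n) \<le> \<mu> \<omega> (take n \<tau>) then \<mu> \<omega> \<tau> else 0)
      \<in> borel_measurable K"
    by measurable
qed simp_all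

lemma heavy_mass_reindex:
  assumes g: "inj_on g (tree_words b)" "\<And>\<tau>. length (g \<tau>) = length \<tau>" "\<And>k \<tau>. take k (g \<tau>) = g (take k \<tau>)"
    and d: "\<And>M. descendants b (g \<gamma>) M = g ` descendants b \<gamma> M"
  shows "heavy_mass b s (g \<gamma>) \<mu> = heavy_mass b s \<gamma> (\<lambda>\<tau>. \<mu> (g \<tau>))"
proof -
  have "inj_on g (descendants b \<gamma> M)" for M
    by (rule inj_on_subset[OF g(1)]) (auto simp: descendants_def)
  then show ?thesis
    unfolding heavy_mass_def d by (simp add: sum.reindex g)
qed

section \<open>Cylinders under the uniform measure and under locally constant densities\<close>

lemma space_tree_haar [simp]: "space (tree_haar b) = tree_boundary b"
  using sets_eq_imp_space_eq[OF sets_tree_haar[of b]] by simp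

lemma emeasure_tree_haar_cyl:
  assumes b: "b > 0" and \<gamma>: "\<gamma> \<in> tree_words b"
  shows "emeasure (tree_haar b) (cyl b \<gamma>) = ennreal (1 / real b ^ length \<gamma>)"
proof -
  interpret u: prob_space "uniform_count_measure {..<b}"
    using b by (intro prob_space_uniform_count_measure) auto
  interpret product_prob_space "\<lambda>_::nat. uniform_count_measure {..<b}" UNIV
    by (intro product_prob_spaceI) (rule u.prob_space_axioms)
  have mem: "\<gamma> ! i < b" if "i < length \<gamma>" for i
    using \<gamma> subsetD[OF _ nth_mem[OF that]] by (auto simp: tree_words_def)
  have "cyl b \<gamma> = {t \<in> space (tree_haar b). \<forall>i\<in>{..<length \<gamma>}. t i \<in> {\<gamma> ! i}}"
    by (auto simp: cyl_def list_eq_iff_nth_eq)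
  then have "emeasure (tree_haar b) (cyl b \<gamma>) =
      (\<Prod>i\<in>{..<length \<gamma>}. emeasure (uniform_count_measure {..<b}) {\<gamma> ! i})"
    unfolding tree_haar_def using mem
    by (simp only:) (subst emeasure_PiM_Collect, auto simp: sets_uniform_count_measure)
  also have "\<dots> = (\<Prod>i\<in>{..<length \<gamma>}. ennreal (1 / real b))"
    using mem by (intro prod.cong refl) (subst emeasure_uniform_count_measure, auto)
  also have "\<dots> = ennreal (1 / real b ^ length \<gamma>)"
    by (simp add: ennreal_power power_one_over)
  finally show ?thesis .
qed

lemma locally_constant_density:
  assumes b: "b > 0" and h: "\<And>\<tau>. \<tau> \<in> tree_words b \<Longrightarrow> 0 \<le> h \<tau>"
    and Q: "\<And>t. t \<in> tree_boundary b \<Longrightarrow> Q t = real b ^ n * h (pre t n)"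
  shows "finite_measure (density (tree_haar b) (\<lambda>t. ennreal (Q t)))"
    and "length \<gamma> \<le> n \<Longrightarrow> measure (density (tree_haar b) (\<lambda>t. ennreal (Q t))) (cyl b \<gamma>) =
     (\<Sum>\<tau>\<in>descendants b \<gamma> n. h \<tau>)"
proof -
  let ?D = "density (tree_haar b) (\<lambda>t. ennreal (Q t))" and ?k = "\<lambda>\<tau>. real b ^ n * h \<tau>"
  have "Q \<in> borel_measurable (tree_haar b) \<longleftrightarrow> (\<lambda>t. ?k (pre t n)) \<in> borel_measurable (tree_haar b)"
    by (intro measurable_cong) (simp add: Q)
  then have [measurable]: "Q \<in> borel_measurable (tree_haar b)"
    using measurable_pre[of ?k n b] by (simp cong: measurable_cong_sets add: sets_tree_haar)
  have [measurable]: "cyl b \<tau> \<in> sets (tree_haar b)" for \<tau> by (simp add: sets_tree_haar)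
  have mass: "emeasure ?D (cyl b \<gamma>) = ennreal (\<Sum>\<tau>\<in>descendants b \<gamma> n. h \<tau>)" if \<gamma>: "length \<gamma> \<le> n" for \<gamma>
  proof -
    have "emeasure ?D (cyl b \<gamma>) = (\<integral>\<^sup>+t. ennreal (Q t) * indicator (cyl b \<gamma>) t \<partial>tree_haar b)"
      by (rule emeasure_density) auto
    also have "\<dots> = (\<integral>\<^sup>+t. (\<Sum>\<tau>\<in>descendants b \<gamma> n. ennreal (?k \<tau>) * indicator (cyl b \<tau>) t) \<partial>tree_haar b)"
    proof (intro nn_integral_cong)
      fix t assume "t \<in> space (tree_haar b)"
      then have t: "t \<in> tree_boundary b" by simp
      have "(\<Sum>\<tau>\<in>descendants b \<gamma> n. ennreal (?k \<tau>) * indicator (cyl b \<tau>) t) =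
          (\<Sum>\<tau>\<in>descendants b \<gamma> n. if \<tau> = pre t n then ennreal (?k \<tau>) else 0)"
        using t by (intro sum.cong) (auto simp: indicator_cyl_pre descendants_def)
      also have "\<dots> = (if pre t n \<in> descendants b \<gamma> n then ennreal (?k (pre t n)) else 0)"
        by (subst sum.delta) simp_all
      also have "\<dots> = ennreal (Q t) * indicator (cyl b \<gamma>) t"
        using t \<gamma> by (auto simp: Q indicator_cyl_pre descendants_def pre_in_tree_words min_def)
      finally show "ennreal (Q t) * indicator (cyl b \<gamma>) t =
          (\<Sum>\<tau>\<in>descendants b \<gamma> n. ennreal (?k \<tau>) * indicator (cyl b \<tau>) t)" by simp
    qed
    also have "\<dots> = (\<Sum>\<tau>\<in>descendants b \<gamma> n. ennreal (?k \<tau>) * emeasure (tree_haar b) (cyl b \<tau>))"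
      by (subst nn_integral_sum) (simp_all add: nn_integral_cmult)
    also have "\<dots> = (\<Sum>\<tau>\<in>descendants b \<gamma> n. ennreal (h \<tau>))"
      using b h by (intro sum.cong refl)
        (auto simp: descendants_def emeasure_tree_haar_cyl simp flip: ennreal_mult)
    also have "\<dots> = ennreal (\<Sum>\<tau>\<in>descendants b \<gamma> n. h \<tau>)"
      by (intro sum_ennreal) (auto simp: descendants_def h)
    finally show ?thesis .
  qed
  show "finite_measure ?D"
    using mass[of "[]"] by (intro finite_measureI) (simp add: cyl_Nil)
  show "measure ?D (cyl b \<gamma>) = (\<Sum>\<tau>\<in>descendants b \<gamma> n. h \<tau>)" if "length \<gamma> \<le> n"
    unfolding measure_def mass[OF that]
    by (intro enn2real_ennreal sum_nonneg h) (auto simp: descendants_def)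
qed

section \<open>Conditional expectations of nonnegative variables\<close>

lemma (in sigma_finite_subalgebra) nn_cond_exp_eq_real_cond_exp:
  assumes f: "integrable M f" "AE x in M. 0 \<le> f x"
  shows "AE x in M. nn_cond_exp M F (\<lambda>x. ennreal (f x)) x = ennreal (real_cond_exp M F f x)"
proof -
  have pos: "AE x in M. 0 \<le> real_cond_exp M F f x"
    using f by (intro real_cond_exp_pos) auto
  have "AE x in M. ennreal (real_cond_exp M F f x) = nn_cond_exp M F (\<lambda>x. ennreal (f x)) x"
  proof (rule nn_cond_exp_charact)
    fix A assume A: "A \<in> sets F"
    then have A': "A \<in> sets M" using subalg by (auto simp: subalgebra_def)
    have "(\<integral>\<^sup>+x\<in>A. ennreal (f x) \<partial>M) = (\<integral>\<^sup>+x. ennreal (indicator A x * f x) \<partial>M)"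
      by (intro nn_integral_cong) (simp split: split_indicator)
    also have "\<dots> = ennreal (\<integral>x. indicator A x * f x \<partial>M)"
      using f integrable_mult_indicator[OF A' f(1)]
      by (intro nn_integral_eq_integral) (auto split: split_indicator)
    also have "(\<integral>x. indicator A x * f x \<partial>M) = (\<integral>x. indicator A x * real_cond_exp M F f x \<partial>M)"
      using real_cond_exp_intA[OF f(1) A] by (simp add: set_lebesgue_integral_def)
    also have "ennreal \<dots> = (\<integral>\<^sup>+x. ennreal (indicator A x * real_cond_exp M F f x) \<partial>M)"
      using pos integrable_mult_indicator[OF A' real_cond_exp_int(1)[OF f(1)]]
      by (intro nn_integral_eq_integral[symmetric]) (auto split: split_indicator)
    also have "\<dots> = (\<integral>\<^sup>+x\<in>A. ennreal (real_cond_exp M F f x) \<partial>M)"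
      by (intro nn_integral_cong) (simp split: split_indicator)
    finally show "(\<integral>\<^sup>+x\<in>A. ennreal (f x) \<partial>M) = (\<integral>\<^sup>+x\<in>A. ennreal (real_cond_exp M F f x) \<partial>M)" .
  qed (use f in auto)
  then show ?thesis by eventually_elim simp
qed

text \<open>
  For nonnegative variables, conditional expectations are most easily identified by their
  Lebesgue integrals over the sets of the subalgebra.
\<close>

lemma (in sigma_finite_subalgebra) real_cond_exp_eqI_nn:
  assumes X: "X \<in> borel_measurable M" "AE x in M. 0 \<le> X x" "(\<integral>\<^sup>+x. ennreal (X x) \<partial>M) < \<infinity>"
    and Z: "Z \<in> borel_measurable F" "AE x in M. 0 \<le> Z x"
    and eq: "\<And>A. A \<in> sets F \<Longrightarrow> (\<integral>\<^sup>+x. indicator A x * ennreal (X x) \<partial>M) = (\<integral>\<^sup>+x. indicator A x * ennreal (Z x) \<partial>M)"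
  shows "integrable M X" "integrable M Z" "AE x in M. real_cond_exp M F X x = Z x"
proof -
  have ZM: "Z \<in> borel_measurable M" by (rule measurable_from_subalg[OF subalg Z(1)])
  show iX: "integrable M X"
    using X by (intro integrableI_nonneg) auto
  have "space M \<in> sets F" using subalg sets.top[of F] by (simp add: subalgebra_def)
  from eq[OF this] have "(\<integral>\<^sup>+x. ennreal (X x) \<partial>M) = (\<integral>\<^sup>+x. ennreal (Z x) \<partial>M)"
    by (simp cong: nn_integral_cong)
  with X(3) show iZ: "integrable M Z"
    using Z ZM by (intro integrableI_nonneg) auto
  have "AE x in M. ennreal (Z x) = nn_cond_exp M F (\<lambda>x. ennreal (X x)) x"
    using X Z eq by (intro nn_cond_exp_charact) (auto simp: mult.commute)
  moreover have "AE x in M. 0 \<le> real_cond_exp M F X x"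
    using X iX by (intro real_cond_exp_pos) auto
  ultimately show "AE x in M. real_cond_exp M F X x = Z x"
    using nn_cond_exp_eq_real_cond_exp[OF iX X(2)] Z(2) by eventually_elim simp
qed

lemma (in sigma_finite_subalgebra) nn_cond_exp_le:
  assumes f: "f \<in> borel_measurable M" and g: "g \<in> borel_measurable F" "(\<integral>\<^sup>+x. g x \<partial>M) < \<infinity>"
    and le: "\<And>A. A \<in> sets F \<Longrightarrow> (\<integral>\<^sup>+x. indicator A x * f x \<partial>M) \<le> (\<integral>\<^sup>+x. indicator A x * g x \<partial>M)"
  shows "AE x in M. nn_cond_exp M F f x \<le> g x"
proof -
  let ?N = "nn_cond_exp M F f"
  have gM [measurable]: "g \<in> borel_measurable M" by (rule measurable_from_subalg[OF subalg g(1)])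
  define A where "A = {x \<in> space M. g x < ?N x}"
  have sp: "space F = space M" using subalg by (simp add: subalgebra_def)
  have "{x \<in> space F. g x < ?N x} \<in> sets F" using g(1) by measurable
  then have A: "A \<in> sets F" by (simp add: A_def sp)
  then have AM [measurable]: "A \<in> sets M" using subalg by (auto simp: subalgebra_def)
  have ind: "indicator A \<in> borel_measurable F" using A by simp
  have fin: "(\<integral>\<^sup>+x. indicator A x * g x \<partial>M) < \<infinity>"
    by (rule le_less_trans[OF nn_integral_mono g(2)]) (auto split: split_indicator)
  have "(\<integral>\<^sup>+x. indicator A x * ?N x \<partial>M) \<le> (\<integral>\<^sup>+x. indicator A x * g x \<partial>M)"
    using nn_cond_exp_intg[OF ind f] le[OF A] by simp
  then have "(\<integral>\<^sup>+x. indicator A x * ?N x - indicator A x * g x \<partial>M) = 0"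
    using fin by (subst nn_integral_diff) (auto simp: A_def diff_eq_0_iff_ennreal split: split_indicator)
  then have "AE x in M. indicator A x * ?N x - indicator A x * g x = 0"
    by (subst (asm) nn_integral_0_iff_AE) auto
  then show ?thesis
    using AE_space
  proof eventually_elim
    case (elim x)
    show ?case
    proof (rule ccontr)
      assume "\<not> ?N x \<le> g x"
      then have "x \<in> A" using elim by (simp add: A_def)
      with elim have "?N x - g x = 0" by simp
      with \<open>\<not> ?N x \<le> g x\<close> show False by (auto simp: diff_eq_0_iff_ennreal)
    qed
  qed
qed

section \<open>Levy's upward convergence theorem\<close>

locale generating_filtration = prob_space M for M :: "'a measure" +
  fixes F :: "nat \<Rightarrow> 'a measure"
  assumes subalgebra_F: "subalgebra M (F n)"
    and F_mono: "m \<le> n \<Longrightarrow> sets (F m) \<subseteq> sets (F n)"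
    and F_generates: "sets M = sigma_sets (space M) (\<Union>n. sets (F n))"
begin

lemma sigma_finite_subalgebra_F: "sigma_finite_subalgebra M (F n)"
  by (intro finite_measure_subalgebra_is_sigma_finite finite_measure_subalgebra.intro
      finite_measure_subalgebra_axioms.intro subalgebra_F finite_measure_axioms)

lemma space_F: "space (F n) = space M"
  using subalgebra_F by (auto simp: subalgebra_def)

lemma sets_F_subset: "A \<in> sets (F n) \<Longrightarrow> A \<in> sets M"
  using subalgebra_F by (auto simp: subalgebra_def)

lemma measurable_F_mono: "m \<le> n \<Longrightarrow> f \<in> borel_measurable (F m) \<Longrightarrow> f \<in> borel_measurable (F n)"
  using F_mono[of m n] by (auto simp: measurable_def space_F)

lemma measurable_F_M: "f \<in> borel_measurable (F m) \<Longrightarrow> f \<in> borel_measurable M"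
  by (rule measurable_from_subalg[OF subalgebra_F])

text \<open>Doob's maximal inequality, by splitting according to the first index that exceeds the level.\<close>

lemma maximal_inequality:
  assumes g [measurable]: "g \<in> borel_measurable M" and c: "0 < c"
  shows "ennreal c * emeasure M {\<omega> \<in> space M. \<exists>n. ennreal c < nn_cond_exp M (F n) g \<omega>} \<le> (\<integral>\<^sup>+\<omega>. g \<omega> \<partial>M)"
proof -
  define B where "B n = {\<omega> \<in> space M. ennreal c < nn_cond_exp M (F n) g \<omega>}" for n
  have BF: "B n \<in> sets (F n)" for n
  proof -
    have "{\<omega> \<in> space (F n). ennreal c < nn_cond_exp M (F n) g \<omega>} \<in> sets (F n)"
      by measurable
    then show ?thesis by (simp add: B_def space_F)
  qed
  define A where "A = disjointed B"
  have AF: "A n \<in> sets (F n)" for n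
  proof -
    have "B i \<in> sets (F n)" if "i < n" for i
      using BF[of i] F_mono[of i n] that by auto
    then show ?thesis
      unfolding A_def disjointed_def by (intro sets.Diff BF sets.finite_UN) auto
  qed
  have AM [measurable]: "A n \<in> sets M" for n by (rule sets_F_subset[OF AF])
  have each: "ennreal c * emeasure M (A n) \<le> (\<integral>\<^sup>+\<omega>. g \<omega> * indicator (A n) \<omega> \<partial>M)" for n
  proof -
    interpret sigma_finite_subalgebra M "F n" by (rule sigma_finite_subalgebra_F)
    have [measurable]: "indicator (A n) \<in> borel_measurable (F n)"
      using AF by simp
    have "ennreal c * emeasure M (A n) = (\<integral>\<^sup>+\<omega>. ennreal c * indicator (A n) \<omega> \<partial>M)"
      by (simp add: nn_integral_cmult_indicator)
    also have "\<dots> \<le> (\<integral>\<^sup>+\<omega>. indicator (A n) \<omega> * nn_cond_exp M (F n) g \<omega> \<partial>M)"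
    proof (intro nn_integral_mono)
      fix \<omega>
      have "\<omega> \<in> A n \<Longrightarrow> \<omega> \<in> B n"
        using disjointed_subset[of B n] by (auto simp: A_def)
      then show "ennreal c * indicator (A n) \<omega> \<le> indicator (A n) \<omega> * nn_cond_exp M (F n) g \<omega>"
        by (auto simp: B_def split: split_indicator)
    qed
    also have "\<dots> = (\<integral>\<^sup>+\<omega>. indicator (A n) \<omega> * g \<omega> \<partial>M)"
      by (rule nn_cond_exp_intg) auto
    finally show ?thesis by (simp add: mult.commute)
  qed
  have disj: "disjoint_family A" unfolding A_def by (rule disjoint_family_disjointed)
  have "{\<omega> \<in> space M. \<exists>n. ennreal c < nn_cond_exp M (F n) g \<omega>} = (\<Union>n. A n)"
    unfolding A_def UN_disjointed_eq by (auto simp: B_def)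
  then have "ennreal c * emeasure M {\<omega> \<in> space M. \<exists>n. ennreal c < nn_cond_exp M (F n) g \<omega>} =
      (\<Sum>n. ennreal c * emeasure M (A n))"
    using suminf_emeasure[of A M] disj by (simp add: image_subset_iff)
  also have "\<dots> \<le> (\<Sum>n. \<integral>\<^sup>+\<omega>. g \<omega> * indicator (A n) \<omega> \<partial>M)"
    by (intro suminf_le each) auto
  also have "\<dots> = (\<integral>\<^sup>+\<omega>. (\<Sum>n. g \<omega> * indicator (A n) \<omega>) \<partial>M)"
    by (rule nn_integral_suminf[symmetric]) auto
  also have "\<dots> = (\<integral>\<^sup>+\<omega>. g \<omega> * indicator (\<Union>n. A n) \<omega> \<partial>M)"
    using suminf_indicator[OF disj] by simp
  also have "\<dots> \<le> (\<integral>\<^sup>+\<omega>. g \<omega> \<partial>M)"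
    by (intro nn_integral_mono) (auto split: split_indicator)
  finally show ?thesis .
qed

definition approximable :: "('a \<Rightarrow> real) \<Rightarrow> bool" where
  "approximable f \<longleftrightarrow> (\<forall>\<epsilon>>0. \<exists>n g. integrable M g \<and> g \<in> borel_measurable (F n) \<and>
     (\<integral>\<omega>. \<bar>f \<omega> - g \<omega>\<bar> \<partial>M) < \<epsilon>)"

lemma approximable_limit:
  assumes f: "integrable M f" and s: "\<And>i. integrable M (s i)" "\<And>i. approximable (s i)"
    and lim: "\<And>x. x \<in> space M \<Longrightarrow> (\<lambda>i. s i x) \<longlonglongrightarrow> f x"
    and w: "integrable M w" "\<And>i x. x \<in> space M \<Longrightarrow> \<bar>f x - s i x\<bar> \<le> w x"
  shows "approximable f"
  unfolding approximable_def
proof (intro allI impI)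
  fix \<epsilon> :: real assume \<epsilon>: "0 < \<epsilon>"
  have "(\<lambda>i. \<integral>x. \<bar>f x - s i x\<bar> \<partial>M) \<longlonglongrightarrow> (\<integral>x. 0 \<partial>M)"
  proof (rule integral_dominated_convergence[OF _ _ w(1)])
    show "AE x in M. (\<lambda>i. \<bar>f x - s i x\<bar>) \<longlonglongrightarrow> 0"
    proof (intro AE_I2)
      fix x assume "x \<in> space M"
      then have "(\<lambda>i. \<bar>f x - s i x\<bar>) \<longlonglongrightarrow> \<bar>f x - f x\<bar>"
        by (intro tendsto_intros lim)
      then show "(\<lambda>i. \<bar>f x - s i x\<bar>) \<longlonglongrightarrow> 0" by simp
    qed
  qed (use f s w in auto)
  then have "eventually (\<lambda>i. (\<integral>x. \<bar>f x - s i x\<bar> \<partial>M) < \<epsilon> / 2) sequentially"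
    using \<epsilon> by (intro order_tendstoD) auto
  then obtain i where i: "(\<integral>x. \<bar>f x - s i x\<bar> \<partial>M) < \<epsilon> / 2"
    by (auto simp: eventually_sequentially)
  obtain n g where g: "integrable M g" "g \<in> borel_measurable (F n)" "(\<integral>x. \<bar>s i x - g x\<bar> \<partial>M) < \<epsilon> / 2"
    using s(2)[of i] \<epsilon> unfolding approximable_def by (meson half_gt_zero)
  have "(\<integral>x. \<bar>f x - g x\<bar> \<partial>M) \<le> (\<integral>x. \<bar>f x - s i x\<bar> + \<bar>s i x - g x\<bar> \<partial>M)"
    using f s g by (intro integral_mono) auto
  also have "\<dots> = (\<integral>x. \<bar>f x - s i x\<bar> \<partial>M) + (\<integral>x. \<bar>s i x - g x\<bar> \<partial>M)"
    using f s g by (intro Bochner_Integration.integral_add) auto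
  finally show "\<exists>n g. integrable M g \<and> g \<in> borel_measurable (F n) \<and> (\<integral>\<omega>. \<bar>f \<omega> - g \<omega>\<bar> \<partial>M) < \<epsilon>"
    using i g by (intro exI[of _ n] exI[of _ g]) auto
qed

lemma approximable_add:
  assumes f: "integrable M f" "approximable f" and h: "integrable M h" "approximable h"
  shows "approximable (\<lambda>x. f x + h x)"
  unfolding approximable_def
proof (intro allI impI)
  fix \<epsilon> :: real assume \<epsilon>: "0 < \<epsilon>"
  obtain n g where g: "integrable M g" "g \<in> borel_measurable (F n)" "(\<integral>x. \<bar>f x - g x\<bar> \<partial>M) < \<epsilon> / 2"
    using f(2) \<epsilon> unfolding approximable_def by (meson half_gt_zero)
  obtain m k where k: "integrable M k" "k \<in> borel_measurable (F m)" "(\<integral>x. \<bar>h x - k x\<bar> \<partial>M) < \<epsilon> / 2"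
    using h(2) \<epsilon> unfolding approximable_def by (meson half_gt_zero)
  have "(\<integral>x. \<bar>(f x + h x) - (g x + k x)\<bar> \<partial>M) \<le> (\<integral>x. \<bar>f x - g x\<bar> + \<bar>h x - k x\<bar> \<partial>M)"
    using f g h k by (intro integral_mono) auto
  also have "\<dots> = (\<integral>x. \<bar>f x - g x\<bar> \<partial>M) + (\<integral>x. \<bar>h x - k x\<bar> \<partial>M)"
    using f g h k by (intro Bochner_Integration.integral_add) auto
  finally have "(\<integral>x. \<bar>(f x + h x) - (g x + k x)\<bar> \<partial>M) < \<epsilon>"
    using g k by simp
  moreover have "(\<lambda>x. g x + k x) \<in> borel_measurable (F (max n m))"
    by (intro borel_measurable_add measurable_F_mono[OF _ g(2)] measurable_F_mono[OF _ k(2)]) auto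
  ultimately show "\<exists>n g. integrable M g \<and> g \<in> borel_measurable (F n) \<and> (\<integral>x. \<bar>(f x + h x) - g x\<bar> \<partial>M) < \<epsilon>"
    using g k by (intro exI[of _ "max n m"] exI[of _ "\<lambda>x. g x + k x"]) auto
qed

lemma approximable_cmult:
  assumes "approximable f"
  shows "approximable (\<lambda>x. c * f x)"
  unfolding approximable_def
proof (intro allI impI)
  fix \<epsilon> :: real assume \<epsilon>: "0 < \<epsilon>"
  then have "0 < \<epsilon> / (\<bar>c\<bar> + 1)" by (simp add: add_nonneg_pos)
  then obtain n g where g: "integrable M g" "g \<in> borel_measurable (F n)" "(\<integral>x. \<bar>f x - g x\<bar> \<partial>M) < \<epsilon> / (\<bar>c\<bar> + 1)"
    using assms unfolding approximable_def by meson
  have "(\<integral>x. \<bar>c * f x - c * g x\<bar> \<partial>M) = \<bar>c\<bar> * (\<integral>x. \<bar>f x - g x\<bar> \<partial>M)"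
    by (simp add: abs_mult flip: right_diff_distrib)
  also have "\<dots> \<le> (\<bar>c\<bar> + 1) * (\<integral>x. \<bar>f x - g x\<bar> \<partial>M)"
    by (intro mult_right_mono) auto
  also have "\<dots> < \<epsilon>"
    using g(3) by (simp add: field_simps add_nonneg_pos)
  finally have "(\<integral>x. \<bar>c * f x - c * g x\<bar> \<partial>M) < \<epsilon>" .
  then show "\<exists>n g. integrable M g \<and> g \<in> borel_measurable (F n) \<and> (\<integral>x. \<bar>c * f x - g x\<bar> \<partial>M) < \<epsilon>"
    using g by (intro exI[of _ n] exI[of _ "\<lambda>x. c * g x"]) auto
qed

lemma approximable_F:
  assumes "integrable M f" "f \<in> borel_measurable (F n)"
  shows "approximable f"
  unfolding approximable_def using assms by (intro allI impI exI[of _ n] exI[of _ f]) auto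

lemma approximable_cong:
  assumes "\<And>x. x \<in> space M \<Longrightarrow> f x = g x" "approximable f"
  shows "approximable g"
proof -
  have "(\<integral>x. \<bar>f x - h x\<bar> \<partial>M) = (\<integral>x. \<bar>g x - h x\<bar> \<partial>M)" for h
    using assms(1) by (intro Bochner_Integration.integral_cong) auto
  with assms(2) show ?thesis by (simp add: approximable_def)
qed

text \<open>
  Limits, sums and multiples of approximable functions are approximable, hence the events with
  approximable indicator form a Dynkin system.
\<close>

lemma approximable_indicator:
  assumes "A \<in> sets M"
  shows "approximable (indicator A)"
proof -
  have stable: "Int_stable (\<Union>n. sets (F n))"
  proof (rule Int_stableI)
    fix A B assume "A \<in> (\<Union>n. sets (F n))" "B \<in> (\<Union>n. sets (F n))"
    then obtain n m where "A \<in> sets (F n)" "B \<in> sets (F m)" by blast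
    then have "A \<in> sets (F (max n m))" "B \<in> sets (F (max n m))"
      using F_mono[of n "max n m"] F_mono[of m "max n m"] by auto
    then show "A \<inter> B \<in> (\<Union>n. sets (F n))" by blast
  qed
  have "(\<Union>n. sets (F n)) \<subseteq> Pow (space M)"
    using sets.sets_into_space space_F by blast
  from stable this assms[unfolded F_generates] show ?thesis
  proof (induct rule: sigma_sets_induct_disjoint)
  case (basic A)
  then obtain n where n: "A \<in> sets (F n)" by blast
  show ?case
  proof (rule approximable_F[of _ n])
    show "integrable M (indicator A :: _ \<Rightarrow> real)"
      using sets_F_subset[OF n] by (simp add: emeasure_eq_measure)
  qed (use n in simp)
next
  case empty
  have "approximable (\<lambda>_. 0)" by (rule approximable_F[of _ 0]) auto
  then show ?case by simp
next
  case (compl A)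
  then have A: "A \<in> sets M" by (simp add: F_generates)
  have "approximable (\<lambda>x. 1 + (- 1) * indicator A x)"
    using A by (intro approximable_add approximable_cmult compl approximable_F[of _ 0])
      (auto simp: emeasure_eq_measure)
  then show ?case
    by (rule approximable_cong[rotated]) (auto split: split_indicator)
next
  case (union A)
  then have A: "A i \<in> sets M" for i by (auto simp: F_generates)
  have int: "integrable M (indicator B :: _ \<Rightarrow> real)" if "B \<in> sets M" for B
    using that by (simp add: emeasure_eq_measure)
  have part: "approximable (\<lambda>x. \<Sum>i<n. indicator (A i) x)" for n
  proof (induct n)
    case 0
    show ?case using approximable_F[of "\<lambda>_. 0" 0] by simp
  next
    case (Suc n)
    then show ?case
      using A int by (simp only: sum.lessThan_Suc, intro approximable_add union Bochner_Integration.integrable_sum) auto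
  qed
  have sums: "(\<lambda>i. indicator (A i) x :: real) sums indicator (\<Union>i. A i) x" for x
  proof (cases "x \<in> (\<Union>i. A i)")
    case True
    then obtain k where k: "x \<in> A k" by blast
    then have "indicator (A i) x = (if i = k then 1 else 0 :: real)" for i
      using union(1) by (auto simp: disjoint_family_on_def indicator_def)
    moreover have "(\<lambda>i. if i = k then 1 else 0 :: real) sums 1"
      using sums_single[of k "\<lambda>_. 1 :: real"] by simp
    ultimately show ?thesis using True by simp
  qed simp
  show ?case
  proof (rule approximable_limit[where s = "\<lambda>n x. \<Sum>i<n. indicator (A i) x" and w = "\<lambda>_. 1"])
    show "(\<lambda>n. \<Sum>i<n. indicator (A i) x :: real) \<longlonglongrightarrow> indicator (\<Union>i. A i) x" for x
      using sums unfolding sums_def .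
    fix n x
    have "0 \<le> (\<Sum>i<n. indicator (A i) x :: real)" by (intro sum_nonneg) simp
    moreover have "(\<Sum>i<n. indicator (A i) x :: real) \<le> indicator (\<Union>i. A i) x"
      unfolding sums_unique[OF sums[of x]]
      by (intro sum_le_suminf sums_summable[OF sums]) auto
    moreover have "indicator (\<Union>i. A i) x \<le> (1::real)" by (simp add: indicator_def)
    ultimately show "\<bar>indicator (\<Union>i. A i) x - (\<Sum>i<n. indicator (A i) x)\<bar> \<le> (1::real)"
      by linarith
  qed (use A int part in auto)
qed
qed

lemma approximable_integrable:
  assumes "integrable M f"
  shows "approximable f"
  using assms
proof induct
  case (base A c)
  then show ?case
    using approximable_cmult[OF approximable_indicator, of A c] by (simp add: mult.commute)
next
  case (add f g)
  then show ?case by (intro approximable_add)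
next
  case (lim f s)
  show ?case
  proof (rule approximable_limit[where s = s and w = "\<lambda>x. 3 * \<bar>f x\<bar>"])
    fix i x assume "x \<in> space M"
    from lim(4)[OF this, of i] have "\<bar>s i x\<bar> \<le> 2 * \<bar>f x\<bar>" by simp
    then show "\<bar>f x - s i x\<bar> \<le> 3 * \<bar>f x\<bar>" by linarith
  qed (use lim in auto)
qed

text \<open>
  For an integrable function that is measurable at some level, convergence is trivial. Such functions
  approximate X in mean, and the maximal inequality controls the conditional expectations of the
  error for all n at once.
\<close>

theorem cond_exp_converges:
  assumes X: "integrable M X"
  shows "AE \<omega> in M. (\<lambda>n. real_cond_exp M (F n) X \<omega>) \<longlonglongrightarrow> X \<omega>"
proof -
  have [measurable]: "X \<in> borel_measurable M" using X by simp
  define Bad where "Bad c = {\<omega> \<in> space M. \<not> (\<exists>m. \<forall>n. m \<le> n \<longrightarrow> \<bar>real_cond_exp M (F n) X \<omega> - X \<omega>\<bar> \<le> 2 * c)}" for c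
  have [measurable]: "Bad c \<in> sets M" for c
    unfolding Bad_def by measurable
  have small: "ennreal c * emeasure M (Bad c) \<le> ennreal (2 * \<epsilon>)" if c: "0 < c" and \<epsilon>: "0 < \<epsilon>" for c \<epsilon> :: real
  proof -
    obtain k Y where Y: "integrable M Y" "Y \<in> borel_measurable (F k)" "(\<integral>\<omega>. \<bar>X \<omega> - Y \<omega>\<bar> \<partial>M) < \<epsilon>"
      using approximable_integrable[OF X] \<epsilon> unfolding approximable_def by blast
    have [measurable]: "Y \<in> borel_measurable M" using Y by simp
    define D where "D \<omega> = ennreal \<bar>X \<omega> - Y \<omega>\<bar>" for \<omega>
    have [measurable]: "D \<in> borel_measurable M" unfolding D_def by measurable
    have D: "(\<integral>\<^sup>+\<omega>. D \<omega> \<partial>M) \<le> ennreal \<epsilon>"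
      unfolding D_def using X Y by (subst nn_integral_eq_integral) (auto intro: ennreal_leI)
    define U where "U = {\<omega> \<in> space M. \<exists>n. ennreal c < nn_cond_exp M (F n) D \<omega>}"
    define V where "V = {\<omega> \<in> space M. 1 \<le> ennreal (1 / c) * D \<omega>}"
    have [measurable]: "U \<in> sets M" "V \<in> sets M" unfolding U_def V_def by measurable
    have conv: "AE \<omega> in M. \<forall>n. k \<le> n \<longrightarrow> real_cond_exp M (F n) X \<omega> - Y \<omega> = real_cond_exp M (F n) (\<lambda>\<omega>. X \<omega> - Y \<omega>) \<omega> \<and>
        \<bar>real_cond_exp M (F n) (\<lambda>\<omega>. X \<omega> - Y \<omega>) \<omega>\<bar> \<le> nn_cond_exp M (F n) D \<omega>"
      unfolding AE_all_countable
    proof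
      fix n
      interpret sigma_finite_subalgebra M "F n" by (rule sigma_finite_subalgebra_F)
      show "AE \<omega> in M. k \<le> n \<longrightarrow> real_cond_exp M (F n) X \<omega> - Y \<omega> = real_cond_exp M (F n) (\<lambda>\<omega>. X \<omega> - Y \<omega>) \<omega> \<and>
        \<bar>real_cond_exp M (F n) (\<lambda>\<omega>. X \<omega> - Y \<omega>) \<omega>\<bar> \<le> nn_cond_exp M (F n) D \<omega>"
      proof (cases "k \<le> n")
        case True
        have "AE \<omega> in M. real_cond_exp M (F n) Y \<omega> = Y \<omega>"
          using Y True by (intro real_cond_exp_F_meas) (auto intro: measurable_F_mono)
        moreover have "AE \<omega> in M. real_cond_exp M (F n) (\<lambda>\<omega>. X \<omega> - Y \<omega>) \<omega> =
            real_cond_exp M (F n) X \<omega> - real_cond_exp M (F n) Y \<omega>"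
          using X Y by (intro real_cond_exp_diff)
        moreover have "AE \<omega> in M. \<bar>real_cond_exp M (F n) (\<lambda>\<omega>. X \<omega> - Y \<omega>) \<omega>\<bar> \<le> nn_cond_exp M (F n) D \<omega>"
          unfolding D_def by (rule real_cond_exp_abs) simp
        ultimately show ?thesis by eventually_elim simp
      qed simp
    qed
    \<comment> \<open>Once n is at least k, a deviation above \<open>2 c\<close> requires that D or one of its conditional
      expectations exceeds c.\<close>
    have "emeasure M (Bad c) \<le> emeasure M (U \<union> V)"
    proof (rule emeasure_mono_AE)
      show "AE \<omega> in M. \<omega> \<in> Bad c \<longrightarrow> \<omega> \<in> U \<union> V"
        using conv
      proof eventually_elim
        case (elim \<omega>)
        show ?case
        proof
          assume bad: "\<omega> \<in> Bad c"
          show "\<omega> \<in> U \<union> V"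
          proof (rule ccontr)
            assume "\<omega> \<notin> U \<union> V"
            with bad have UV: "\<And>n. nn_cond_exp M (F n) D \<omega> \<le> ennreal c" "ennreal (1 / c) * D \<omega> < 1"
              by (auto simp: Bad_def U_def V_def not_less not_le)
            have "ennreal (1 / c * \<bar>X \<omega> - Y \<omega>\<bar>) < ennreal 1"
              using UV(2) ennreal_mult[of "1 / c" "\<bar>X \<omega> - Y \<omega>\<bar>"] c unfolding D_def ennreal_1 by simp
            then have XY: "\<bar>X \<omega> - Y \<omega>\<bar> < c"
              using c by (subst (asm) ennreal_less_iff) (auto simp: field_simps)
            have "\<bar>real_cond_exp M (F n) X \<omega> - X \<omega>\<bar> \<le> 2 * c" if n: "k \<le> n" for n
            proof -
              have e: "real_cond_exp M (F n) X \<omega> - Y \<omega> = real_cond_exp M (F n) (\<lambda>\<omega>. X \<omega> - Y \<omega>) \<omega>"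
                and le: "\<bar>real_cond_exp M (F n) (\<lambda>\<omega>. X \<omega> - Y \<omega>) \<omega>\<bar> \<le> nn_cond_exp M (F n) D \<omega>"
                using elim n by blast+
              have "ennreal \<bar>real_cond_exp M (F n) (\<lambda>\<omega>. X \<omega> - Y \<omega>) \<omega>\<bar> \<le> ennreal c"
                using order_trans[OF le UV(1)] .
              then have "\<bar>real_cond_exp M (F n) X \<omega> - Y \<omega>\<bar> \<le> c"
                unfolding e using c by simp
              with XY show ?thesis by linarith
            qed
            with bad show False unfolding Bad_def by blast
          qed
        qed
      qed
    qed auto
    also have "\<dots> \<le> emeasure M U + emeasure M V"
      by (rule emeasure_subadditive) auto
    finally have "ennreal c * emeasure M (Bad c) \<le> ennreal c * emeasure M U + ennreal c * emeasure M V"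
      using mult_left_mono by (fastforce simp: distrib_left)
    moreover have "ennreal c * emeasure M U \<le> ennreal \<epsilon>"
      using maximal_inequality[of D c] c D by (auto simp: U_def)
    moreover have "ennreal c * emeasure M V \<le> ennreal \<epsilon>"
    proof -
      have "emeasure M V \<le> ennreal (1 / c) * (\<integral>\<^sup>+\<omega>. D \<omega> * indicator (space M) \<omega> \<partial>M)"
        unfolding V_def by (rule nn_integral_Markov_inequality) auto
      also have "(\<integral>\<^sup>+\<omega>. D \<omega> * indicator (space M) \<omega> \<partial>M) = (\<integral>\<^sup>+\<omega>. D \<omega> \<partial>M)"
        by (intro nn_integral_cong) simp
      finally have "ennreal c * emeasure M V \<le> ennreal c * (ennreal (1 / c) * (\<integral>\<^sup>+\<omega>. D \<omega> \<partial>M))"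
        by (rule mult_left_mono) simp
      also have "\<dots> = (\<integral>\<^sup>+\<omega>. D \<omega> \<partial>M)"
        using c by (simp add: mult.assoc[symmetric] ennreal_mult[symmetric])
      finally show ?thesis using D by simp
    qed
    ultimately have "ennreal c * emeasure M (Bad c) \<le> ennreal \<epsilon> + ennreal \<epsilon>"
      by (meson add_mono order_trans)
    then show ?thesis
      using ennreal_plus[of \<epsilon> \<epsilon>] \<epsilon> by (simp only: mult_2 less_imp_le)
  qed
  have zero: "emeasure M (Bad c) = 0" if c: "0 < c" for c
  proof -
    have "ennreal c * emeasure M (Bad c) \<le> 0"
    proof (rule ennreal_le_epsilon)
      fix e :: real assume "0 < e"
      then show "ennreal c * emeasure M (Bad c) \<le> 0 + ennreal e"
        using small[OF c, of "e / 2"] by simp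
    qed
    then show ?thesis using c by simp
  qed
  have "AE \<omega> in M. \<forall>j. \<omega> \<notin> Bad (1 / real (Suc j))"
    unfolding AE_all_countable by (intro allI AE_not_in null_setsI zero) auto
  then show ?thesis
    using AE_space
  proof eventually_elim
    case (elim \<omega>)
    show ?case
    proof (rule tendstoI)
      fix e :: real assume e: "0 < e"
      then obtain j where j: "1 / real (Suc j) < e / 2"
        using nat_approx_posE[of "e / 2"] by auto
      have "\<omega> \<notin> Bad (1 / real (Suc j))" using elim by blast
      then obtain m where m: "\<And>n. m \<le> n \<Longrightarrow> \<bar>real_cond_exp M (F n) X \<omega> - X \<omega>\<bar> \<le> 2 * (1 / real (Suc j))"
        using elim unfolding Bad_def by blast
      show "eventually (\<lambda>n. dist (real_cond_exp M (F n) X \<omega>) (X \<omega>) < e) sequentially"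
        unfolding eventually_sequentially dist_real_def
      proof (intro exI[of _ m] allI impI)
        fix n assume "m \<le> n"
        from m[OF this] j show "\<bar>real_cond_exp M (F n) X \<omega> - X \<omega>\<bar> < e" by linarith
      qed
    qed
  qed
qed

end

section \<open>Coordinate algebras\<close>

lemma space_cascade_space: "space (cascade_space b) = (\<Pi>\<^sub>E \<gamma>\<in>tree_words b. {0..})"
  by (simp add: space_PiM space_restrict_space)

lemma coord_algebra_generators:
  "(\<Union>\<gamma>\<in>I. {(\<lambda>\<omega>. \<omega> \<gamma>) -` A \<inter> space (cascade_space b) | A. A \<in> sets nonneg_borel}) \<subseteq> Pow (space (cascade_space b))"
  by auto

lemma space_coord_algebra: "space (coord_algebra b I) = space (cascade_space b)"
  unfolding coord_algebra_def by (rule space_measure_of[OF coord_algebra_generators])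

lemma sets_coord_algebra: "sets (coord_algebra b I) = sigma_sets (space (cascade_space b))
    (\<Union>\<gamma>\<in>I. {(\<lambda>\<omega>. \<omega> \<gamma>) -` A \<inter> space (cascade_space b) | A. A \<in> sets nonneg_borel})"
  unfolding coord_algebra_def by (rule sets_measure_of[OF coord_algebra_generators])

lemma coord_algebra_mono: "I \<subseteq> J \<Longrightarrow> sets (coord_algebra b I) \<subseteq> sets (coord_algebra b J)"
  unfolding sets_coord_algebra by (intro sigma_sets_mono' UN_mono) auto

lemma measurable_coord_algebra:
  assumes "\<gamma> \<in> I" "\<gamma> \<in> tree_words b"
  shows "(\<lambda>\<omega>. \<omega> \<gamma>) \<in> coord_algebra b I \<rightarrow>\<^sub>M nonneg_borel"
proof (rule measurableI)
  fix A :: "real set" assume "A \<in> sets nonneg_borel"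
  then show "(\<lambda>\<omega>. \<omega> \<gamma>) -` A \<inter> space (coord_algebra b I) \<in> sets (coord_algebra b I)"
    unfolding space_coord_algebra sets_coord_algebra using assms(1) by (intro sigma_sets.Basic) blast
qed (use assms(2) in \<open>auto simp: space_coord_algebra space_cascade_space space_restrict_space PiE_iff\<close>)

lemma borel_measurable_coord_algebra:
  assumes "\<gamma> \<in> I" "\<gamma> \<in> tree_words b"
  shows "(\<lambda>\<omega>. \<omega> \<gamma>) \<in> borel_measurable (coord_algebra b I)"
  by (rule measurable_compose[OF measurable_coord_algebra[OF assms]])
     (rule measurable_restrict_space1, simp)

lemma coord_algebra_subset_cascade_space:
  assumes "I \<subseteq> tree_words b"
  shows "sets (coord_algebra b I) \<subseteq> sets (cascade_space b)"
  unfolding sets_coord_algebra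
proof (rule sets.sigma_sets_subset, rule subsetI)
  fix B assume "B \<in> (\<Union>\<gamma>\<in>I. {(\<lambda>\<omega>. \<omega> \<gamma>) -` A \<inter> space (cascade_space b) | A. A \<in> sets nonneg_borel})"
  then obtain \<gamma> A where *: "\<gamma> \<in> I" "A \<in> sets nonneg_borel" "B = (\<lambda>\<omega>. \<omega> \<gamma>) -` A \<inter> space (cascade_space b)"
    by blast
  have "(\<lambda>\<omega>. \<omega> \<gamma>) \<in> cascade_space b \<rightarrow>\<^sub>M nonneg_borel"
    by (rule measurable_component_singleton) (use * assms in auto)
  from measurable_sets[OF this *(2)] show "B \<in> sets (cascade_space b)"
    using *(3) by simp
qed

text \<open>
  An event of a coordinate algebra is an event about the restricted family of weights; this
  carries an identity of laws on the product over I to the coordinate algebra.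
\<close>

lemma coord_algebra_restrict:
  assumes I: "I \<subseteq> tree_words b" and C: "C \<in> sets (coord_algebra b I)"
  shows "\<exists>B\<in>sets (\<Pi>\<^sub>M \<gamma>\<in>I. nonneg_borel). C = (\<lambda>\<omega>. restrict \<omega> I) -` B \<inter> space (cascade_space b)"
proof -
  let ?X = "space (cascade_space b)" and ?N = "\<Pi>\<^sub>M \<gamma>\<in>I. nonneg_borel"
  have r: "(\<lambda>\<omega>. restrict \<omega> I) \<in> ?X \<rightarrow> space ?N"
    using I by (auto simp: space_cascade_space space_PiM space_restrict_space PiE_iff)
  have "sets (coord_algebra b I) \<subseteq> sets (vimage_algebra ?X (\<lambda>\<omega>. restrict \<omega> I) ?N)"
    unfolding sets_coord_algebra
  proof (subst (1) space_vimage_algebra[symmetric], rule sets.sigma_sets_subset, rule subsetI)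
    fix B assume "B \<in> (\<Union>\<gamma>\<in>I. {(\<lambda>\<omega>. \<omega> \<gamma>) -` A \<inter> ?X | A. A \<in> sets nonneg_borel})"
    then obtain \<gamma> A where *: "\<gamma> \<in> I" "A \<in> sets nonneg_borel" "B = (\<lambda>\<omega>. \<omega> \<gamma>) -` A \<inter> ?X"
      by blast
    have "(\<lambda>x. x \<gamma>) \<in> ?N \<rightarrow>\<^sub>M nonneg_borel"
      by (rule measurable_component_singleton) fact
    from measurable_sets[OF this *(2)] have "(\<lambda>x. x \<gamma>) -` A \<inter> space ?N \<in> sets ?N" .
    from in_vimage_algebra[OF this, of "\<lambda>\<omega>. restrict \<omega> I" ?X]
    have "(\<lambda>\<omega>. restrict \<omega> I) -` ((\<lambda>x. x \<gamma>) -` A \<inter> space ?N) \<inter> ?X \<in> sets (vimage_algebra ?X (\<lambda>\<omega>. restrict \<omega> I) ?N)" .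
    moreover have "(\<lambda>\<omega>. restrict \<omega> I) -` ((\<lambda>x. x \<gamma>) -` A \<inter> space ?N) \<inter> ?X = B"
      using * r by (auto simp: Pi_iff)
    ultimately show "B \<in> sets (vimage_algebra ?X (\<lambda>\<omega>. restrict \<omega> I) ?N)" by simp
  qed
  with C show ?thesis
    unfolding sets_vimage_algebra2[OF r] by blast
qed

section \<open>Cascade generators\<close>

locale cascade_model =
  fixes b :: nat and p :: "real measure" and q :: "nat \<Rightarrow> (nat \<Rightarrow> real) \<Rightarrow> real measure"
    and P :: "(nat list \<Rightarrow> real) measure"
  assumes b: "b \<ge> 2" and generator: "cascade_generator b p q P"
begin

lemma sets_P: "sets P = sets (cascade_space b)"
  using generator by (simp add: cascade_generator_def)

lemma space_P: "space P = space (cascade_space b)"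
  by (rule sets_eq_imp_space_eq[OF sets_P])

sublocale prob_space P
  using generator by (simp add: cascade_generator_def)

lemma W_nonneg: "\<omega> \<in> space P \<Longrightarrow> \<gamma> \<in> tree_words b \<Longrightarrow> 0 \<le> \<omega> \<gamma>"
  by (auto simp: space_P space_cascade_space PiE_iff)

lemma measurable_W: "\<gamma> \<in> tree_words b \<Longrightarrow> (\<lambda>\<omega>. \<omega> \<gamma>) \<in> P \<rightarrow>\<^sub>M nonneg_borel"
  using measurable_component_singleton[of \<gamma> "tree_words b" "\<lambda>_. nonneg_borel"]
  by (simp cong: measurable_cong_sets add: sets_P)

lemma borel_measurable_W: "\<gamma> \<in> tree_words b \<Longrightarrow> (\<lambda>\<omega>. \<omega> \<gamma>) \<in> borel_measurable P"
  by (rule measurable_compose[OF measurable_W]) (auto intro: measurable_restrict_space1)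

lemma subalgebra_coord: "I \<subseteq> tree_words b \<Longrightarrow> subalgebra P (coord_algebra b I)"
  using coord_algebra_subset_cascade_space[of I b]
  by (simp add: subalgebra_def space_coord_algebra space_P sets_P)

lemma sigma_finite_subalgebra_coord: "I \<subseteq> tree_words b \<Longrightarrow> sigma_finite_subalgebra P (coord_algebra b I)"
  by (intro finite_measure_subalgebra_is_sigma_finite finite_measure_subalgebra.intro
      finite_measure_subalgebra_axioms.intro subalgebra_coord finite_measure_axioms)

lemma path_algebra_subset_level:
  "\<gamma> \<in> tree_words b \<Longrightarrow> sets (path_algebra b \<gamma>) \<subseteq> sets (level_algebra b (length \<gamma>))"
  unfolding path_algebra_def level_algebra_def
  by (intro coord_algebra_mono) (auto simp: take_in_tree_words)

lemma level_algebra_mono: "m \<le> n \<Longrightarrow> sets (level_algebra b m) \<subseteq> sets (level_algebra b n)"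
  unfolding level_algebra_def by (intro coord_algebra_mono) auto

lemma subalgebra_level: "subalgebra P (level_algebra b n)"
  unfolding level_algebra_def by (rule subalgebra_coord) auto

sublocale generating_filtration P "level_algebra b"
proof
  show "subalgebra P (level_algebra b n)" for n by (rule subalgebra_level)
  show "m \<le> n \<Longrightarrow> sets (level_algebra b m) \<subseteq> sets (level_algebra b n)" for m n by (rule level_algebra_mono)
  show "sets P = sigma_sets (space P) (\<Union>n. sets (level_algebra b n))"
  proof
    show "sets P \<subseteq> sigma_sets (space P) (\<Union>n. sets (level_algebra b n))"
      unfolding sets_P sets_PiM_single space_P space_PiM
    proof (rule sigma_sets_mono, rule subsetI)
      fix B assume "B \<in> {{f \<in> \<Pi>\<^sub>E i\<in>tree_words b. space nonneg_borel. f i \<in> A} |i A. i \<in> tree_words b \<and> A \<in> sets nonneg_borel}"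
      then obtain \<gamma> A where *: "\<gamma> \<in> tree_words b" "A \<in> sets nonneg_borel"
          "B = {f \<in> \<Pi>\<^sub>E i\<in>tree_words b. space nonneg_borel. f \<gamma> \<in> A}" by blast
      have "(\<lambda>\<omega>. \<omega> \<gamma>) -` A \<inter> space (level_algebra b (length \<gamma>)) \<in> sets (level_algebra b (length \<gamma>))"
        unfolding level_algebra_def
        by (rule measurable_sets[OF measurable_coord_algebra *(2)]) (use * in auto)
      moreover have "(\<lambda>\<omega>. \<omega> \<gamma>) -` A \<inter> space (level_algebra b (length \<gamma>)) = B"
        using *(3) by (auto simp: level_algebra_def space_coord_algebra space_PiM)
      ultimately show "B \<in> sigma_sets (\<Pi>\<^sub>E i\<in>tree_words b. space nonneg_borel) (\<Union>n. sets (level_algebra b n))"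
        by (intro sigma_sets.Basic) blast
    qed
    show "sigma_sets (space P) (\<Union>n. sets (level_algebra b n)) \<subseteq> sets P"
      using subalgebra_level by (intro sets.sigma_sets_subset) (auto simp: subalgebra_def)
  qed
qed

lemma level_measurable_coord:
  "\<gamma> \<in> tree_words b \<Longrightarrow> length \<gamma> \<le> n \<Longrightarrow> (\<lambda>\<omega>. \<omega> \<gamma>) \<in> level_algebra b n \<rightarrow>\<^sub>M nonneg_borel"
  unfolding level_algebra_def by (rule measurable_coord_algebra) auto

abbreviation past :: "nat list \<Rightarrow> (nat list \<Rightarrow> real) \<Rightarrow> nat \<Rightarrow> real" where
  "past \<tau> x \<equiv> \<lambda>j\<in>{..<length \<tau>}. x (take j \<tau>)"

lemma q_kernel: "n \<ge> 1 \<Longrightarrow> q n \<in> (\<Pi>\<^sub>M i\<in>{..<n}. nonneg_borel) \<rightarrow>\<^sub>M prob_algebra nonneg_borel"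
  using generator by (simp add: cascade_generator_def)

lemma measurable_past:
  assumes "\<And>j. j < length \<tau> \<Longrightarrow> (\<lambda>x. x (take j \<tau>)) \<in> K \<rightarrow>\<^sub>M nonneg_borel"
  shows "past \<tau> \<in> K \<rightarrow>\<^sub>M (\<Pi>\<^sub>M i\<in>{..<length \<tau>}. nonneg_borel)"
  using assms by (intro measurable_restrict) auto

lemma measurable_kernel_past:
  assumes "\<And>j. j < length \<tau> \<Longrightarrow> (\<lambda>x. x (take j \<tau>)) \<in> K \<rightarrow>\<^sub>M nonneg_borel" "\<tau> \<noteq> []" "A \<in> sets nonneg_borel"
  shows "(\<lambda>x. emeasure (q (length \<tau>) (past \<tau> x)) A) \<in> borel_measurable K"
proof -
  have "(\<lambda>x. q (length \<tau>) (past \<tau> x)) \<in> K \<rightarrow>\<^sub>M prob_algebra nonneg_borel"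
    using assms by (intro measurable_compose[OF measurable_past q_kernel]) (auto simp: Suc_le_eq)
  then have "(\<lambda>x. q (length \<tau>) (past \<tau> x)) \<in> K \<rightarrow>\<^sub>M subprob_algebra nonneg_borel"
    by (rule measurable_prob_algebraD)
  then show ?thesis
    by (rule measurable_compose) (rule measurable_emeasure_subprob_algebra[OF assms(3)])
qed

text \<open>
  Integrated form of the generator axioms: given the past, the next level is drawn
  independently from the kernels.
\<close>

lemma nn_integral_next_level:
  assumes J: "finite J" "\<And>\<tau>. \<tau> \<in> J \<Longrightarrow> \<tau> \<in> tree_words b \<and> length \<tau> = Suc n"
    and A: "\<And>\<tau>. \<tau> \<in> J \<Longrightarrow> A \<tau> \<in> sets nonneg_borel"
    and \<psi>: "\<psi> \<in> borel_measurable (level_algebra b n)"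
  shows "(\<integral>\<^sup>+\<omega>. \<psi> \<omega> * (\<Prod>\<tau>\<in>J. indicator (A \<tau>) (\<omega> \<tau>)) \<partial>P) =
    (\<integral>\<^sup>+\<omega>. \<psi> \<omega> * (\<Prod>\<tau>\<in>J. emeasure (q (Suc n) (past \<tau> \<omega>)) (A \<tau>)) \<partial>P)"
proof (cases "J = {}")
  case False
  interpret sigma_finite_subalgebra P "level_algebra b n" by (rule sigma_finite_subalgebra_F)
  have [measurable]: "(\<lambda>\<omega>. \<omega> \<tau>) \<in> P \<rightarrow>\<^sub>M nonneg_borel" if "\<tau> \<in> J" for \<tau>
    using J(2)[OF that] by (intro measurable_W) blast
  define E where "E = {\<omega> \<in> space P. \<forall>\<tau>\<in>J. \<omega> \<tau> \<in> A \<tau>}"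
  have one: "{\<omega> \<in> space P. \<omega> \<tau> \<in> A \<tau>} \<in> sets P" if "\<tau> \<in> J" for \<tau>
    using measurable_sets[OF measurable_W A[OF that]] J(2)[OF that] by (simp add: vimage_def Int_def conj_commute)
  have E: "E \<in> sets P"
  proof -
    have "E = (\<Inter>\<tau>\<in>J. {\<omega> \<in> space P. \<omega> \<tau> \<in> A \<tau>})" using False by (auto simp: E_def)
    then show ?thesis using one J(1) False by (simp add: sets.finite_INT)
  qed
  have single: "AE \<omega> in P. real_cond_exp P (level_algebra b n) (indicator {\<omega> \<in> space P. \<omega> \<tau> \<in> A \<tau>}) \<omega> =
      measure (q (Suc n) (past \<tau> \<omega>)) (A \<tau>)" if \<tau>: "\<tau> \<in> J" for \<tau>
  proof -
    \<comment> \<open>A boundary point through \<open>\<tau>\<close>, continued by the letter 0.\<close>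
    define t where "t = (\<lambda>i. if i < Suc n then \<tau> ! i else 0)"
    have \<tau>': "\<tau> \<in> tree_words b" "length \<tau> = Suc n" using J(2)[OF \<tau>] by auto
    have "\<tau> ! i < b" if "i < Suc n" for i
      using \<tau>' that by (simp add: nth_tree_words)
    then have t: "t \<in> tree_boundary b" using b by (auto simp: t_def tree_boundary_def)
    have pre: "pre t j = take j \<tau>" if "j \<le> Suc n" for j
      using that \<tau>' by (intro nth_equalityI) (auto simp: t_def)
    have "past \<tau> \<omega> = (\<lambda>j\<in>{..<Suc n}. \<omega> (pre t j))" for \<omega>
      using \<tau>'(2) by (simp add: fun_eq_iff pre less_imp_le restrict_def)
    moreover have "AE \<omega> in P.
          real_cond_exp P (level_algebra b n) (indicator {x \<in> space P. x (pre t (Suc n)) \<in> A \<tau>}) \<omega> =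
          measure (q (Suc n) (\<lambda>j\<in>{..<Suc n}. \<omega> (pre t j))) (A \<tau>)"
      using generator t A[OF \<tau>] unfolding cascade_generator_def by blast
    moreover have "pre t (Suc n) = \<tau>"
      using pre[of "Suc n"] \<tau>'(2) by simp
    ultimately show ?thesis by (simp only:)
  qed
  have "cond_indep_vars P (level_algebra b n) nonneg_borel (\<lambda>\<gamma> \<omega>. \<omega> \<gamma>) {\<gamma> \<in> tree_words b. length \<gamma> = Suc n}"
    using generator by (simp add: cascade_generator_def)
  then have "AE \<omega> in P. real_cond_exp P (level_algebra b n) (indicator E) \<omega> =
      (\<Prod>\<tau>\<in>J. real_cond_exp P (level_algebra b n) (indicator {\<omega> \<in> space P. \<omega> \<tau> \<in> A \<tau>}) \<omega>)"
    unfolding cond_indep_vars_def E_def using J A False by blast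
  moreover have "AE \<omega> in P. \<forall>\<tau>\<in>J. real_cond_exp P (level_algebra b n) (indicator {\<omega> \<in> space P. \<omega> \<tau> \<in> A \<tau>}) \<omega> =
      measure (q (Suc n) (past \<tau> \<omega>)) (A \<tau>)"
    using single J(1) by (intro AE_finite_allI)
  moreover have "AE \<omega> in P. nn_cond_exp P (level_algebra b n) (\<lambda>\<omega>. ennreal (indicator E \<omega>)) \<omega> =
      ennreal (real_cond_exp P (level_algebra b n) (indicator E) \<omega>)"
    using E by (intro nn_cond_exp_eq_real_cond_exp) (auto simp: emeasure_eq_measure)
  ultimately have AE: "AE \<omega> in P. nn_cond_exp P (level_algebra b n) (\<lambda>\<omega>. ennreal (indicator E \<omega>)) \<omega> =
      (\<Prod>\<tau>\<in>J. emeasure (q (Suc n) (past \<tau> \<omega>)) (A \<tau>))"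
    using AE_space
  proof eventually_elim
    case (elim \<omega>)
    have "emeasure (q (Suc n) (past \<tau> \<omega>)) (A \<tau>) = ennreal (measure (q (Suc n) (past \<tau> \<omega>)) (A \<tau>))" if \<tau>: "\<tau> \<in> J" for \<tau>
    proof -
      have "past \<tau> \<in> P \<rightarrow>\<^sub>M (\<Pi>\<^sub>M i\<in>{..<length \<tau>}. nonneg_borel)"
        using J(2)[OF \<tau>] by (intro measurable_past measurable_W) (auto simp: take_in_tree_words)
      from measurable_space[OF this elim(4)] J(2)[OF \<tau>]
      have "q (Suc n) (past \<tau> \<omega>) \<in> space (prob_algebra nonneg_borel)"
        using measurable_space[OF q_kernel[of "Suc n"]] by simp
      then have "prob_space (q (Suc n) (past \<tau> \<omega>))" by (simp add: space_prob_algebra)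
      then show ?thesis
        by (intro finite_measure.emeasure_eq_measure prob_space.finite_measure)
    qed
    with elim show ?case by (simp add: prod_ennreal)
  qed
  have [measurable]: "\<psi> \<in> borel_measurable P" by (rule measurable_F_M[OF \<psi>])
  have "(\<integral>\<^sup>+\<omega>. \<psi> \<omega> * (\<Prod>\<tau>\<in>J. indicator (A \<tau>) (\<omega> \<tau>)) \<partial>P) = (\<integral>\<^sup>+\<omega>. \<psi> \<omega> * ennreal (indicator E \<omega>) \<partial>P)"
  proof (intro nn_integral_cong arg_cong[where f = "\<lambda>x. _ * x"])
    fix \<omega> assume "\<omega> \<in> space P"
    then show "(\<Prod>\<tau>\<in>J. indicator (A \<tau>) (\<omega> \<tau>)) = ennreal (indicator E \<omega>)"
      using J(1) by (cases "\<omega> \<in> E") (auto simp: E_def prod_zero_iff indicator_def intro!: prod.neutral)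
  qed
  also have "\<dots> = (\<integral>\<^sup>+\<omega>. \<psi> \<omega> * nn_cond_exp P (level_algebra b n) (\<lambda>\<omega>. ennreal (indicator E \<omega>)) \<omega> \<partial>P)"
    using E \<psi> by (intro nn_cond_exp_intg[symmetric]) auto
  also have "\<dots> = (\<integral>\<^sup>+\<omega>. \<psi> \<omega> * (\<Prod>\<tau>\<in>J. emeasure (q (Suc n) (past \<tau> \<omega>)) (A \<tau>)) \<partial>P)"
    using AE by (intro nn_integral_cong_AE) (auto elim: eventually_mono)
  finally show ?thesis .
qed simp

end

section \<open>Subtrees with the same past have the same law\<close>

text \<open>
  For an embedding h of a set S of words into the tree, \<open>pull h S \<omega>\<close> is the family of weights read off
  along the copy \<open>h ` S\<close>.
\<close>

definition pull :: "(nat list \<Rightarrow> nat list) \<Rightarrow> nat list set \<Rightarrow> (nat list \<Rightarrow> real) \<Rightarrow> nat list \<Rightarrow> real" where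
  "pull h S \<omega> = (\<lambda>\<tau>\<in>S. \<omega> (h \<tau>))"

definition up_to :: "nat list set \<Rightarrow> nat \<Rightarrow> nat list set" where
  "up_to S m = {\<tau> \<in> S. length \<tau> \<le> m}"

lemma measurable_pull:
  assumes "\<And>\<tau>. \<tau> \<in> S \<Longrightarrow> (\<lambda>\<omega>. \<omega> (h \<tau>)) \<in> K \<rightarrow>\<^sub>M nonneg_borel"
  shows "pull h S \<in> K \<rightarrow>\<^sub>M (\<Pi>\<^sub>M \<tau>\<in>S. nonneg_borel)"
  unfolding pull_def by (rule measurable_restrict) (rule assms)

lemma nn_integral_distr_density:
  assumes "T \<in> M \<rightarrow>\<^sub>M N" "\<phi> \<in> borel_measurable M" "f \<in> borel_measurable N"
  shows "(\<integral>\<^sup>+x. f x \<partial>distr (density M \<phi>) N T) = (\<integral>\<^sup>+x. \<phi> x * f (T x) \<partial>M)"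
proof -
  have [measurable]: "T \<in> M \<rightarrow>\<^sub>M N" "\<phi> \<in> borel_measurable M" "f \<in> borel_measurable N" by fact+
  show ?thesis
    by (subst nn_integral_distr) (auto simp: nn_integral_density)
qed

lemma emeasure_distr_density:
  assumes "T \<in> M \<rightarrow>\<^sub>M N" "\<phi> \<in> borel_measurable M" "X \<in> sets N"
  shows "emeasure (distr (density M \<phi>) N T) X = (\<integral>\<^sup>+x. \<phi> x * indicator X (T x) \<partial>M)"
  using nn_integral_distr_density[of T M N \<phi> "indicator X"] assms by simp

context cascade_model
begin

text \<open>
  Integrating out the top level leaves the same function of the remaining weights for every
  embedding that preserves lengths and prefixes.
\<close>

lemma nn_integral_pull_next_level:
  assumes S: "S \<subseteq> tree_words b" "\<And>\<tau> j. \<tau> \<in> S \<Longrightarrow> take j \<tau> \<in> S"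
    and h: "\<And>\<tau>. \<tau> \<in> S \<Longrightarrow> h \<tau> \<in> tree_words b" "inj_on h S" "\<And>\<tau>. length (h \<tau>) = length \<tau>"
      "\<And>k \<tau>. take k (h \<tau>) = h (take k \<tau>)"
    and A: "\<And>\<tau>. \<tau> \<in> S \<Longrightarrow> A \<tau> \<in> sets nonneg_borel"
    and \<psi>: "\<psi> \<in> borel_measurable (level_algebra b m)"
  shows "(\<integral>\<^sup>+\<omega>. \<psi> \<omega> * indicator (Pi\<^sub>E (up_to S (Suc m)) A) (pull h (up_to S (Suc m)) \<omega>) \<partial>P) =
    (\<integral>\<^sup>+\<omega>. \<psi> \<omega> * (\<lambda>x. (\<Prod>\<tau>\<in>up_to S m. indicator (A \<tau>) (x \<tau>)) *
       (\<Prod>\<tau>\<in>up_to S (Suc m) - up_to S m. emeasure (q (Suc m) (past \<tau> x)) (A \<tau>))) (pull h (up_to S m) \<omega>) \<partial>P)"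
proof -
  define lev where "lev = up_to S (Suc m) - up_to S m"
  have lev: "\<tau> \<in> lev \<longleftrightarrow> \<tau> \<in> S \<and> length \<tau> = Suc m" for \<tau> by (auto simp: lev_def up_to_def)
  have fin: "finite (up_to S k)" for k
    by (rule finite_subset[OF _ finite_words_le[of b k]]) (use S in \<open>auto simp: up_to_def\<close>)
  then have finl: "finite lev" by (simp add: lev_def)
  define \<psi>' where "\<psi>' \<omega> = \<psi> \<omega> * (\<Prod>\<tau>\<in>up_to S m. indicator (A \<tau>) (\<omega> (h \<tau>)))" for \<omega>
  have \<psi>': "\<psi>' \<in> borel_measurable (level_algebra b m)"
    unfolding \<psi>'_def
  proof (intro borel_measurable_times_ennreal \<psi> borel_measurable_prod_ennreal)
    fix \<tau> assume \<tau>: "\<tau> \<in> up_to S m"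
    then have "(\<lambda>\<omega>. \<omega> (h \<tau>)) \<in> level_algebra b m \<rightarrow>\<^sub>M nonneg_borel"
      using h by (intro level_measurable_coord) (auto simp: up_to_def)
    moreover have "indicator (A \<tau>) \<in> borel_measurable nonneg_borel"
      using A \<tau> by (intro borel_measurable_indicator) (auto simp: up_to_def)
    ultimately show "(\<lambda>\<omega>. indicator (A \<tau>) (\<omega> (h \<tau>)) :: ennreal) \<in> borel_measurable (level_algebra b m)"
      by (rule measurable_compose)
  qed
  have injl: "inj_on h lev" using h(2) by (rule inj_on_subset) (auto simp: lev)
  define B where "B \<sigma> = A (inv_into lev h \<sigma>)" for \<sigma>
  have B: "B (h \<tau>) = A \<tau>" if "\<tau> \<in> lev" for \<tau>
    using that injl by (simp add: B_def)
  have "(\<integral>\<^sup>+\<omega>. \<psi> \<omega> * indicator (Pi\<^sub>E (up_to S (Suc m)) A) (pull h (up_to S (Suc m)) \<omega>) \<partial>P) =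
      (\<integral>\<^sup>+\<omega>. \<psi>' \<omega> * (\<Prod>\<sigma>\<in>h ` lev. indicator (B \<sigma>) (\<omega> \<sigma>)) \<partial>P)"
  proof (intro nn_integral_cong)
    fix \<omega>
    have "indicator (Pi\<^sub>E (up_to S (Suc m)) A) (pull h (up_to S (Suc m)) \<omega>) =
        (\<Prod>\<tau>\<in>up_to S (Suc m). indicator (A \<tau>) (\<omega> (h \<tau>)) :: ennreal)"
      using fin by (auto simp: pull_def indicator_def PiE_iff Pi_iff prod_zero_iff intro!: prod.neutral[symmetric])
    also have "\<dots> = (\<Prod>\<tau>\<in>up_to S m \<union> lev. indicator (A \<tau>) (\<omega> (h \<tau>)))"
      by (intro prod.cong refl) (auto simp: lev_def up_to_def)
    also have "(\<Prod>\<tau>\<in>up_to S m \<union> lev. indicator (A \<tau>) (\<omega> (h \<tau>)) :: ennreal) =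
        (\<Prod>\<tau>\<in>up_to S m. indicator (A \<tau>) (\<omega> (h \<tau>))) * (\<Prod>\<tau>\<in>lev. indicator (A \<tau>) (\<omega> (h \<tau>)))"
      using fin finl by (intro prod.union_disjoint) (auto simp: lev_def)
    also have "(\<Prod>\<tau>\<in>lev. indicator (A \<tau>) (\<omega> (h \<tau>)) :: ennreal) = (\<Prod>\<sigma>\<in>h ` lev. indicator (B \<sigma>) (\<omega> \<sigma>))"
      by (subst prod.reindex[OF injl]) (simp add: B)
    finally show "\<psi> \<omega> * indicator (Pi\<^sub>E (up_to S (Suc m)) A) (pull h (up_to S (Suc m)) \<omega>) =
        \<psi>' \<omega> * (\<Prod>\<sigma>\<in>h ` lev. indicator (B \<sigma>) (\<omega> \<sigma>))"
      by (simp add: \<psi>'_def mult.assoc)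
  qed
  also have "\<dots> = (\<integral>\<^sup>+\<omega>. \<psi>' \<omega> * (\<Prod>\<sigma>\<in>h ` lev. emeasure (q (Suc m) (past \<sigma> \<omega>)) (B \<sigma>)) \<partial>P)"
    using finl h A \<psi>' by (intro nn_integral_next_level) (auto simp: lev B)
  also have "\<dots> = (\<integral>\<^sup>+\<omega>. \<psi> \<omega> * (\<lambda>x. (\<Prod>\<tau>\<in>up_to S m. indicator (A \<tau>) (x \<tau>)) *
       (\<Prod>\<tau>\<in>lev. emeasure (q (Suc m) (past \<tau> x)) (A \<tau>))) (pull h (up_to S m) \<omega>) \<partial>P)"
  proof (intro nn_integral_cong)
    fix \<omega>
    have "past (h \<tau>) \<omega> = past \<tau> (pull h (up_to S m) \<omega>)" if "\<tau> \<in> lev" for \<tau>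
    proof (rule ext)
      fix j
      show "past (h \<tau>) \<omega> j = past \<tau> (pull h (up_to S m) \<omega>) j"
        using that S(2)[of \<tau> j] h by (simp add: lev pull_def up_to_def)
    qed
    then have "(\<Prod>\<sigma>\<in>h ` lev. emeasure (q (Suc m) (past \<sigma> \<omega>)) (B \<sigma>)) =
        (\<Prod>\<tau>\<in>lev. emeasure (q (Suc m) (past \<tau> (pull h (up_to S m) \<omega>))) (A \<tau>))"
      by (subst prod.reindex[OF injl]) (simp add: B)
    then show "\<psi>' \<omega> * (\<Prod>\<sigma>\<in>h ` lev. emeasure (q (Suc m) (past \<sigma> \<omega>)) (B \<sigma>)) =
      \<psi> \<omega> * (\<lambda>x. (\<Prod>\<tau>\<in>up_to S m. indicator (A \<tau>) (x \<tau>)) *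
       (\<Prod>\<tau>\<in>lev. emeasure (q (Suc m) (past \<tau> x)) (A \<tau>))) (pull h (up_to S m) \<omega>)"
      by (simp add: \<psi>'_def mult.assoc pull_def)
  qed
  finally show ?thesis by (simp only: lev_def)
qed

text \<open>
  Consequently S and an embedded copy of S, weighted by functions of the first n levels, have the same
  law as soon as they have the same law up to level n. There are two applications: different
  weightings of one subtree below a word of length n, and one weighting of the tree and of its image
  under a permutation of the letters at position n.
\<close>

lemma nn_integral_pull_eq:
  assumes S: "S \<subseteq> tree_words b" "\<And>\<tau> j. \<tau> \<in> S \<Longrightarrow> take j \<tau> \<in> S"
    and h: "\<And>\<tau>. \<tau> \<in> S \<Longrightarrow> h \<tau> \<in> tree_words b" "inj_on h S" "\<And>\<tau>. length (h \<tau>) = length \<tau>"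
      "\<And>k \<tau>. take k (h \<tau>) = h (take k \<tau>)"
    and \<phi>: "\<phi> \<in> borel_measurable (level_algebra b n)" "\<phi>' \<in> borel_measurable (level_algebra b n)"
      "(\<integral>\<^sup>+\<omega>. \<phi> \<omega> \<partial>P) < \<infinity>"
    and base: "\<And>f. f \<in> borel_measurable (\<Pi>\<^sub>M \<tau>\<in>up_to S n. nonneg_borel) \<Longrightarrow>
      (\<integral>\<^sup>+\<omega>. \<phi> \<omega> * f (pull h (up_to S n) \<omega>) \<partial>P) = (\<integral>\<^sup>+\<omega>. \<phi>' \<omega> * f (pull id (up_to S n) \<omega>) \<partial>P)"
    and f: "f \<in> borel_measurable (\<Pi>\<^sub>M \<tau>\<in>S. nonneg_borel)"
  shows "(\<integral>\<^sup>+\<omega>. \<phi> \<omega> * f (pull h S \<omega>) \<partial>P) = (\<integral>\<^sup>+\<omega>. \<phi>' \<omega> * f (pull id S \<omega>) \<partial>P)"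
proof -
  have \<phi>P: "\<phi> \<in> borel_measurable P" "\<phi>' \<in> borel_measurable P"
    using \<phi> by (auto intro: measurable_F_M)
  have hW: "(\<lambda>\<omega>. \<omega> (h \<tau>)) \<in> P \<rightarrow>\<^sub>M nonneg_borel" if "\<tau> \<in> S" for \<tau>
    using h(1)[OF that] by (rule measurable_W)
  have idW: "(\<lambda>\<omega>. \<omega> (id \<tau>)) \<in> P \<rightarrow>\<^sub>M nonneg_borel" if "\<tau> \<in> S" for \<tau>
    using that S(1) measurable_W[of \<tau>] by auto
  have pull: "pull h U \<in> P \<rightarrow>\<^sub>M (\<Pi>\<^sub>M \<tau>\<in>U. nonneg_borel)" "pull id U \<in> P \<rightarrow>\<^sub>M (\<Pi>\<^sub>M \<tau>\<in>U. nonneg_borel)"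
    if "U \<subseteq> S" for U
    using that hW idW by (intro measurable_pull; blast)+
  have up: "up_to S m \<subseteq> S" for m by (auto simp: up_to_def)
  have fin: "finite (up_to S k)" for k
    by (rule finite_subset[OF _ finite_words_le[of b k]]) (use S in \<open>auto simp: up_to_def\<close>)
  have level: "(\<integral>\<^sup>+\<omega>. \<phi> \<omega> * f (pull h (up_to S m) \<omega>) \<partial>P) = (\<integral>\<^sup>+\<omega>. \<phi>' \<omega> * f (pull id (up_to S m) \<omega>) \<partial>P)"
    if "n \<le> m" "f \<in> borel_measurable (\<Pi>\<^sub>M \<tau>\<in>up_to S m. nonneg_borel)" for m f
    using that
  proof (induct m arbitrary: f rule: dec_induct)
    case base
    then show ?case by (rule assms(10))
  next
    case (step m)
    let ?N = "\<Pi>\<^sub>M \<tau>\<in>up_to S (Suc m). nonneg_borel"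
    let ?d = "distr (density P \<phi>) ?N (pull h (up_to S (Suc m)))"
    let ?d' = "distr (density P \<phi>') ?N (pull id (up_to S (Suc m)))"
    have \<phi>m: "\<phi> \<in> borel_measurable (level_algebra b m)" "\<phi>' \<in> borel_measurable (level_algebra b m)"
      using \<phi> step(1) by (auto intro: measurable_F_mono)
    have "?d = ?d'"
    proof (rule measure_eqI_PiM_finite[OF fin])
      fix A :: "nat list \<Rightarrow> real set"
      assume A0: "\<And>i. i \<in> up_to S (Suc m) \<Longrightarrow> A i \<in> sets nonneg_borel"
      \<comment> \<open>Total extension of the family A, so that measurability holds without side conditions.\<close>
      define A' where "A' \<tau> = (if \<tau> \<in> up_to S (Suc m) then A \<tau> else {0..})" for \<tau>
      have A': "A' \<tau> \<in> sets nonneg_borel" for \<tau>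
        using A0 sets.top[of nonneg_borel] by (auto simp: A'_def space_restrict_space)
      have PiE_eq: "Pi\<^sub>E (up_to S (Suc m)) A = Pi\<^sub>E (up_to S (Suc m)) A'"
        by (rule PiE_cong) (simp add: A'_def)
      have X: "Pi\<^sub>E (up_to S (Suc m)) A' \<in> sets ?N"
        using fin A' by (intro sets_PiM_I_finite) auto
      define K where "K x = (\<Prod>\<tau>\<in>up_to S m. indicator (A' \<tau>) (x \<tau>)) *
         (\<Prod>\<tau>\<in>up_to S (Suc m) - up_to S m. emeasure (q (Suc m) (past \<tau> x)) (A' \<tau>))" for x :: "nat list \<Rightarrow> real"
      have coord: "(\<lambda>x. x \<tau>) \<in> (\<Pi>\<^sub>M \<tau>\<in>up_to S m. nonneg_borel) \<rightarrow>\<^sub>M nonneg_borel" if "\<tau> \<in> up_to S m" for \<tau>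
        using that by (rule measurable_component_singleton)
      have K: "K \<in> borel_measurable (\<Pi>\<^sub>M \<tau>\<in>up_to S m. nonneg_borel)"
        unfolding K_def
      proof (intro borel_measurable_times_ennreal borel_measurable_prod_ennreal)
        fix \<tau> assume \<tau>: "\<tau> \<in> up_to S m"
        show "(\<lambda>x. indicator (A' \<tau>) (x \<tau>) :: ennreal) \<in> borel_measurable (\<Pi>\<^sub>M \<tau>\<in>up_to S m. nonneg_borel)"
          by (rule measurable_compose[OF coord[OF \<tau>] borel_measurable_indicator[OF A']])
      next
        fix \<tau> assume \<tau>: "\<tau> \<in> up_to S (Suc m) - up_to S m"
        then have len: "length \<tau> = Suc m" by (auto simp: up_to_def)
        have "(\<lambda>x. emeasure (q (length \<tau>) (past \<tau> x)) (A' \<tau>)) \<in> borel_measurable (\<Pi>\<^sub>M \<tau>\<in>up_to S m. nonneg_borel)"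
          using \<tau> len S(2) A' by (intro measurable_kernel_past coord) (auto simp: up_to_def)
        then show "(\<lambda>x. emeasure (q (Suc m) (past \<tau> x)) (A' \<tau>)) \<in> borel_measurable (\<Pi>\<^sub>M \<tau>\<in>up_to S m. nonneg_borel)"
          by (simp only: len)
      qed
      have "emeasure ?d (Pi\<^sub>E (up_to S (Suc m)) A') = (\<integral>\<^sup>+\<omega>. \<phi> \<omega> * K (pull h (up_to S m) \<omega>) \<partial>P)"
        unfolding emeasure_distr_density[OF pull(1)[OF up] \<phi>P(1) X] K_def
        by (rule nn_integral_pull_next_level[OF S h A' \<phi>m(1)])
      also have "\<dots> = (\<integral>\<^sup>+\<omega>. \<phi>' \<omega> * K (pull id (up_to S m) \<omega>) \<partial>P)"
        by (rule step(3)[OF K])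
      also have "\<dots> = emeasure ?d' (Pi\<^sub>E (up_to S (Suc m)) A')"
        unfolding emeasure_distr_density[OF pull(2)[OF up] \<phi>P(2) X] K_def
        by (rule nn_integral_pull_next_level[OF S _ _ _ _ A' \<phi>m(2), symmetric]) (use S in auto)
      finally show "emeasure ?d (Pi\<^sub>E (up_to S (Suc m)) A) = emeasure ?d' (Pi\<^sub>E (up_to S (Suc m)) A)"
        unfolding PiE_eq .
    next
      show "range (\<lambda>_::nat. space ?N) \<subseteq> prod_algebra (up_to S (Suc m)) (\<lambda>_. nonneg_borel)"
      proof (rule subsetI)
        fix X assume "X \<in> range (\<lambda>_::nat. space ?N)"
        then have "X = (\<Pi>\<^sub>E i\<in>up_to S (Suc m). space nonneg_borel)" by (simp add: space_PiM)
        then show "X \<in> prod_algebra (up_to S (Suc m)) (\<lambda>_. nonneg_borel)"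
          by (simp only:) (rule prod_algebraI_finite[OF fin], rule ballI, rule sets.top)
      qed
      have "emeasure ?d (space ?N) \<le> (\<integral>\<^sup>+\<omega>. \<phi> \<omega> \<partial>P)"
        unfolding emeasure_distr_density[OF pull(1)[OF up] \<phi>P(1) sets.top]
        by (intro nn_integral_mono) (auto split: split_indicator)
      then show "emeasure ?d (space ?N) \<noteq> \<infinity>" using \<phi>(3) by auto
    qed auto
    then show ?case
      unfolding nn_integral_distr_density[OF pull(1)[OF up] \<phi>P(1) step(4), symmetric]
        nn_integral_distr_density[OF pull(2)[OF up] \<phi>P(2) step(4), symmetric] by (simp only:)
  qed
  let ?N = "\<Pi>\<^sub>M \<tau>\<in>S. nonneg_borel"
  let ?d = "distr (density P \<phi>) ?N (pull h S)"
  let ?d' = "distr (density P \<phi>') ?N (pull id S)"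
  have "?d = ?d'"
  proof (rule measure_eqI_PiM_infinite)
    fix A J assume J: "finite J" "J \<subseteq> S" "\<And>i. i \<in> J \<Longrightarrow> A i \<in> sets nonneg_borel"
    define m where "m = Max (insert n (length ` J))"
    have m: "n \<le> m" "J \<subseteq> up_to S m"
      using J by (auto simp: m_def up_to_def)
    let ?E = "prod_emb S (\<lambda>_. nonneg_borel) J (Pi\<^sub>E J A)" and ?E' = "prod_emb (up_to S m) (\<lambda>_. nonneg_borel) J (Pi\<^sub>E J A)"
    have E: "?E \<in> sets ?N" using J by (intro sets_PiM_I) auto
    have E': "?E' \<in> sets (\<Pi>\<^sub>M \<tau>\<in>up_to S m. nonneg_borel)" using J m by (intro sets_PiM_I) auto
    have ind: "indicator ?E (pull k S \<omega>) = (indicator ?E' (pull k (up_to S m) \<omega>) :: ennreal)"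
      if "\<omega> \<in> space P" "\<And>\<tau>. \<tau> \<in> S \<Longrightarrow> k \<tau> \<in> tree_words b" for k \<omega>
    proof -
      have "0 \<le> \<omega> (k \<tau>)" if "\<tau> \<in> S" for \<tau> using that \<open>\<And>\<tau>. \<tau> \<in> S \<Longrightarrow> k \<tau> \<in> tree_words b\<close> \<open>\<omega> \<in> space P\<close>
        by (intro W_nonneg) auto
      then have "pull k S \<omega> \<in> ?E \<longleftrightarrow> (\<forall>\<tau>\<in>J. \<omega> (k \<tau>) \<in> A \<tau>)"
        "pull k (up_to S m) \<omega> \<in> ?E' \<longleftrightarrow> (\<forall>\<tau>\<in>J. \<omega> (k \<tau>) \<in> A \<tau>)"
        using J(2) m(2) up[of m]
        by (auto simp: prod_emb_iff pull_def PiE_iff space_restrict_space Pi_iff subset_iff extensional_restrict)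
      then show ?thesis by (simp add: indicator_def)
    qed
    have "emeasure ?d ?E = (\<integral>\<^sup>+\<omega>. \<phi> \<omega> * indicator ?E' (pull h (up_to S m) \<omega>) \<partial>P)"
      unfolding emeasure_distr_density[OF pull(1)[OF order_refl] \<phi>P(1) E]
      using h(1) by (intro nn_integral_cong) (simp add: ind)
    also have "\<dots> = (\<integral>\<^sup>+\<omega>. \<phi>' \<omega> * indicator ?E' (pull id (up_to S m) \<omega>) \<partial>P)"
      using E' by (intro level m) simp
    also have "\<dots> = emeasure ?d' ?E"
      unfolding emeasure_distr_density[OF pull(2)[OF order_refl] \<phi>P(2) E]
      using S(1) by (intro nn_integral_cong) (simp add: ind subset_iff)
    finally show "emeasure ?d ?E = emeasure ?d' ?E" .
  next
    show "finite_measure ?d"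
    proof (rule finite_measureI)
      have "emeasure ?d (space ?N) \<le> (\<integral>\<^sup>+\<omega>. \<phi> \<omega> \<partial>P)"
        unfolding emeasure_distr_density[OF pull(1)[OF order_refl] \<phi>P(1) sets.top]
        by (intro nn_integral_mono) (auto split: split_indicator)
      then show "emeasure ?d (space ?d) \<noteq> \<infinity>" using \<phi>(3) by auto
    qed
  qed auto
  then show ?thesis
    unfolding nn_integral_distr_density[OF pull(1)[OF order_refl] \<phi>P(1) f, symmetric]
      nn_integral_distr_density[OF pull(2)[OF order_refl] \<phi>P(2) f, symmetric] by (simp only:)
qed

end

section \<open>Masses of cylinders under the cascade\<close>

text \<open>
  The mass \<open>\<lambda>\<^sub>n(\<Delta>\<^sub>\<gamma>)\<close> of a cylinder at its own level \<open>n = |\<gamma>|\<close>.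
\<close>

definition word_weight :: "nat \<Rightarrow> nat list \<Rightarrow> (nat list \<Rightarrow> real) \<Rightarrow> real" where
  "word_weight b \<gamma> \<omega> = (\<Prod>j\<le>length \<gamma>. \<omega> (take j \<gamma>)) / real b ^ length \<gamma>"

text \<open>
  The mass \<open>\<lambda>\<^sub>m(\<Delta>\<^sub>\<gamma>)\<close>, provided that m is at least the length of \<open>\<gamma>\<close>.
\<close>

definition level_mass :: "nat \<Rightarrow> nat \<Rightarrow> nat list \<Rightarrow> (nat list \<Rightarrow> real) \<Rightarrow> real" where
  "level_mass b m \<gamma> \<omega> = (\<Sum>\<tau>\<in>descendants b \<gamma> m. word_weight b \<tau> \<omega>)"

text \<open>
  A version of \<open>\<lambda>\<^sub>\<infinity>(\<Delta>\<^sub>\<gamma>)\<close> that is defined everywhere and measurable in the weights near \<open>\<gamma>\<close>.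
\<close>

definition limit_mass :: "nat \<Rightarrow> nat list \<Rightarrow> (nat list \<Rightarrow> real) \<Rightarrow> ennreal" where
  "limit_mass b \<gamma> \<omega> = liminf (\<lambda>m. ennreal (level_mass b m \<gamma> \<omega>))"

text \<open>
  The words comparable with \<open>\<gamma>\<close> in the prefix order: the path to \<open>\<gamma>\<close> and the subtree below \<open>\<gamma>\<close>.
\<close>

definition line_of :: "nat \<Rightarrow> nat list \<Rightarrow> nat list set" where
  "line_of b \<gamma> = {\<tau> \<in> tree_words b. take (length \<gamma>) \<tau> = take (length \<tau>) \<gamma>}"

lemma word_weight_snoc:
  "word_weight b (\<gamma> @ [i]) \<omega> = word_weight b \<gamma> \<omega> * \<omega> (\<gamma> @ [i]) / real b"
proof -
  have "(\<Prod>j\<le>length \<gamma>. \<omega> (take j (\<gamma> @ [i]))) = (\<Prod>j\<le>length \<gamma>. \<omega> (take j \<gamma>))"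
    by (intro prod.cong) auto
  then show ?thesis by (simp add: word_weight_def)
qed

lemma borel_measurable_word_weight:
  assumes "\<And>j. (\<lambda>\<omega>. \<omega> (take j \<gamma>)) \<in> borel_measurable K"
  shows "word_weight b \<gamma> \<in> borel_measurable K"
  unfolding word_weight_def using assms by (intro borel_measurable_divide borel_measurable_prod) auto

lemma borel_measurable_word_weight_coord:
  assumes "\<gamma> \<in> tree_words b" "\<And>j. j \<le> length \<gamma> \<Longrightarrow> take j \<gamma> \<in> I"
  shows "word_weight b \<gamma> \<in> borel_measurable (coord_algebra b I)"
proof (rule borel_measurable_word_weight)
  fix j
  have "take j \<gamma> = take (min j (length \<gamma>)) \<gamma>" by (simp add: min_def)
  with assms(2)[of "min j (length \<gamma>)"] have "take j \<gamma> \<in> I" by simp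
  then show "(\<lambda>\<omega>. \<omega> (take j \<gamma>)) \<in> borel_measurable (coord_algebra b I)"
    using assms(1) by (intro borel_measurable_coord_algebra take_in_tree_words)
qed

lemma take_in_line_of: "\<tau> \<in> line_of b \<gamma> \<Longrightarrow> take j \<tau> \<in> line_of b \<gamma>"
  unfolding line_of_def
  by (auto simp: take_in_tree_words min_def dest: arg_cong[of _ _ "take j"])

lemma descendants_in_line_of:
  assumes "take (length \<gamma>) \<tau> = \<gamma>" "\<sigma> \<in> descendants b \<tau> m"
  shows "\<sigma> \<in> line_of b \<gamma>"
proof -
  have "length \<gamma> \<le> length \<tau>" using assms(1) by (metis length_take min.cobounded1)
  then have "take (length \<gamma>) \<sigma> = \<gamma>"
    using assms by (auto simp: descendants_def min_def dest: arg_cong[of _ _ "take (length \<gamma>)"])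
  moreover from this have "length \<gamma> \<le> length \<sigma>" by (metis length_take min.cobounded1)
  ultimately show ?thesis using assms(2) by (auto simp: line_of_def descendants_def)
qed

lemma borel_measurable_limit_mass:
  assumes "take (length \<gamma>) \<tau> = \<gamma>"
  shows "limit_mass b \<tau> \<in> borel_measurable (coord_algebra b (line_of b \<gamma>))"
  unfolding limit_mass_def level_mass_def
  by (intro borel_measurable_liminf measurable_compose[OF _ measurable_ennreal] borel_measurable_sum
      borel_measurable_word_weight_coord take_in_line_of[OF descendants_in_line_of[OF assms]])
    (auto simp: descendants_def)

lemma cascade_eq_word_weight:
  assumes "b > 0"
  shows "cascade n t \<omega> = real b ^ n * word_weight b (pre t n) \<omega>"
  using assms by (simp add: cascade_def word_weight_def min_def)

context cascade_model
begin

lemma word_weight_nonneg: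
  assumes "\<gamma> \<in> tree_words b" "\<omega> \<in> space P"
  shows "0 \<le> word_weight b \<gamma> \<omega>"
proof -
  have "0 \<le> \<omega> (take j \<gamma>)" for j
    using assms by (intro W_nonneg take_in_tree_words)
  then show ?thesis
    unfolding word_weight_def by (simp add: prod_nonneg)
qed

lemma level_measurable_word_weight:
  "\<gamma> \<in> tree_words b \<Longrightarrow> length \<gamma> \<le> n \<Longrightarrow> word_weight b \<gamma> \<in> borel_measurable (level_algebra b n)"
  unfolding level_algebra_def
  by (rule borel_measurable_word_weight_coord) (auto simp: take_in_tree_words)

lemma path_measurable_word_weight:
  "\<gamma> \<in> tree_words b \<Longrightarrow> word_weight b \<gamma> \<in> borel_measurable (path_algebra b \<gamma>)"
  unfolding path_algebra_def by (rule borel_measurable_word_weight_coord) auto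

lemma measurable_word_weight: "\<gamma> \<in> tree_words b \<Longrightarrow> word_weight b \<gamma> \<in> borel_measurable P"
  by (rule measurable_F_M[OF level_measurable_word_weight]) auto

lemma measurable_limit_mass: "limit_mass b \<tau> \<in> borel_measurable P"
  by (rule measurable_from_subalg[OF subalgebra_coord borel_measurable_limit_mass[of "[]"]])
     (auto simp: line_of_def)

text \<open>The weights of a new level have conditional mean one, because all kernels have mean one.\<close>

lemma nn_integral_next_weight:
  assumes \<tau>: "\<tau> \<in> tree_words b" "length \<tau> = Suc n" and \<psi>: "\<psi> \<in> borel_measurable (level_algebra b n)"
  shows "(\<integral>\<^sup>+\<omega>. \<psi> \<omega> * ennreal (\<omega> \<tau>) \<partial>P) = (\<integral>\<^sup>+\<omega>. \<psi> \<omega> \<partial>P)"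
proof -
  have \<psi>P [measurable]: "\<psi> \<in> borel_measurable P" by (rule measurable_F_M[OF \<psi>])
  have [measurable]: "(\<lambda>\<omega>. \<omega> \<tau>) \<in> P \<rightarrow>\<^sub>M nonneg_borel" by (rule measurable_W[OF \<tau>(1)])
  have id [measurable]: "(\<lambda>y. ennreal y) \<in> borel_measurable nonneg_borel"
    by (rule measurable_restrict_space1) simp
  define \<kappa> where "\<kappa> \<omega> = q (Suc n) (past \<tau> \<omega>)" for \<omega>
  have past: "past \<tau> \<in> P \<rightarrow>\<^sub>M (\<Pi>\<^sub>M i\<in>{..<Suc n}. nonneg_borel)"
    using measurable_past[of \<tau> P] measurable_W \<tau> by (simp add: take_in_tree_words)
  have "\<kappa> \<in> P \<rightarrow>\<^sub>M prob_algebra nonneg_borel"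
    unfolding \<kappa>_def by (rule measurable_compose[OF past q_kernel]) simp
  then have "\<kappa> \<in> P \<rightarrow>\<^sub>M subprob_algebra nonneg_borel" by (rule measurable_prob_algebraD)
  then have \<kappa>: "\<kappa> \<in> density P \<psi> \<rightarrow>\<^sub>M subprob_algebra nonneg_borel" by simp
  have mean: "(\<integral>\<^sup>+y. ennreal y \<partial>\<kappa> \<omega>) = 1" if "\<omega> \<in> space P" for \<omega>
    using generator measurable_space[OF past that] unfolding cascade_generator_def \<kappa>_def by simp
  have "distr (density P \<psi>) nonneg_borel (\<lambda>\<omega>. \<omega> \<tau>) = density P \<psi> \<bind> \<kappa>"
  proof (rule measure_eqI)
    show "sets (distr (density P \<psi>) nonneg_borel (\<lambda>\<omega>. \<omega> \<tau>)) = sets (density P \<psi> \<bind> \<kappa>)"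
      using sets_bind[of "density P \<psi>" \<kappa> nonneg_borel] sets_kernel[OF \<kappa>] not_empty by simp
    fix A assume "A \<in> sets (distr (density P \<psi>) nonneg_borel (\<lambda>\<omega>. \<omega> \<tau>))"
    then have A: "A \<in> sets nonneg_borel" by simp
    have "emeasure (distr (density P \<psi>) nonneg_borel (\<lambda>\<omega>. \<omega> \<tau>)) A = (\<integral>\<^sup>+x. indicator A x \<partial>distr (density P \<psi>) nonneg_borel (\<lambda>\<omega>. \<omega> \<tau>))"
      using A by (intro nn_integral_indicator[symmetric]) simp
    also have "\<dots> = (\<integral>\<^sup>+\<omega>. \<psi> \<omega> * indicator A (\<omega> \<tau>) \<partial>P)"
      using A by (subst nn_integral_distr) (auto simp: nn_integral_density)
    also have "\<dots> = (\<integral>\<^sup>+\<omega>. \<psi> \<omega> * emeasure (\<kappa> \<omega>) A \<partial>P)"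
      using nn_integral_next_level[of "{\<tau>}" n "\<lambda>_. A", OF _ _ _ \<psi>] \<tau> A by (simp only: \<kappa>_def) simp
    also have "\<dots> = (\<integral>\<^sup>+\<omega>. emeasure (\<kappa> \<omega>) A \<partial>density P \<psi>)"
      using measurable_compose[OF \<open>\<kappa> \<in> P \<rightarrow>\<^sub>M subprob_algebra nonneg_borel\<close> measurable_emeasure_subprob_algebra[OF A]]
      by (intro nn_integral_density[symmetric]) auto
    also have "\<dots> = emeasure (density P \<psi> \<bind> \<kappa>) A"
      using not_empty by (intro emeasure_bind[OF _ \<kappa> A, symmetric]) simp
    finally show "emeasure (distr (density P \<psi>) nonneg_borel (\<lambda>\<omega>. \<omega> \<tau>)) A = emeasure (density P \<psi> \<bind> \<kappa>) A" .
  qed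
  then have "(\<integral>\<^sup>+y. ennreal y \<partial>distr (density P \<psi>) nonneg_borel (\<lambda>\<omega>. \<omega> \<tau>)) =
      (\<integral>\<^sup>+\<omega>. (\<integral>\<^sup>+y. ennreal y \<partial>\<kappa> \<omega>) \<partial>density P \<psi>)"
    using nn_integral_bind[OF id \<kappa>] by simp
  also have "\<dots> = (\<integral>\<^sup>+\<omega>. 1 \<partial>density P \<psi>)"
    by (intro nn_integral_cong mean) simp
  also have "\<dots> = (\<integral>\<^sup>+\<omega>. \<psi> \<omega> \<partial>P)"
    by (subst nn_integral_density) auto
  also have "(\<integral>\<^sup>+y. ennreal y \<partial>distr (density P \<psi>) nonneg_borel (\<lambda>\<omega>. \<omega> \<tau>)) = (\<integral>\<^sup>+\<omega>. \<psi> \<omega> * ennreal (\<omega> \<tau>) \<partial>P)"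
    by (subst nn_integral_distr) (auto simp: nn_integral_density)
  finally show ?thesis .
qed

lemma nn_integral_child_weight:
  assumes \<gamma>: "\<gamma> \<in> tree_words b" and i: "i < b" and \<psi>: "\<psi> \<in> borel_measurable (level_algebra b (length \<gamma>))"
  shows "(\<integral>\<^sup>+\<omega>. \<psi> \<omega> * ennreal (word_weight b (\<gamma> @ [i]) \<omega>) \<partial>P) =
    ennreal (1 / real b) * (\<integral>\<^sup>+\<omega>. \<psi> \<omega> * ennreal (word_weight b \<gamma> \<omega>) \<partial>P)"
proof -
  let ?\<psi> = "\<lambda>\<omega>. \<psi> \<omega> * ennreal (word_weight b \<gamma> \<omega>)"
  have \<psi>': "?\<psi> \<in> borel_measurable (level_algebra b (length \<gamma>))"
    using \<psi> level_measurable_word_weight[OF \<gamma> order_refl] by (intro borel_measurable_times_ennreal) auto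
  have snoc: "\<gamma> @ [i] \<in> tree_words b" by (rule append_in_tree_words[OF \<gamma> i])
  have "(\<integral>\<^sup>+\<omega>. \<psi> \<omega> * ennreal (word_weight b (\<gamma> @ [i]) \<omega>) \<partial>P) =
      (\<integral>\<^sup>+\<omega>. ennreal (1 / real b) * (?\<psi> \<omega> * ennreal (\<omega> (\<gamma> @ [i]))) \<partial>P)"
  proof (intro nn_integral_cong)
    fix \<omega> assume \<omega>: "\<omega> \<in> space P"
    have "ennreal (word_weight b (\<gamma> @ [i]) \<omega>) = ennreal (1 / real b * (word_weight b \<gamma> \<omega> * \<omega> (\<gamma> @ [i])))"
      by (simp add: word_weight_snoc)
    also have "\<dots> = ennreal (1 / real b) * (ennreal (word_weight b \<gamma> \<omega>) * ennreal (\<omega> (\<gamma> @ [i])))"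
      using W_nonneg[OF \<omega> snoc] word_weight_nonneg[OF \<gamma> \<omega>] by (simp only: ennreal_mult ennreal_mult' divide_nonneg_nonneg zero_le_one of_nat_0_le_iff mult_nonneg_nonneg)
    finally show "\<psi> \<omega> * ennreal (word_weight b (\<gamma> @ [i]) \<omega>) = ennreal (1 / real b) * (?\<psi> \<omega> * ennreal (\<omega> (\<gamma> @ [i])))"
      by (simp only: mult_ac)
  qed
  also have "\<dots> = ennreal (1 / real b) * (\<integral>\<^sup>+\<omega>. ?\<psi> \<omega> * ennreal (\<omega> (\<gamma> @ [i])) \<partial>P)"
    using measurable_F_M[OF \<psi>'] borel_measurable_W[OF snoc] by (intro nn_integral_cmult) auto
  also have "(\<integral>\<^sup>+\<omega>. ?\<psi> \<omega> * ennreal (\<omega> (\<gamma> @ [i])) \<partial>P) = (\<integral>\<^sup>+\<omega>. ?\<psi> \<omega> \<partial>P)"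
    using snoc by (intro nn_integral_next_weight[OF _ _ \<psi>']) auto
  finally show ?thesis .
qed

lemma nn_integral_word_weight_finite: "\<gamma> \<in> tree_words b \<Longrightarrow> (\<integral>\<^sup>+\<omega>. ennreal (word_weight b \<gamma> \<omega>) \<partial>P) < \<infinity>"
proof (induct \<gamma> rule: rev_induct)
  case Nil
  have p: "distr P nonneg_borel (\<lambda>\<omega>. \<omega> []) = p" "(\<integral>\<^sup>+x. ennreal x \<partial>p) < \<infinity>"
    using generator by (auto simp: cascade_generator_def)
  have "(\<integral>\<^sup>+x. ennreal x \<partial>distr P nonneg_borel (\<lambda>\<omega>. \<omega> [])) = (\<integral>\<^sup>+\<omega>. ennreal (\<omega> []) \<partial>P)"
    by (rule nn_integral_distr[OF measurable_W]) (auto intro: measurable_restrict_space1)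
  with p show ?case by (simp add: word_weight_def)
next
  case (snoc i \<gamma>)
  then have "\<gamma> \<in> tree_words b" "i < b" by (auto simp: tree_words_def)
  with snoc nn_integral_child_weight[of \<gamma> i "\<lambda>_. 1"] show ?case
    by (simp add: ennreal_mult_less_top)
qed

lemma nn_integral_level_mass:
  assumes \<gamma>: "\<gamma> \<in> tree_words b" and m: "length \<gamma> \<le> m" and \<psi>: "\<psi> \<in> borel_measurable (level_algebra b (length \<gamma>))"
  shows "(\<integral>\<^sup>+\<omega>. \<psi> \<omega> * ennreal (level_mass b m \<gamma> \<omega>) \<partial>P) = (\<integral>\<^sup>+\<omega>. \<psi> \<omega> * ennreal (word_weight b \<gamma> \<omega>) \<partial>P)"
proof -
  have \<psi>P: "\<psi> \<in> borel_measurable P" by (rule measurable_F_M[OF \<psi>])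
  have split: "(\<integral>\<^sup>+\<omega>. \<psi> \<omega> * ennreal (level_mass b m \<gamma> \<omega>) \<partial>P) =
      (\<Sum>\<tau>\<in>descendants b \<gamma> m. \<integral>\<^sup>+\<omega>. \<psi> \<omega> * ennreal (word_weight b \<tau> \<omega>) \<partial>P)" for m
  proof -
    have "(\<integral>\<^sup>+\<omega>. \<psi> \<omega> * ennreal (level_mass b m \<gamma> \<omega>) \<partial>P) =
        (\<integral>\<^sup>+\<omega>. (\<Sum>\<tau>\<in>descendants b \<gamma> m. \<psi> \<omega> * ennreal (word_weight b \<tau> \<omega>)) \<partial>P)"
    proof (intro nn_integral_cong)
      fix \<omega> assume \<omega>: "\<omega> \<in> space P"
      have "ennreal (level_mass b m \<gamma> \<omega>) = (\<Sum>\<tau>\<in>descendants b \<gamma> m. ennreal (word_weight b \<tau> \<omega>))"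
        unfolding level_mass_def using \<omega> by (intro sum_ennreal[symmetric] word_weight_nonneg) (auto simp: descendants_def)
      then show "\<psi> \<omega> * ennreal (level_mass b m \<gamma> \<omega>) = (\<Sum>\<tau>\<in>descendants b \<gamma> m. \<psi> \<omega> * ennreal (word_weight b \<tau> \<omega>))"
        by (simp add: sum_distrib_left)
    qed
    also have "\<dots> = (\<Sum>\<tau>\<in>descendants b \<gamma> m. \<integral>\<^sup>+\<omega>. \<psi> \<omega> * ennreal (word_weight b \<tau> \<omega>) \<partial>P)"
      using \<psi>P measurable_word_weight by (intro nn_integral_sum) (auto simp: descendants_def)
    finally show ?thesis .
  qed
  show ?thesis
    using m
  proof (induct m rule: dec_induct)
    case base
    then show ?case using \<gamma> by (simp add: level_mass_def descendants_self)
  next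
    case (step m)
    have "(\<integral>\<^sup>+\<omega>. \<psi> \<omega> * ennreal (level_mass b (Suc m) \<gamma> \<omega>) \<partial>P) =
        (\<Sum>\<tau>\<in>descendants b \<gamma> m. \<Sum>\<sigma>\<in>descendants b \<tau> (Suc m). \<integral>\<^sup>+\<omega>. \<psi> \<omega> * ennreal (word_weight b \<sigma> \<omega>) \<partial>P)"
      unfolding split using step(1) by (intro sum_descendants) auto
    also have "\<dots> = (\<Sum>\<tau>\<in>descendants b \<gamma> m. \<integral>\<^sup>+\<omega>. \<psi> \<omega> * ennreal (word_weight b \<tau> \<omega>) \<partial>P)"
    proof (intro sum.cong refl)
      fix \<tau> assume \<tau>: "\<tau> \<in> descendants b \<gamma> m"
      then have w: "\<tau> \<in> tree_words b" "length \<tau> = m" by (auto simp: descendants_def)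
      have \<psi>\<tau>: "\<psi> \<in> borel_measurable (level_algebra b (length \<tau>))"
        using \<psi> step(1) w by (auto intro: measurable_F_mono)
      have "(\<Sum>\<sigma>\<in>descendants b \<tau> (Suc m). \<integral>\<^sup>+\<omega>. \<psi> \<omega> * ennreal (word_weight b \<sigma> \<omega>) \<partial>P) =
          (\<Sum>i<b. \<integral>\<^sup>+\<omega>. \<psi> \<omega> * ennreal (word_weight b (\<tau> @ [i]) \<omega>) \<partial>P)"
        using descendants_children[OF w(1)] w(2) by (simp add: sum.reindex inj_on_def)
      also have "\<dots> = (\<Sum>i<b. ennreal (1 / real b) * (\<integral>\<^sup>+\<omega>. \<psi> \<omega> * ennreal (word_weight b \<tau> \<omega>) \<partial>P))"
        by (intro sum.cong refl nn_integral_child_weight[OF w(1) _ \<psi>\<tau>]) simp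
      also have "\<dots> = (\<integral>\<^sup>+\<omega>. \<psi> \<omega> * ennreal (word_weight b \<tau> \<omega>) \<partial>P)"
        using b by (simp add: mult.assoc[symmetric] ennreal_of_nat_eq_real_of_nat flip: ennreal_mult)
      finally show "(\<Sum>\<sigma>\<in>descendants b \<tau> (Suc m). \<integral>\<^sup>+\<omega>. \<psi> \<omega> * ennreal (word_weight b \<sigma> \<omega>) \<partial>P) =
          (\<integral>\<^sup>+\<omega>. \<psi> \<omega> * ennreal (word_weight b \<tau> \<omega>) \<partial>P)" .
    qed
    finally show ?case using step(3) by (simp add: split)
  qed
qed

text \<open>
  By Fatou's lemma. Mass may be lost in the limit, so equality cannot be expected.
\<close>

lemma nn_integral_limit_mass_le:
  assumes \<gamma>: "\<gamma> \<in> tree_words b" and \<psi>: "\<psi> \<in> borel_measurable (level_algebra b (length \<gamma>))"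
  shows "(\<integral>\<^sup>+\<omega>. \<psi> \<omega> * limit_mass b \<gamma> \<omega> \<partial>P) \<le> (\<integral>\<^sup>+\<omega>. \<psi> \<omega> * ennreal (word_weight b \<gamma> \<omega>) \<partial>P)"
proof -
  have \<psi>P: "\<psi> \<in> borel_measurable P" by (rule measurable_F_M[OF \<psi>])
  have mass: "level_mass b m \<gamma> \<in> borel_measurable P" for m
    unfolding level_mass_def by (intro borel_measurable_sum measurable_word_weight) (auto simp: descendants_def)
  have "(\<integral>\<^sup>+\<omega>. limit_mass b \<gamma> \<omega> \<partial>density P \<psi>) \<le>
      liminf (\<lambda>m. \<integral>\<^sup>+\<omega>. ennreal (level_mass b m \<gamma> \<omega>) \<partial>density P \<psi>)"
    unfolding limit_mass_def using mass by (intro nn_integral_liminf) auto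
  also have "\<dots> = liminf (\<lambda>m. \<integral>\<^sup>+\<omega>. \<psi> \<omega> * ennreal (level_mass b m \<gamma> \<omega>) \<partial>P)"
    using mass \<psi>P by (simp add: nn_integral_density)
  also have "\<dots> = liminf (\<lambda>m. \<integral>\<^sup>+\<omega>. \<psi> \<omega> * ennreal (word_weight b \<gamma> \<omega>) \<partial>P)"
    by (intro Liminf_eq) (auto simp: eventually_sequentially nn_integral_level_mass[OF \<gamma> _ \<psi>] intro!: exI[of _ "length \<gamma>"])
  also have "\<dots> = (\<integral>\<^sup>+\<omega>. \<psi> \<omega> * ennreal (word_weight b \<gamma> \<omega>) \<partial>P)"
    by (rule Liminf_const) simp
  finally show ?thesis
    using \<psi>P measurable_limit_mass by (simp add: nn_integral_density)
qed

lemma nonneg_martingaleI: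
  assumes X: "\<And>n. X n \<in> borel_measurable (level_algebra b n)" "\<And>n \<omega>. \<omega> \<in> space P \<Longrightarrow> 0 \<le> X n \<omega>"
    and fin: "(\<integral>\<^sup>+\<omega>. ennreal (X 0 \<omega>) \<partial>P) < \<infinity>"
    and step: "\<And>n C. C \<in> sets (level_algebra b n) \<Longrightarrow>
      (\<integral>\<^sup>+\<omega>. indicator C \<omega> * ennreal (X (Suc n) \<omega>) \<partial>P) = (\<integral>\<^sup>+\<omega>. indicator C \<omega> * ennreal (X n \<omega>) \<partial>P)"
  shows "martingale P (level_algebra b) X"
proof -
  have eq: "(\<integral>\<^sup>+\<omega>. indicator C \<omega> * ennreal (X n \<omega>) \<partial>P) = (\<integral>\<^sup>+\<omega>. indicator C \<omega> * ennreal (X m \<omega>) \<partial>P)"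
    if "m \<le> n" "C \<in> sets (level_algebra b m)" for m n C
    using that
  proof (induct n rule: dec_induct)
    case (step n)
    then have "C \<in> sets (level_algebra b n)" using level_algebra_mono[of m n] by auto
    from assms(4)[OF this] step show ?case by simp
  qed simp
  have finite: "(\<integral>\<^sup>+\<omega>. ennreal (X n \<omega>) \<partial>P) < \<infinity>" for n
    using eq[of 0 n "space P"] sets.top[of "level_algebra b 0"] fin
    by (simp add: space_F cong: nn_integral_cong)
  have XP: "X n \<in> borel_measurable P" for n by (rule measurable_F_M[OF X(1)])
  have "integrable P (X n)" for n
    using XP finite X(2) by (intro integrableI_nonneg AE_I2) auto
  moreover have "AE \<omega> in P. real_cond_exp P (level_algebra b m) (X n) \<omega> = X m \<omega>" if "m \<le> n" for m n
  proof -
    interpret sigma_finite_subalgebra P "level_algebra b m" by (rule sigma_finite_subalgebra_F)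
    show ?thesis
      using XP finite X eq[OF that] by (intro real_cond_exp_eqI_nn(3) AE_I2) auto
  qed
  ultimately show ?thesis using X(1) by (simp add: martingale_def)
qed

text \<open>
  A random mass on words that is split evenly in conditional mean among the b children has a
  martingale as its density with respect to the uniform measure.
\<close>

lemma martingale_of_even_split:
  assumes t: "t \<in> tree_boundary b"
    and V: "\<And>\<gamma>. \<gamma> \<in> tree_words b \<Longrightarrow> V \<gamma> \<in> borel_measurable (level_algebra b (length \<gamma>))"
      "\<And>\<gamma> \<omega>. \<gamma> \<in> tree_words b \<Longrightarrow> \<omega> \<in> space P \<Longrightarrow> 0 \<le> V \<gamma> \<omega>"
      "(\<integral>\<^sup>+\<omega>. ennreal (V [] \<omega>) \<partial>P) < \<infinity>"
    and child: "\<And>\<gamma> i C. \<gamma> \<in> tree_words b \<Longrightarrow> i < b \<Longrightarrow> C \<in> sets (level_algebra b (length \<gamma>)) \<Longrightarrow>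
      (\<integral>\<^sup>+\<omega>. indicator C \<omega> * ennreal (V (\<gamma> @ [i]) \<omega>) \<partial>P) =
      ennreal (1 / real b) * (\<integral>\<^sup>+\<omega>. indicator C \<omega> * ennreal (V \<gamma> \<omega>) \<partial>P)"
    and X: "\<And>n \<omega>. \<omega> \<in> space P \<Longrightarrow> X n \<omega> = real b ^ n * V (pre t n) \<omega>"
  shows "martingale P (level_algebra b) X"
proof (rule nonneg_martingaleI)
  note pw = pre_in_tree_words[OF t]
  have Vn: "V (pre t n) \<in> borel_measurable (level_algebra b n)" for n
    using V(1)[OF pw, of n] by simp
  then have "(\<lambda>\<omega>. real b ^ n * V (pre t n) \<omega>) \<in> borel_measurable (level_algebra b n)" for n
    by (intro borel_measurable_times) auto
  then show "X n \<in> borel_measurable (level_algebra b n)" for n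
    by (subst measurable_cong[OF X]) (auto simp: space_F)
  show "0 \<le> X n \<omega>" if "\<omega> \<in> space P" for n \<omega>
    using V(2)[OF pw that] by (simp add: X[OF that])
  show "(\<integral>\<^sup>+\<omega>. ennreal (X 0 \<omega>) \<partial>P) < \<infinity>"
    using V(3) by (simp add: X cong: nn_integral_cong)
  fix n C assume C: "C \<in> sets (level_algebra b n)"
  have nn: "(\<integral>\<^sup>+\<omega>. indicator C \<omega> * ennreal (X n \<omega>) \<partial>P) =
      ennreal (real b ^ n) * (\<integral>\<^sup>+\<omega>. indicator C \<omega> * ennreal (V (pre t n) \<omega>) \<partial>P)" for n
  proof -
    have "(\<integral>\<^sup>+\<omega>. indicator C \<omega> * ennreal (X n \<omega>) \<partial>P) =
        (\<integral>\<^sup>+\<omega>. ennreal (real b ^ n) * (indicator C \<omega> * ennreal (V (pre t n) \<omega>)) \<partial>P)"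
      using V(2)[OF pw] by (intro nn_integral_cong) (simp add: X ennreal_mult mult_ac)
    also have "\<dots> = ennreal (real b ^ n) * (\<integral>\<^sup>+\<omega>. indicator C \<omega> * ennreal (V (pre t n) \<omega>) \<partial>P)"
      using sets_F_subset[OF C] measurable_F_M[OF Vn] by (intro nn_integral_cmult) auto
    finally show ?thesis .
  qed
  have "(\<integral>\<^sup>+\<omega>. indicator C \<omega> * ennreal (V (pre t (Suc n)) \<omega>) \<partial>P) =
      ennreal (1 / real b) * (\<integral>\<^sup>+\<omega>. indicator C \<omega> * ennreal (V (pre t n) \<omega>) \<partial>P)"
    unfolding pre_Suc using C t pw by (intro child) (auto simp: tree_boundary_def)
  then show "(\<integral>\<^sup>+\<omega>. indicator C \<omega> * ennreal (X (Suc n) \<omega>) \<partial>P) = (\<integral>\<^sup>+\<omega>. indicator C \<omega> * ennreal (X n \<omega>) \<partial>P)"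
    unfolding nn using b by (simp add: mult.assoc[symmetric] flip: ennreal_mult)
qed

lemma martingale_cascade:
  assumes t: "t \<in> tree_boundary b"
  shows "martingale P (level_algebra b) (\<lambda>n. cascade n t)"
proof (rule martingale_of_even_split[OF t, where V = "word_weight b"])
  show "cascade n t \<omega> = real b ^ n * word_weight b (pre t n) \<omega>" for n \<omega>
    using b by (intro cascade_eq_word_weight) simp
  show "(\<integral>\<^sup>+\<omega>. ennreal (word_weight b [] \<omega>) \<partial>P) < \<infinity>"
    by (rule nn_integral_word_weight_finite) simp
qed (simp_all add: level_measurable_word_weight word_weight_nonneg nn_integral_child_weight)

lemma random_density_cascade:
  assumes \<omega>: "\<omega> \<in> space P"
  shows "finite_measure (random_density b cascade \<omega> n)"
    and "length \<gamma> \<le> n \<Longrightarrow> measure (random_density b cascade \<omega> n) (cyl b \<gamma>) = level_mass b n \<gamma> \<omega>"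
  unfolding random_density_def level_mass_def
  using b word_weight_nonneg[OF _ \<omega>] cascade_eq_word_weight[of b n _ \<omega>]
  by (intro locally_constant_density[where h = "\<lambda>\<tau>. word_weight b \<tau> \<omega>"]; simp)+

end

section \<open>The heavy part of the limit measure\<close>

definition heavy_limit :: "nat \<Rightarrow> real \<Rightarrow> nat list \<Rightarrow> (nat list \<Rightarrow> real) \<Rightarrow> ennreal" where
  "heavy_limit b s \<gamma> \<omega> = heavy_mass b s \<gamma> (\<lambda>\<tau>. limit_mass b \<tau> \<omega>)"

text \<open>
  Exchanges the letters i and j at position n of every word. Shorter words are fixed, since updating
  a list beyond its end does nothing, so this is an automorphism of the whole tree that fixes the
  first n levels.
\<close>

definition swap_letter :: "nat \<Rightarrow> nat \<Rightarrow> nat \<Rightarrow> nat list \<Rightarrow> nat list" where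
  "swap_letter n i j \<tau> = \<tau>[n := if \<tau> ! n = i then j else if \<tau> ! n = j then i else \<tau> ! n]"

lemma length_swap_letter [simp]: "length (swap_letter n i j \<tau>) = length \<tau>"
  by (simp add: swap_letter_def)

lemma swap_letter_short: "length \<tau> \<le> n \<Longrightarrow> swap_letter n i j \<tau> = \<tau>"
  by (simp add: swap_letter_def list_update_beyond)

lemma swap_letter_swap_letter [simp]: "swap_letter n i j (swap_letter n i j \<tau>) = \<tau>"
  by (cases "n < length \<tau>") (auto simp: swap_letter_def list_update_beyond)

lemma take_swap_letter: "take k (swap_letter n i j \<tau>) = swap_letter n i j (take k \<tau>)"
proof (cases "n < k")
  case True
  then show ?thesis
    by (cases "n < length \<tau>") (simp_all add: swap_letter_def take_update_swap)
qed (simp add: swap_letter_def list_update_beyond)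

lemma swap_letter_in_tree_words:
  assumes "i < b" "j < b" "\<tau> \<in> tree_words b"
  shows "swap_letter n i j \<tau> \<in> tree_words b"
proof (cases "n < length \<tau>")
  case True
  then have "\<tau> ! n < b" using assms(3) nth_tree_words by blast
  then show ?thesis
    using assms set_update_subset_insert[of \<tau> n] unfolding swap_letter_def tree_words_def by fastforce
qed (use assms in \<open>simp add: swap_letter_short\<close>)

lemma swap_letter_snoc: "swap_letter (length \<gamma>) i j (\<gamma> @ [i]) = \<gamma> @ [j]"
  by (simp add: swap_letter_def)

lemma inj_swap_letter: "inj_on (swap_letter n i j) A"
  by (rule inj_on_inverseI[of _ "swap_letter n i j"]) simp

lemma descendants_swap_letter:
  assumes "i < b" "j < b"
  shows "descendants b (swap_letter n i j \<gamma>) m = swap_letter n i j ` descendants b \<gamma> m"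
proof (intro equalityI subsetI)
  fix \<sigma> assume "\<sigma> \<in> descendants b (swap_letter n i j \<gamma>) m"
  then have "swap_letter n i j \<sigma> \<in> descendants b \<gamma> m"
    using assms by (auto simp: descendants_def swap_letter_in_tree_words take_swap_letter)
  then show "\<sigma> \<in> swap_letter n i j ` descendants b \<gamma> m"
    by (rule rev_image_eqI) simp
qed (use assms in \<open>auto simp: descendants_def swap_letter_in_tree_words take_swap_letter\<close>)

lemma heavy_mass_cong:
  assumes "\<And>\<tau>. \<tau> \<in> tree_words b \<Longrightarrow> \<mu> \<tau> = \<mu>' \<tau>"
  shows "heavy_mass b s \<gamma> \<mu> = heavy_mass b s \<gamma> \<mu>'"
  unfolding heavy_mass_def
proof (intro INF_cong SUP_cong sum.cong refl)
  fix N M \<tau> assume "\<tau> \<in> descendants b \<gamma> M"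
  then have "\<tau> \<in> tree_words b" by (rule descendants_words)
  then have "\<mu> \<tau> = \<mu>' \<tau>" "\<And>n. \<mu> (take n \<tau>) = \<mu>' (take n \<tau>)"
    by (auto intro: assms take_in_tree_words)
  then show "(if \<exists>n. N \<le> n \<and> n \<le> M \<and> ennreal (heavy_bound b s N n) \<le> \<mu> (take n \<tau>) then \<mu> \<tau> else 0) =
      (if \<exists>n. N \<le> n \<and> n \<le> M \<and> ennreal (heavy_bound b s N n) \<le> \<mu>' (take n \<tau>) then \<mu>' \<tau> else 0)"
    by (simp only:)
qed

lemma heavy_limit_swap_letter:
  assumes ij: "i < b" "j < b"
  shows "heavy_limit b s \<gamma> (pull (swap_letter n i j) (tree_words b) \<omega>) = heavy_limit b s (swap_letter n i j \<gamma>) \<omega>"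
proof -
  let ?g = "swap_letter n i j" and ?\<omega> = "pull (swap_letter n i j) (tree_words b) \<omega>"
  have w: "word_weight b \<tau> ?\<omega> = word_weight b (?g \<tau>) \<omega>" if "\<tau> \<in> tree_words b" for \<tau>
    using that by (simp add: word_weight_def pull_def take_in_tree_words take_swap_letter)
  have "level_mass b m (?g \<tau>) \<omega> = level_mass b m \<tau> ?\<omega>" for m \<tau>
    unfolding level_mass_def descendants_swap_letter[OF ij]
    by (subst sum.reindex[OF inj_swap_letter]) (auto simp: w descendants_words intro!: sum.cong)
  then have l: "limit_mass b (?g \<tau>) \<omega> = limit_mass b \<tau> ?\<omega>" for \<tau>
    by (simp add: limit_mass_def)
  have "heavy_limit b s (?g \<gamma>) \<omega> = heavy_mass b s \<gamma> (\<lambda>\<tau>. limit_mass b (?g \<tau>) \<omega>)"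
    unfolding heavy_limit_def
    by (rule heavy_mass_reindex) (simp_all add: inj_swap_letter take_swap_letter descendants_swap_letter[OF ij])
  then show ?thesis by (simp add: l heavy_limit_def)
qed

lemma borel_measurable_heavy_limit:
  "heavy_limit b s \<gamma> \<in> borel_measurable (coord_algebra b (line_of b \<gamma>))"
  unfolding heavy_limit_def by (intro borel_measurable_heavy_mass borel_measurable_limit_mass)

lemma line_of_words: "line_of b \<gamma> \<subseteq> tree_words b"
  by (auto simp: line_of_def)

context cascade_model
begin

lemma measurable_heavy_limit: "heavy_limit b s \<gamma> \<in> borel_measurable P"
  by (rule measurable_from_subalg[OF subalgebra_coord[OF line_of_words] borel_measurable_heavy_limit])

text \<open>
  Exchanging the subtrees below two siblings preserves the conditional law given the past, and
  maps the heavy mass below one sibling to that below the other.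
\<close>

lemma nn_integral_heavy_limit_sibling:
  assumes \<gamma>: "\<gamma> \<in> tree_words b" and ij: "i < b" "j < b" and C: "C \<in> sets (level_algebra b (length \<gamma>))"
  shows "(\<integral>\<^sup>+\<omega>. indicator C \<omega> * heavy_limit b s (\<gamma> @ [j]) \<omega> \<partial>P) =
    (\<integral>\<^sup>+\<omega>. indicator C \<omega> * heavy_limit b s (\<gamma> @ [i]) \<omega> \<partial>P)"
proof -
  let ?g = "swap_letter (length \<gamma>) i j" and ?S = "tree_words b"
  have ind: "indicator C \<in> borel_measurable (level_algebra b (length \<gamma>))" using C by simp
  have "(\<integral>\<^sup>+\<omega>. indicator C \<omega> * heavy_limit b s (\<gamma> @ [i]) (pull ?g ?S \<omega>) \<partial>P) =
      (\<integral>\<^sup>+\<omega>. indicator C \<omega> * heavy_limit b s (\<gamma> @ [i]) (pull id ?S \<omega>) \<partial>P)"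
  proof (rule nn_integral_pull_eq[OF order_refl take_in_tree_words swap_letter_in_tree_words[OF ij]
        inj_swap_letter length_swap_letter take_swap_letter ind ind])
    show "(\<integral>\<^sup>+\<omega>. indicator C \<omega> \<partial>P) < \<infinity>"
      using sets_F_subset[OF C] by (simp add: emeasure_eq_measure)
    fix f :: "(nat list \<Rightarrow> real) \<Rightarrow> ennreal"
    have "pull ?g (up_to ?S (length \<gamma>)) \<omega> = pull id (up_to ?S (length \<gamma>)) \<omega>" for \<omega>
      unfolding pull_def by (rule restrict_ext) (simp add: up_to_def swap_letter_short)
    then show "(\<integral>\<^sup>+\<omega>. indicator C \<omega> * f (pull ?g (up_to ?S (length \<gamma>)) \<omega>) \<partial>P) =
        (\<integral>\<^sup>+\<omega>. indicator C \<omega> * f (pull id (up_to ?S (length \<gamma>)) \<omega>) \<partial>P)"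
      by (simp only:)
    show "heavy_limit b s (\<gamma> @ [i]) \<in> borel_measurable (\<Pi>\<^sub>M \<tau>\<in>?S. nonneg_borel)"
      using measurable_heavy_limit by (simp cong: measurable_cong_sets add: sets_P)
  qed
  moreover have "pull id ?S \<omega> = \<omega>" if "\<omega> \<in> space P" for \<omega>
    using that unfolding pull_def by (auto simp: space_P space_PiM PiE_restrict)
  ultimately show ?thesis
    unfolding heavy_limit_swap_letter[OF ij] swap_letter_snoc by (simp cong: nn_integral_cong)
qed

text \<open>
  Given the first \<open>length \<gamma>\<close> levels, the subtree below \<open>\<gamma>\<close> only depends on the path to \<open>\<gamma>\<close>.
\<close>

lemma nn_integral_line_of:
  assumes \<gamma>: "\<gamma> \<in> tree_words b" and C: "C \<in> sets (level_algebra b (length \<gamma>))"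
    and X: "X \<in> borel_measurable (coord_algebra b (line_of b \<gamma>))"
  shows "(\<integral>\<^sup>+\<omega>. indicator C \<omega> * X \<omega> \<partial>P) = (\<integral>\<^sup>+\<omega>. indicator C \<omega> * nn_cond_exp P (path_algebra b \<gamma>) X \<omega> \<partial>P)"
proof -
  let ?S = "line_of b \<gamma>" and ?n = "length \<gamma>"
  have path_words: "{take j \<gamma> |j. j \<le> length \<gamma>} \<subseteq> tree_words b"
    using \<gamma> by (auto simp: take_in_tree_words)
  interpret path: sigma_finite_subalgebra P "path_algebra b \<gamma>"
    unfolding path_algebra_def by (rule sigma_finite_subalgebra_coord[OF path_words])
  have CM: "C \<in> sets P" by (rule sets_F_subset[OF C])
  \<comment> \<open>Conditioning the event C on the path, instead of the variable X, turns the claim into the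
    equality of two weighted laws on the line of \<open>\<gamma>\<close>, which only has to be checked on the path.\<close>
  define G where "G = nn_cond_exp P (path_algebra b \<gamma>) (indicator C)"
  have Gpath: "G \<in> borel_measurable (path_algebra b \<gamma>)" unfolding G_def by simp
  have GP [measurable]: "G \<in> borel_measurable P" unfolding G_def by simp
  have GF: "G \<in> borel_measurable (level_algebra b ?n)"
    using Gpath path_algebra_subset_level[OF \<gamma>]
    by (auto simp: measurable_def space_F path_algebra_def space_coord_algebra space_P)
  have XP [measurable]: "X \<in> borel_measurable P"
    by (rule measurable_from_subalg[OF subalgebra_coord[OF line_of_words] X])
  have [measurable]: "C \<in> sets P" by (rule CM)
  have sub: "subalgebra P (coord_algebra b ?S)" by (rule subalgebra_coord[OF line_of_words])
  have transfer: "(\<integral>\<^sup>+\<omega>. indicator C \<omega> * f (pull id ?S \<omega>) \<partial>P) = (\<integral>\<^sup>+\<omega>. G \<omega> * f (pull id ?S \<omega>) \<partial>P)"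
    if f: "f \<in> borel_measurable (\<Pi>\<^sub>M \<tau>\<in>?S. nonneg_borel)" for f
  proof (rule nn_integral_pull_eq[OF line_of_words take_in_line_of _ _ _ _ _ GF _ _ f])
    show "indicator C \<in> borel_measurable (level_algebra b ?n)" using C by simp
    show "(\<integral>\<^sup>+\<omega>. indicator C \<omega> \<partial>P) < \<infinity>"
      using CM by (simp add: emeasure_eq_measure)
    fix f :: "(nat list \<Rightarrow> real) \<Rightarrow> ennreal"
    assume f: "f \<in> borel_measurable (\<Pi>\<^sub>M \<tau>\<in>up_to ?S ?n. nonneg_borel)"
    have up: "\<tau> \<in> {take j \<gamma> |j. j \<le> length \<gamma>}" "\<tau> \<in> tree_words b" if "\<tau> \<in> up_to ?S ?n" for \<tau>
      using that by (auto simp: up_to_def line_of_def intro!: exI[of _ "length \<tau>"])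
    have "pull id (up_to ?S ?n) \<in> path_algebra b \<gamma> \<rightarrow>\<^sub>M (\<Pi>\<^sub>M \<tau>\<in>up_to ?S ?n. nonneg_borel)"
      unfolding path_algebra_def by (intro measurable_pull) (simp only: id_apply, intro measurable_coord_algebra up)
    then have "(\<lambda>\<omega>. f (pull id (up_to ?S ?n) \<omega>)) \<in> borel_measurable (path_algebra b \<gamma>)"
      using f by (rule measurable_compose)
    from path.nn_cond_exp_intg[OF this, of "indicator C"] CM
    show "(\<integral>\<^sup>+\<omega>. indicator C \<omega> * f (pull id (up_to ?S ?n) \<omega>) \<partial>P) = (\<integral>\<^sup>+\<omega>. G \<omega> * f (pull id (up_to ?S ?n) \<omega>) \<partial>P)"
      by (simp add: G_def mult.commute)
  qed (use line_of_words in auto)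
  have "restr_to_subalg (density P (indicator C)) (coord_algebra b ?S) = restr_to_subalg (density P G) (coord_algebra b ?S)"
  proof (rule measure_eqI)
    have subd: "subalgebra (density P \<phi>) (coord_algebra b ?S)" for \<phi> :: "_ \<Rightarrow> ennreal"
      using sub by (simp add: subalgebra_def)
    fix B assume "B \<in> sets (restr_to_subalg (density P (indicator C)) (coord_algebra b ?S))"
    then have B: "B \<in> sets (coord_algebra b ?S)" by (simp add: sets_restr_to_subalg[OF subd])
    then have BP: "B \<in> sets P" using sub by (auto simp: subalgebra_def)
    obtain B' where B': "B' \<in> sets (\<Pi>\<^sub>M \<tau>\<in>?S. nonneg_borel)" "B = (\<lambda>\<omega>. restrict \<omega> ?S) -` B' \<inter> space (cascade_space b)"
      using coord_algebra_restrict[OF line_of_words B] by blast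
    have eq: "(\<integral>\<^sup>+\<omega>. \<phi> \<omega> * indicator B \<omega> \<partial>P) = (\<integral>\<^sup>+\<omega>. \<phi> \<omega> * indicator B' (pull id ?S \<omega>) \<partial>P)" for \<phi> :: "_ \<Rightarrow> ennreal"
      by (intro nn_integral_cong) (simp add: B'(2) pull_def space_P indicator_def restrict_def)
    show "emeasure (restr_to_subalg (density P (indicator C)) (coord_algebra b ?S)) B =
        emeasure (restr_to_subalg (density P G) (coord_algebra b ?S)) B"
      using B BP CM transfer[of "indicator B'"] B'(1)
      by (simp add: emeasure_restr_to_subalg[OF subd] emeasure_density eq)
  qed (simp add: sets_restr_to_subalg[OF sub] sets_restr_to_subalg subalgebra_def
        coord_algebra_subset_cascade_space[OF line_of_words] space_coord_algebra space_P sets_P)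
  then have "(\<integral>\<^sup>+\<omega>. X \<omega> \<partial>density P (indicator C)) = (\<integral>\<^sup>+\<omega>. X \<omega> \<partial>density P G)"
    using nn_integral_subalgebra2[OF _ X, of "density P (indicator C)"] nn_integral_subalgebra2[OF _ X, of "density P G"] sub
    by (simp add: subalgebra_def)
  then have "(\<integral>\<^sup>+\<omega>. indicator C \<omega> * X \<omega> \<partial>P) = (\<integral>\<^sup>+\<omega>. G \<omega> * X \<omega> \<partial>P)"
    by (simp add: nn_integral_density)
  also have "\<dots> = (\<integral>\<^sup>+\<omega>. G \<omega> * nn_cond_exp P (path_algebra b \<gamma>) X \<omega> \<partial>P)"
    by (rule path.nn_cond_exp_intg[OF Gpath XP, symmetric])
  also have "\<dots> = (\<integral>\<^sup>+\<omega>. nn_cond_exp P (path_algebra b \<gamma>) X \<omega> * G \<omega> \<partial>P)"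
    by (simp add: mult.commute)
  also have "\<dots> = (\<integral>\<^sup>+\<omega>. nn_cond_exp P (path_algebra b \<gamma>) X \<omega> * indicator C \<omega> \<partial>P)"
    unfolding G_def by (rule path.nn_cond_exp_intg) auto
  finally show ?thesis by (simp add: mult.commute)
qed

end

section \<open>The weight decomposition\<close>

text \<open>
  The version of \<open>E[\<nu>\<^sub>\<gamma>([0,s]) | \<F>\<^sub>n]\<close>, \<open>n = |\<gamma>|\<close>, that yields the weights. It is measurable with respect
  to the path, and the truncation makes it lie between 0 and \<open>\<lambda>\<^sub>n(\<Delta>\<^sub>\<gamma>)\<close> everywhere, not just
  almost surely, so that the quotients lie in \<open>[0,1]\<close>.
\<close>

definition heavy_cond_mass :: "nat \<Rightarrow> (nat list \<Rightarrow> real) measure \<Rightarrow> real \<Rightarrow> nat list \<Rightarrow> (nat list \<Rightarrow> real) \<Rightarrow> real" where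
  "heavy_cond_mass b P s \<gamma> \<omega> = enn2real (min
     (nn_cond_exp P (path_algebra b \<gamma>) (heavy_limit b s \<gamma>) \<omega>) (ennreal (word_weight b \<gamma> \<omega>)))"

lemma heavy_cond_mass_nonneg: "0 \<le> heavy_cond_mass b P s \<gamma> \<omega>"
  by (simp add: heavy_cond_mass_def)

locale cascade_limit = cascade_model +
  fixes L :: "(nat list \<Rightarrow> real) \<Rightarrow> (nat \<Rightarrow> nat) measure"
  assumes limit: "T_martingale_limit b P cascade L"
begin

definition regular :: "(nat list \<Rightarrow> real) \<Rightarrow> bool" where
  "regular \<omega> \<longleftrightarrow> \<omega> \<in> space P \<and> finite_measure (L \<omega>) \<and> sets (L \<omega>) = sets (tree_borel b) \<and>
     (\<forall>\<gamma>\<in>tree_words b. limit_mass b \<gamma> \<omega> = emeasure (L \<omega>) (cyl b \<gamma>))"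

lemma AE_regular: "AE \<omega> in P. regular \<omega>"
  using limit[unfolded T_martingale_limit_def] AE_space
proof eventually_elim
  case (elim \<omega>)
  have L: "finite_measure (L \<omega>)" "sets (L \<omega>) = sets (tree_borel b)"
    using elim(1) by (auto simp: tree_weak_conv_def)
  interpret L: finite_measure "L \<omega>" by fact
  have "limit_mass b \<gamma> \<omega> = emeasure (L \<omega>) (cyl b \<gamma>)" for \<gamma>
  proof -
    have "(\<lambda>n. measure (random_density b cascade \<omega> n) (cyl b \<gamma>)) \<longlonglongrightarrow> measure (L \<omega>) (cyl b \<gamma>)"
      by (rule tree_weak_conv_cyl[OF elim(1)]) (simp add: random_density_def sets_tree_haar)
    moreover have "eventually (\<lambda>n. measure (random_density b cascade \<omega> n) (cyl b \<gamma>) = level_mass b n \<gamma> \<omega>) sequentially"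
      unfolding eventually_sequentially
      by (intro exI[of _ "length \<gamma>"] allI impI random_density_cascade(2)[OF elim(2)])
    ultimately have "(\<lambda>n. level_mass b n \<gamma> \<omega>) \<longlonglongrightarrow> measure (L \<omega>) (cyl b \<gamma>)"
      by (rule Lim_transform_eventually)
    then have "(\<lambda>n. ennreal (level_mass b n \<gamma> \<omega>)) \<longlonglongrightarrow> ennreal (measure (L \<omega>) (cyl b \<gamma>))"
      by (rule tendsto_ennrealI)
    then show ?thesis
      unfolding limit_mass_def L.emeasure_eq_measure by (intro lim_imp_Liminf) auto
  qed
  with L elim show ?case by (simp add: regular_def)
qed

lemma regular_heavy_limit:
  assumes "regular \<omega>"
  shows "heavy_limit b s \<gamma> \<omega> = emeasure (L \<omega>) (cyl b \<gamma> \<inter> heavy_points b s (L \<omega>))"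
proof -
  have "heavy_limit b s \<gamma> \<omega> = heavy_mass b s \<gamma> (\<lambda>\<tau>. emeasure (L \<omega>) (cyl b \<tau>))"
    unfolding heavy_limit_def using assms by (intro heavy_mass_cong) (simp add: regular_def)
  also have "\<dots> = emeasure (L \<omega>) (cyl b \<gamma> \<inter> heavy_points b s (L \<omega>))"
    using assms by (intro emeasure_heavy_points_eq_heavy_mass[symmetric] b) (auto simp: regular_def)
  finally show ?thesis .
qed

lemma regular_heavy_limit_le:
  assumes "regular \<omega>" "\<gamma> \<in> tree_words b"
  shows "heavy_limit b s \<gamma> \<omega> \<le> limit_mass b \<gamma> \<omega>"
proof -
  have "emeasure (L \<omega>) (cyl b \<gamma> \<inter> heavy_points b s (L \<omega>)) \<le> emeasure (L \<omega>) (cyl b \<gamma>)"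
    using assms(1) by (intro emeasure_mono) (auto simp: regular_def)
  with assms show ?thesis by (simp add: regular_heavy_limit regular_def)
qed

lemma regular_heavy_limit_finite: "regular \<omega> \<Longrightarrow> heavy_limit b s \<gamma> \<omega> < \<infinity>"
  by (simp add: regular_heavy_limit regular_def finite_measure.emeasure_eq_measure)

lemma regular_heavy_limit_sum:
  assumes "regular \<omega>" "length \<gamma> \<le> m"
  shows "heavy_limit b s \<gamma> \<omega> = (\<Sum>\<tau>\<in>descendants b \<gamma> m. heavy_limit b s \<tau> \<omega>)"
proof -
  let ?H = "heavy_points b s (L \<omega>)"
  have sets: "sets (L \<omega>) = sets (tree_borel b)" using assms(1) by (simp add: regular_def)
  have "emeasure (L \<omega>) (\<Union>\<tau>\<in>descendants b \<gamma> m. cyl b \<tau> \<inter> ?H) = (\<Sum>\<tau>\<in>descendants b \<gamma> m. emeasure (L \<omega>) (cyl b \<tau> \<inter> ?H))"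
  proof (rule emeasure_cyl_UN[OF sets])
    fix \<tau>
    have "cyl b \<tau> \<inter> ?H \<in> sets (L \<omega>)"
      unfolding sets by (intro sets.Int cyl_in_sets heavy_points_in_sets)
    then show "cyl b \<tau> \<inter> ?H \<subseteq> cyl b \<tau> \<and> cyl b \<tau> \<inter> ?H \<in> sets (L \<omega>)" by blast
  qed
  also have "(\<Union>\<tau>\<in>descendants b \<gamma> m. cyl b \<tau> \<inter> ?H) = (\<Union>\<tau>\<in>descendants b \<gamma> m. cyl b \<tau>) \<inter> ?H"
    by blast
  also have "(\<Union>\<tau>\<in>descendants b \<gamma> m. cyl b \<tau>) = cyl b \<gamma>"
    by (rule cyl_UN[OF assms(2), symmetric])
  finally show ?thesis by (simp add: regular_heavy_limit[OF assms(1)])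
qed

lemma nn_integral_heavy_limit_le:
  assumes \<gamma>: "\<gamma> \<in> tree_words b" and \<psi>: "\<psi> \<in> borel_measurable (level_algebra b (length \<gamma>))"
  shows "(\<integral>\<^sup>+\<omega>. \<psi> \<omega> * heavy_limit b s \<gamma> \<omega> \<partial>P) \<le> (\<integral>\<^sup>+\<omega>. \<psi> \<omega> * ennreal (word_weight b \<gamma> \<omega>) \<partial>P)"
proof -
  have "(\<integral>\<^sup>+\<omega>. \<psi> \<omega> * heavy_limit b s \<gamma> \<omega> \<partial>P) \<le> (\<integral>\<^sup>+\<omega>. \<psi> \<omega> * limit_mass b \<gamma> \<omega> \<partial>P)"
  proof (rule nn_integral_mono_AE)
    show "AE \<omega> in P. \<psi> \<omega> * heavy_limit b s \<gamma> \<omega> \<le> \<psi> \<omega> * limit_mass b \<gamma> \<omega>"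
      using AE_regular by eventually_elim (intro mult_left_mono regular_heavy_limit_le \<gamma>; simp)
  qed
  also have "\<dots> \<le> (\<integral>\<^sup>+\<omega>. \<psi> \<omega> * ennreal (word_weight b \<gamma> \<omega>) \<partial>P)"
    by (rule nn_integral_limit_mass_le[OF \<gamma> \<psi>])
  finally show ?thesis .
qed

lemma nn_integral_heavy_limit_finite:
  assumes \<gamma>: "\<gamma> \<in> tree_words b"
  shows "(\<integral>\<^sup>+\<omega>. heavy_limit b s \<gamma> \<omega> \<partial>P) < \<infinity>"
  using nn_integral_heavy_limit_le[OF \<gamma>, of "\<lambda>_. 1" s] nn_integral_word_weight_finite[OF \<gamma>]
  by (simp add: le_less_trans)

abbreviation Z :: "real \<Rightarrow> nat list \<Rightarrow> (nat list \<Rightarrow> real) \<Rightarrow> real" where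
  "Z \<equiv> heavy_cond_mass b P"

lemma Z_le:
  assumes "\<gamma> \<in> tree_words b" "\<omega> \<in> space P"
  shows "Z s \<gamma> \<omega> \<le> word_weight b \<gamma> \<omega>"
  unfolding heavy_cond_mass_def using word_weight_nonneg[OF assms]
  by (intro enn2real_leI) auto

lemma path_measurable_Z: "\<gamma> \<in> tree_words b \<Longrightarrow> Z s \<gamma> \<in> borel_measurable (path_algebra b \<gamma>)"
  unfolding heavy_cond_mass_def
  using measurable_compose[OF path_measurable_word_weight measurable_ennreal, of \<gamma>]
  by (intro borel_measurable_enn2real borel_measurable_min borel_measurable_nn_cond_exp) auto

lemma borel_measurable_path_level:
  assumes "\<gamma> \<in> tree_words b" "f \<in> borel_measurable (path_algebra b \<gamma>)" "length \<gamma> \<le> n"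
  shows "f \<in> borel_measurable (level_algebra b n)"
proof -
  have "f \<in> borel_measurable (level_algebra b (length \<gamma>))"
    using assms(2) path_algebra_subset_level[OF assms(1)]
    by (auto simp: measurable_def space_F path_algebra_def space_coord_algebra space_P)
  then show ?thesis by (rule measurable_F_mono[OF assms(3)])
qed

lemma level_measurable_Z: "\<gamma> \<in> tree_words b \<Longrightarrow> length \<gamma> \<le> n \<Longrightarrow> Z s \<gamma> \<in> borel_measurable (level_algebra b n)"
  using borel_measurable_path_level[OF _ path_measurable_Z] by blast

lemma AE_Z:
  assumes \<gamma>: "\<gamma> \<in> tree_words b"
  shows "AE \<omega> in P. ennreal (Z s \<gamma> \<omega>) = nn_cond_exp P (path_algebra b \<gamma>) (heavy_limit b s \<gamma>) \<omega>"
proof -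
  have path_words: "{take j \<gamma> |j. j \<le> length \<gamma>} \<subseteq> tree_words b"
    using \<gamma> by (auto simp: take_in_tree_words)
  interpret path: sigma_finite_subalgebra P "path_algebra b \<gamma>"
    unfolding path_algebra_def by (rule sigma_finite_subalgebra_coord[OF path_words])
  have "AE \<omega> in P. nn_cond_exp P (path_algebra b \<gamma>) (heavy_limit b s \<gamma>) \<omega> \<le> ennreal (word_weight b \<gamma> \<omega>)"
  proof (rule path.nn_cond_exp_le[OF measurable_heavy_limit])
    show "(\<lambda>\<omega>. ennreal (word_weight b \<gamma> \<omega>)) \<in> borel_measurable (path_algebra b \<gamma>)"
      by (rule measurable_compose[OF path_measurable_word_weight[OF \<gamma>] measurable_ennreal])
    fix A assume "A \<in> sets (path_algebra b \<gamma>)"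
    then have "A \<in> sets (level_algebra b (length \<gamma>))" using path_algebra_subset_level[OF \<gamma>] by blast
    then show "(\<integral>\<^sup>+\<omega>. indicator A \<omega> * heavy_limit b s \<gamma> \<omega> \<partial>P) \<le> (\<integral>\<^sup>+\<omega>. indicator A \<omega> * ennreal (word_weight b \<gamma> \<omega>) \<partial>P)"
      by (intro nn_integral_heavy_limit_le[OF \<gamma>]) simp
  qed (rule nn_integral_word_weight_finite[OF \<gamma>])
  then show ?thesis
  proof eventually_elim
    case (elim \<omega>)
    then have "min (nn_cond_exp P (path_algebra b \<gamma>) (heavy_limit b s \<gamma>) \<omega>) (ennreal (word_weight b \<gamma> \<omega>)) =
        nn_cond_exp P (path_algebra b \<gamma>) (heavy_limit b s \<gamma>) \<omega>" by (rule min_absorb1)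
    with elim show ?case
      unfolding heavy_cond_mass_def by (simp add: le_less_trans[of _ "ennreal (word_weight b \<gamma> \<omega>)"])
  qed
qed

text \<open>
  Conditioning on the path and conditioning on all weights of the first levels agree here.
\<close>

lemma nn_integral_Z:
  assumes \<gamma>: "\<gamma> \<in> tree_words b" and C: "C \<in> sets (level_algebra b (length \<gamma>))"
  shows "(\<integral>\<^sup>+\<omega>. indicator C \<omega> * ennreal (Z s \<gamma> \<omega>) \<partial>P) = (\<integral>\<^sup>+\<omega>. indicator C \<omega> * heavy_limit b s \<gamma> \<omega> \<partial>P)"
proof -
  have "(\<integral>\<^sup>+\<omega>. indicator C \<omega> * ennreal (Z s \<gamma> \<omega>) \<partial>P) =
      (\<integral>\<^sup>+\<omega>. indicator C \<omega> * nn_cond_exp P (path_algebra b \<gamma>) (heavy_limit b s \<gamma>) \<omega> \<partial>P)"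
    using AE_Z[OF \<gamma>, of s] by (intro nn_integral_cong_AE) (auto elim: eventually_mono)
  then show ?thesis
    using nn_integral_line_of[OF \<gamma> C borel_measurable_heavy_limit] by simp
qed

text \<open>
  The heavy mass of a cylinder is the sum of those of its children, which have equal
  conditional means.
\<close>

lemma nn_integral_Z_child:
  assumes \<gamma>: "\<gamma> \<in> tree_words b" and i: "i < b" and C: "C \<in> sets (level_algebra b (length \<gamma>))"
  shows "(\<integral>\<^sup>+\<omega>. indicator C \<omega> * ennreal (Z s (\<gamma> @ [i]) \<omega>) \<partial>P) =
    ennreal (1 / real b) * (\<integral>\<^sup>+\<omega>. indicator C \<omega> * ennreal (Z s \<gamma> \<omega>) \<partial>P)"
proof -
  have C': "C \<in> sets (level_algebra b (length (\<gamma> @ [j])))" for j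
    using C level_algebra_mono[of "length \<gamma>" "length (\<gamma> @ [j])"] by auto
  have [measurable]: "C \<in> sets P" by (rule sets_F_subset[OF C])
  have [measurable]: "heavy_limit b s \<tau> \<in> borel_measurable P" for \<tau> by (rule measurable_heavy_limit)
  have "(\<integral>\<^sup>+\<omega>. indicator C \<omega> * heavy_limit b s \<gamma> \<omega> \<partial>P) =
      (\<integral>\<^sup>+\<omega>. (\<Sum>j<b. indicator C \<omega> * heavy_limit b s (\<gamma> @ [j]) \<omega>) \<partial>P)"
  proof (rule nn_integral_cong_AE)
    show "AE \<omega> in P. indicator C \<omega> * heavy_limit b s \<gamma> \<omega> = (\<Sum>j<b. indicator C \<omega> * heavy_limit b s (\<gamma> @ [j]) \<omega>)"
      using AE_regular
    proof eventually_elim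
      case (elim \<omega>)
      have "heavy_limit b s \<gamma> \<omega> = (\<Sum>j<b. heavy_limit b s (\<gamma> @ [j]) \<omega>)"
        using regular_heavy_limit_sum[OF elim, of \<gamma> "Suc (length \<gamma>)" s]
        by (simp add: descendants_children[OF \<gamma>] sum.reindex inj_on_def)
      then show ?case by (simp add: sum_distrib_left)
    qed
  qed
  also have "\<dots> = (\<Sum>j<b. \<integral>\<^sup>+\<omega>. indicator C \<omega> * heavy_limit b s (\<gamma> @ [j]) \<omega> \<partial>P)"
    by (rule nn_integral_sum) measurable
  also have "\<dots> = (\<Sum>j<b. \<integral>\<^sup>+\<omega>. indicator C \<omega> * heavy_limit b s (\<gamma> @ [i]) \<omega> \<partial>P)"
    using i by (intro sum.cong refl nn_integral_heavy_limit_sibling \<gamma> C) auto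
  also have "\<dots> = ennreal (real b) * (\<integral>\<^sup>+\<omega>. indicator C \<omega> * ennreal (Z s (\<gamma> @ [i]) \<omega>) \<partial>P)"
    using nn_integral_Z[OF append_in_tree_words[OF \<gamma> i] C'] by (simp add: ennreal_of_nat_eq_real_of_nat)
  finally show ?thesis
    using b nn_integral_Z[OF \<gamma> C] by (simp add: mult.assoc[symmetric] flip: ennreal_mult)
qed

abbreviation weights :: "real \<Rightarrow> nat list \<Rightarrow> (nat list \<Rightarrow> real) \<Rightarrow> real" where
  "weights s \<equiv> quotient_weight b (Z s)"

lemma weights_eq:
  assumes \<gamma>: "\<gamma> \<in> tree_words b" and \<omega>: "\<omega> \<in> space P"
  shows "weights s \<gamma> \<omega> = Z s \<gamma> \<omega> / word_weight b \<gamma> \<omega>"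
  using random_density_cascade(2)[OF \<omega>, of \<gamma> "length \<gamma>"] descendants_self[OF \<gamma>]
  by (simp add: quotient_weight_def level_mass_def)

lemma weights_bounds:
  assumes "\<gamma> \<in> tree_words b" "\<omega> \<in> space P"
  shows "0 \<le> weights s \<gamma> \<omega>" "weights s \<gamma> \<omega> \<le> 1"
  using Z_le[OF assms, of s] heavy_cond_mass_nonneg[of b P s \<gamma> \<omega>] word_weight_nonneg[OF assms]
  by (auto simp: weights_eq[OF assms] divide_le_eq_1)

text \<open>
  This includes the case of division by zero, because Z vanishes together with the word weight.
\<close>

lemma word_weight_times_weights:
  assumes "\<gamma> \<in> tree_words b" "\<omega> \<in> space P"
  shows "word_weight b \<gamma> \<omega> * weights s \<gamma> \<omega> = Z s \<gamma> \<omega>"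
  using Z_le[OF assms, of s] heavy_cond_mass_nonneg[of b P s \<gamma> \<omega>]
  by (simp add: weights_eq[OF assms])

lemma path_measurable_weights:
  assumes \<gamma>: "\<gamma> \<in> tree_words b"
  shows "weights s \<gamma> \<in> borel_measurable (path_algebra b \<gamma>)"
proof -
  have "(\<lambda>\<omega>. Z s \<gamma> \<omega> / word_weight b \<gamma> \<omega>) \<in> borel_measurable (path_algebra b \<gamma>)"
    by (intro borel_measurable_divide path_measurable_Z path_measurable_word_weight \<gamma>)
  moreover have "space (path_algebra b \<gamma>) = space P"
    by (simp add: path_algebra_def space_coord_algebra space_P)
  ultimately show ?thesis
    by (subst measurable_cong[OF weights_eq[OF \<gamma>]]) auto
qed

lemma weighted_cascade_eq:
  assumes t: "t \<in> tree_boundary b" and \<omega>: "\<omega> \<in> space P"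
  shows "weighted_cascade (weights s) n t \<omega> = real b ^ n * Z s (pre t n) \<omega>"
proof -
  have "weighted_cascade (weights s) n t \<omega> = cascade n t \<omega> * weights s (pre t n) \<omega>"
    by (simp add: weighted_cascade_def cascade_def)
  also have "\<dots> = real b ^ n * (word_weight b (pre t n) \<omega> * weights s (pre t n) \<omega>)"
    using b by (simp add: cascade_eq_word_weight)
  finally show ?thesis
    using word_weight_times_weights[OF pre_in_tree_words[OF t] \<omega>] by simp
qed

lemma borel_measurable_weighted_cascade:
  "(\<lambda>t. weighted_cascade F n t \<omega>) \<in> borel_measurable (tree_borel b)"
proof -
  have "(\<lambda>t. weighted_cascade F n t \<omega>) = (\<lambda>t. (\<lambda>\<tau>. (\<Prod>j\<le>n. \<omega> (take j \<tau>)) * F \<tau> \<omega>) (pre t n))"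
    by (rule ext) (simp add: weighted_cascade_def min_def)
  then show ?thesis
    using measurable_pre[of "\<lambda>\<tau>. (\<Prod>j\<le>n. \<omega> (take j \<tau>)) * F \<tau> \<omega>" n b] by simp
qed

lemma martingale_weighted_cascade:
  assumes t: "t \<in> tree_boundary b"
  shows "martingale P (level_algebra b) (\<lambda>n. weighted_cascade (weights s) n t)"
proof (rule martingale_of_even_split[OF t, where V = "Z s"])
  have "(\<integral>\<^sup>+\<omega>. ennreal (Z s [] \<omega>) \<partial>P) \<le> (\<integral>\<^sup>+\<omega>. ennreal (word_weight b [] \<omega>) \<partial>P)"
    by (intro nn_integral_mono ennreal_leI Z_le) simp_all
  then show "(\<integral>\<^sup>+\<omega>. ennreal (Z s [] \<omega>) \<partial>P) < \<infinity>"
    using nn_integral_word_weight_finite[of "[]"] by (simp add: le_less_trans)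
qed (simp_all add: level_measurable_Z heavy_cond_mass_nonneg nn_integral_Z_child weighted_cascade_eq[OF t])

lemma martingale_diff:
  assumes X: "martingale P (level_algebra b) X" and Y: "martingale P (level_algebra b) Y"
  shows "martingale P (level_algebra b) (\<lambda>n \<omega>. X n \<omega> - Y n \<omega>)"
  unfolding martingale_def
proof (intro conjI allI impI)
  fix m n :: nat assume mn: "m \<le> n"
  interpret sigma_finite_subalgebra P "level_algebra b m" by (rule sigma_finite_subalgebra_F)
  have int: "integrable P (X n)" "integrable P (Y n)"
    using X Y by (auto simp: martingale_def)
  have "AE \<omega> in P. real_cond_exp P (level_algebra b m) (X n) \<omega> = X m \<omega>"
    "AE \<omega> in P. real_cond_exp P (level_algebra b m) (Y n) \<omega> = Y m \<omega>"
    using X Y mn by (auto simp: martingale_def)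
  with real_cond_exp_diff[OF int]
  show "AE \<omega> in P. real_cond_exp P (level_algebra b m) (\<lambda>\<omega>. X n \<omega> - Y n \<omega>) \<omega> = X m \<omega> - Y m \<omega>"
    by eventually_elim simp
qed (use X Y in \<open>auto simp: martingale_def intro: borel_measurable_diff\<close>)

theorem weight_decomposition_weights: "weight_decomposition b P (weights s)"
  unfolding weight_decomposition_def
proof (rule conjI)
  have W0: "0 \<le> \<omega> (pre t j)" if "t \<in> tree_boundary b" "\<omega> \<in> space P" for t j \<omega>
    using that by (intro W_nonneg pre_in_tree_words)
  show "weight_system b P (weights s)"
    unfolding weight_system_def positive_T_martingale_def
  proof (intro conjI ballI allI AE_I2)
    show "0 \<le> weighted_cascade (weights s) n t \<omega>" if "t \<in> tree_boundary b" "\<omega> \<in> space P" for n t \<omega>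
      unfolding weighted_cascade_def using that
      by (intro mult_nonneg_nonneg prod_nonneg ballI W0 weights_bounds pre_in_tree_words)
  qed (simp_all add: path_measurable_weights weights_bounds martingale_weighted_cascade borel_measurable_weighted_cascade)
  show "weight_system b P (\<lambda>\<gamma> \<omega>. 1 - weights s \<gamma> \<omega>)"
    unfolding weight_system_def positive_T_martingale_def
  proof (intro conjI ballI allI AE_I2)
    have diff: "weighted_cascade (\<lambda>\<gamma> \<omega>. 1 - weights s \<gamma> \<omega>) n t \<omega> = cascade n t \<omega> - weighted_cascade (weights s) n t \<omega>" for n t \<omega>
      by (simp add: weighted_cascade_def cascade_def right_diff_distrib)
    show "0 \<le> weighted_cascade (\<lambda>\<gamma> \<omega>. 1 - weights s \<gamma> \<omega>) n t \<omega>" if "t \<in> tree_boundary b" "\<omega> \<in> space P" for n t \<omega>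
    proof -
      have "0 \<le> 1 - weights s (pre t n) \<omega>"
        using weights_bounds(2)[OF pre_in_tree_words that(2), OF that(1)] by simp
      moreover have "0 \<le> (\<Prod>j\<le>n. \<omega> (pre t j))"
        by (intro prod_nonneg ballI W0 that)
      ultimately show ?thesis
        unfolding weighted_cascade_def by simp
    qed
    show "martingale P (level_algebra b) (\<lambda>n. weighted_cascade (\<lambda>\<gamma> \<omega>. 1 - weights s \<gamma> \<omega>) n t)"
      if "t \<in> tree_boundary b" for t
      using martingale_diff[OF martingale_cascade[OF that] martingale_weighted_cascade[OF that]]
      by (simp only: diff[abs_def])
    show "(\<lambda>\<omega>. 1 - weights s \<gamma> \<omega>) \<in> borel_measurable (path_algebra b \<gamma>)" if "\<gamma> \<in> tree_words b" for \<gamma>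
      by (intro borel_measurable_diff path_measurable_weights that) simp
  qed (simp_all add: weights_bounds borel_measurable_weighted_cascade)
qed

section \<open>Convergence of the weighted cascade\<close>

lemma random_density_weighted:
  assumes \<omega>: "\<omega> \<in> space P"
  shows "finite_measure (random_density b (weighted_cascade (weights s)) \<omega> n)"
    and "length \<gamma> \<le> n \<Longrightarrow> measure (random_density b (weighted_cascade (weights s)) \<omega> n) (cyl b \<gamma>) =
      (\<Sum>\<tau>\<in>descendants b \<gamma> n. Z s \<tau> \<omega>)"
  unfolding random_density_def
  using b heavy_cond_mass_nonneg weighted_cascade_eq[OF _ \<omega>]
  by (intro locally_constant_density[where h = "\<lambda>\<tau>. Z s \<tau> \<omega>"]; simp)+

lemma AE_heavy_limit_real: "AE \<omega> in P. ennreal (enn2real (heavy_limit b s \<gamma> \<omega>)) = heavy_limit b s \<gamma> \<omega>"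
  using AE_regular by eventually_elim (use regular_heavy_limit_finite in simp)

lemma AE_cond_exp_heavy_limit:
  assumes \<gamma>: "\<gamma> \<in> tree_words b" and n: "length \<gamma> \<le> n"
  shows "AE \<omega> in P. real_cond_exp P (level_algebra b n) (\<lambda>\<omega>. enn2real (heavy_limit b s \<gamma> \<omega>)) \<omega> =
    (\<Sum>\<tau>\<in>descendants b \<gamma> n. Z s \<tau> \<omega>)"
proof -
  interpret sigma_finite_subalgebra P "level_algebra b n" by (rule sigma_finite_subalgebra_F)
  have [measurable]: "heavy_limit b s \<tau> \<in> borel_measurable P" for \<tau> by (rule measurable_heavy_limit)
  show ?thesis
  proof (rule real_cond_exp_eqI_nn(3))
    have "(\<integral>\<^sup>+\<omega>. ennreal (enn2real (heavy_limit b s \<gamma> \<omega>)) \<partial>P) = (\<integral>\<^sup>+\<omega>. heavy_limit b s \<gamma> \<omega> \<partial>P)"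
      by (rule nn_integral_cong_AE[OF AE_heavy_limit_real])
    then show "(\<integral>\<^sup>+\<omega>. ennreal (enn2real (heavy_limit b s \<gamma> \<omega>)) \<partial>P) < \<infinity>"
      using nn_integral_heavy_limit_finite[OF \<gamma>, of s] by simp
    show "(\<lambda>\<omega>. \<Sum>\<tau>\<in>descendants b \<gamma> n. Z s \<tau> \<omega>) \<in> borel_measurable (level_algebra b n)"
      by (intro borel_measurable_sum level_measurable_Z) (auto simp: descendants_def)
    fix C assume C: "C \<in> sets (level_algebra b n)"
    have [measurable]: "C \<in> sets P" by (rule sets_F_subset[OF C])
    have [measurable]: "Z s \<tau> \<in> borel_measurable P" if "\<tau> \<in> descendants b \<gamma> n" for \<tau>
      using that by (intro measurable_F_M[OF level_measurable_Z]) (auto simp: descendants_def)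
    have "(\<integral>\<^sup>+\<omega>. indicator C \<omega> * ennreal (enn2real (heavy_limit b s \<gamma> \<omega>)) \<partial>P) =
        (\<integral>\<^sup>+\<omega>. (\<Sum>\<tau>\<in>descendants b \<gamma> n. indicator C \<omega> * heavy_limit b s \<tau> \<omega>) \<partial>P)"
    proof (rule nn_integral_cong_AE)
      show "AE \<omega> in P. indicator C \<omega> * ennreal (enn2real (heavy_limit b s \<gamma> \<omega>)) =
          (\<Sum>\<tau>\<in>descendants b \<gamma> n. indicator C \<omega> * heavy_limit b s \<tau> \<omega>)"
        using AE_regular AE_heavy_limit_real[of s \<gamma>]
      proof eventually_elim
        case (elim \<omega>)
        then show ?case
          unfolding elim(2) regular_heavy_limit_sum[OF elim(1) n] by (simp add: sum_distrib_left)
      qed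
    qed
    also have "\<dots> = (\<Sum>\<tau>\<in>descendants b \<gamma> n. \<integral>\<^sup>+\<omega>. indicator C \<omega> * heavy_limit b s \<tau> \<omega> \<partial>P)"
      by (rule nn_integral_sum) measurable
    also have "\<dots> = (\<Sum>\<tau>\<in>descendants b \<gamma> n. \<integral>\<^sup>+\<omega>. indicator C \<omega> * ennreal (Z s \<tau> \<omega>) \<partial>P)"
      using C by (intro sum.cong refl nn_integral_Z[symmetric]) (auto simp: descendants_def)
    also have "\<dots> = (\<integral>\<^sup>+\<omega>. (\<Sum>\<tau>\<in>descendants b \<gamma> n. indicator C \<omega> * ennreal (Z s \<tau> \<omega>)) \<partial>P)"
      by (rule nn_integral_sum[symmetric]) measurable
    also have "\<dots> = (\<integral>\<^sup>+\<omega>. indicator C \<omega> * ennreal (\<Sum>\<tau>\<in>descendants b \<gamma> n. Z s \<tau> \<omega>) \<partial>P)"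
      by (intro nn_integral_cong) (simp add: sum_distrib_left[symmetric] sum_ennreal heavy_cond_mass_nonneg)
    finally show "(\<integral>\<^sup>+\<omega>. indicator C \<omega> * ennreal (enn2real (heavy_limit b s \<gamma> \<omega>)) \<partial>P) =
        (\<integral>\<^sup>+\<omega>. indicator C \<omega> * ennreal (\<Sum>\<tau>\<in>descendants b \<gamma> n. Z s \<tau> \<omega>) \<partial>P)" .
  qed (auto intro!: AE_I2 sum_nonneg heavy_cond_mass_nonneg)
qed

lemma integrable_heavy_limit:
  assumes \<gamma>: "\<gamma> \<in> tree_words b"
  shows "integrable P (\<lambda>\<omega>. enn2real (heavy_limit b s \<gamma> \<omega>))"
proof (rule integrableI_nonneg)
  have [measurable]: "heavy_limit b s \<gamma> \<in> borel_measurable P" by (rule measurable_heavy_limit)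
  show "(\<lambda>\<omega>. enn2real (heavy_limit b s \<gamma> \<omega>)) \<in> borel_measurable P" by measurable
  have "(\<integral>\<^sup>+\<omega>. ennreal (enn2real (heavy_limit b s \<gamma> \<omega>)) \<partial>P) = (\<integral>\<^sup>+\<omega>. heavy_limit b s \<gamma> \<omega> \<partial>P)"
    by (rule nn_integral_cong_AE[OF AE_heavy_limit_real])
  then show "(\<integral>\<^sup>+\<omega>. ennreal (enn2real (heavy_limit b s \<gamma> \<omega>)) \<partial>P) < \<infinity>"
    using nn_integral_heavy_limit_finite[OF \<gamma>, of s] by simp
qed simp

definition heavy_part :: "real \<Rightarrow> (nat list \<Rightarrow> real) \<Rightarrow> (nat \<Rightarrow> nat) measure" where
  "heavy_part s \<omega> = density (L \<omega>) (indicator (heavy_points b s (L \<omega>)))"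

lemma emeasure_heavy_part:
  assumes "regular \<omega>" "B \<in> sets (tree_borel b)"
  shows "emeasure (heavy_part s \<omega>) B = emeasure (L \<omega>) (B \<inter> heavy_points b s (L \<omega>))"
proof -
  have sets: "sets (L \<omega>) = sets (tree_borel b)" using assms(1) by (simp add: regular_def)
  have H: "heavy_points b s (L \<omega>) \<in> sets (L \<omega>)" and B: "B \<in> sets (L \<omega>)"
    using assms(2) by (simp_all only: sets heavy_points_in_sets)
  have "emeasure (heavy_part s \<omega>) B = (\<integral>\<^sup>+t. indicator (heavy_points b s (L \<omega>)) t * indicator B t \<partial>L \<omega>)"
    unfolding heavy_part_def by (intro emeasure_density borel_measurable_indicator H B)
  also have "\<dots> = (\<integral>\<^sup>+t. indicator (B \<inter> heavy_points b s (L \<omega>)) t \<partial>L \<omega>)"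
    by (intro nn_integral_cong) (simp split: split_indicator)
  also have "\<dots> = emeasure (L \<omega>) (B \<inter> heavy_points b s (L \<omega>))"
    by (intro nn_integral_indicator sets.Int H B)
  finally show ?thesis .
qed

text \<open>
  The mass of a fixed cylinder under the weighted cascade at level n is the conditional expectation
  of its heavy mass given the first n levels.
\<close>

theorem T_martingale_limit_weights:
  "T_martingale_limit b P (weighted_cascade (weights s)) (heavy_part s)"
  unfolding T_martingale_limit_def
proof -
  have levy: "AE \<omega> in P. \<forall>\<gamma>\<in>tree_words b. (\<lambda>n. real_cond_exp P (level_algebra b n)
      (\<lambda>\<omega>. enn2real (heavy_limit b s \<gamma> \<omega>)) \<omega>) \<longlonglongrightarrow> enn2real (heavy_limit b s \<gamma> \<omega>)"
    by (intro AE_ball_countable[THEN iffD2] countable_tree_words ballI cond_exp_converges integrable_heavy_limit)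
  have levels: "AE \<omega> in P. \<forall>\<gamma>\<in>tree_words b. \<forall>n. length \<gamma> \<le> n \<longrightarrow>
      real_cond_exp P (level_algebra b n) (\<lambda>\<omega>. enn2real (heavy_limit b s \<gamma> \<omega>)) \<omega> = (\<Sum>\<tau>\<in>descendants b \<gamma> n. Z s \<tau> \<omega>)"
  proof (intro AE_ball_countable[THEN iffD2] countable_tree_words ballI AE_all_countable[THEN iffD2] allI)
    fix \<gamma> n assume \<gamma>: "\<gamma> \<in> tree_words b"
    show "AE \<omega> in P. length \<gamma> \<le> n \<longrightarrow> real_cond_exp P (level_algebra b n)
      (\<lambda>\<omega>. enn2real (heavy_limit b s \<gamma> \<omega>)) \<omega> = (\<Sum>\<tau>\<in>descendants b \<gamma> n. Z s \<tau> \<omega>)"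
      by (cases "length \<gamma> \<le> n") (auto dest: AE_cond_exp_heavy_limit[OF \<gamma>, of n s] elim: eventually_mono)
  qed
  show "AE \<omega> in P. tree_weak_conv b (random_density b (weighted_cascade (weights s)) \<omega>) (heavy_part s \<omega>)"
    using levy levels AE_regular
  proof eventually_elim
    case (elim \<omega>)
    have \<omega>: "\<omega> \<in> space P" and L: "finite_measure (L \<omega>)" "sets (L \<omega>) = sets (tree_borel b)"
      using elim(3) by (auto simp: regular_def)
    interpret L: finite_measure "L \<omega>" by fact
    show ?case
    proof (rule tree_weak_convI[OF b random_density_weighted(1)[OF \<omega>]])
      show "sets (random_density b (weighted_cascade (weights s)) \<omega> n) = sets (tree_borel b)" for n
        by (simp add: random_density_def sets_tree_haar)
      show sets: "sets (heavy_part s \<omega>) = sets (tree_borel b)"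
        by (simp add: heavy_part_def L(2))
      have "emeasure (heavy_part s \<omega>) (space (heavy_part s \<omega>)) \<noteq> \<infinity>"
        using emeasure_heavy_part[OF elim(3) sets.top] sets_eq_imp_space_eq[OF sets]
        by (simp add: L.emeasure_eq_measure)
      then show "finite_measure (heavy_part s \<omega>)" by (rule finite_measureI)
      fix \<gamma> assume \<gamma>: "\<gamma> \<in> tree_words b"
      have "(\<lambda>n. real_cond_exp P (level_algebra b n)
          (\<lambda>\<omega>. enn2real (heavy_limit b s \<gamma> \<omega>)) \<omega>) \<longlonglongrightarrow> enn2real (heavy_limit b s \<gamma> \<omega>)"
        using elim(1) \<gamma> by blast
      also have "enn2real (heavy_limit b s \<gamma> \<omega>) = measure (heavy_part s \<omega>) (cyl b \<gamma>)"
        by (simp add: measure_def emeasure_heavy_part[OF elim(3)] regular_heavy_limit[OF elim(3)])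
      finally have "(\<lambda>n. real_cond_exp P (level_algebra b n)
          (\<lambda>\<omega>. enn2real (heavy_limit b s \<gamma> \<omega>)) \<omega>) \<longlonglongrightarrow> measure (heavy_part s \<omega>) (cyl b \<gamma>)" .
      moreover have "eventually (\<lambda>n. real_cond_exp P (level_algebra b n)
          (\<lambda>\<omega>. enn2real (heavy_limit b s \<gamma> \<omega>)) \<omega> = measure (random_density b (weighted_cascade (weights s)) \<omega> n) (cyl b \<gamma>)) sequentially"
        unfolding eventually_sequentially
        using elim(2) \<gamma> random_density_weighted(2)[OF \<omega>, of \<gamma> _ s] by (intro exI[of _ "length \<gamma>"]) simp
      ultimately show "(\<lambda>n. measure (random_density b (weighted_cascade (weights s)) \<omega> n) (cyl b \<gamma>)) \<longlonglongrightarrow>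
          measure (heavy_part s \<omega>) (cyl b \<gamma>)"
        by (rule Lim_transform_eventually)
    qed
  qed
qed

text \<open>
  The part of the disintegration need not be a measurable function of the weights; it is almost
  surely equal to one, hence measurable for the completed probability.
\<close>

lemma cond_exp_version_completion:
  assumes \<gamma>: "\<gamma> \<in> tree_words b" and D: "AE \<omega> in P. D \<omega> = enn2real (heavy_limit b s \<gamma> \<omega>)"
  shows "cond_exp_version (completion P) (level_algebra b (length \<gamma>)) D (Z s \<gamma>)"
proof -
  let ?Y = "\<lambda>\<omega>. enn2real (heavy_limit b s \<gamma> \<omega>)" and ?F = "level_algebra b (length \<gamma>)"
  have [measurable]: "heavy_limit b s \<gamma> \<in> borel_measurable P" by (rule measurable_heavy_limit)
  have YP: "?Y \<in> borel_measurable P" by measurable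
  have D': "AE \<omega> in completion P. D \<omega> = ?Y \<omega>" by (rule AE_completion[OF D])
  have Dmeas: "D \<in> borel_measurable (completion P)"
  proof (rule measurableI)
    fix A :: "real set" assume A: "A \<in> sets borel"
    show "D -` A \<inter> space (completion P) \<in> sets (completion P)"
    proof (rule completion.in_sets_AE)
      show "?Y -` A \<inter> space P \<in> sets (completion P)"
        using measurable_sets[OF YP A] by (rule sets_completionI_sets)
      show "AE \<omega> in completion P. (\<omega> \<in> ?Y -` A \<inter> space P) = (\<omega> \<in> D -` A \<inter> space (completion P))"
        using D' by eventually_elim simp
    qed simp
  qed simp
  have sub: "subalgebra (completion P) ?F"
    using subalgebra_level[of "length \<gamma>"] by (auto simp: subalgebra_def)
  have fin: "finite_measure (completion P)"
    by (rule finite_measureI) (simp add: emeasure_eq_measure)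
  interpret S: sigma_finite_subalgebra "completion P" ?F
    using fin sub by (intro finite_measure_subalgebra_is_sigma_finite finite_measure_subalgebra.intro
      finite_measure_subalgebra_axioms.intro)
  have eq: "(\<integral>\<^sup>+\<omega>. indicator A \<omega> * ennreal (D \<omega>) \<partial>completion P) = (\<integral>\<^sup>+\<omega>. indicator A \<omega> * heavy_limit b s \<gamma> \<omega> \<partial>P)" for A
    unfolding nn_integral_completion
  proof (rule nn_integral_cong_AE)
    show "AE \<omega> in P. indicator A \<omega> * ennreal (D \<omega>) = indicator A \<omega> * heavy_limit b s \<gamma> \<omega>"
      using D AE_heavy_limit_real[of s \<gamma>] by eventually_elim simp
  qed
  have nonneg: "AE \<omega> in completion P. 0 \<le> D \<omega>" using D' by eventually_elim simp
  have fin': "(\<integral>\<^sup>+\<omega>. ennreal (D \<omega>) \<partial>completion P) < \<infinity>"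
    using eq[of UNIV] nn_integral_heavy_limit_finite[OF \<gamma>, of s] by simp
  have Zeq: "(\<integral>\<^sup>+\<omega>. indicator A \<omega> * ennreal (D \<omega>) \<partial>completion P) = (\<integral>\<^sup>+\<omega>. indicator A \<omega> * ennreal (Z s \<gamma> \<omega>) \<partial>completion P)"
    if "A \<in> sets ?F" for A
    by (rule trans[OF eq]) (simp add: nn_integral_completion nn_integral_Z[OF \<gamma> that])
  have char: "integrable (completion P) D" "AE \<omega> in completion P. real_cond_exp (completion P) ?F D \<omega> = Z s \<gamma> \<omega>"
    by (rule S.real_cond_exp_eqI_nn[OF Dmeas nonneg fin' level_measurable_Z[OF \<gamma> order_refl] AE_I2[OF heavy_cond_mass_nonneg]],
        rule Zeq, assumption)+
  show ?thesis
    unfolding cond_exp_version_def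
  proof (intro conjI)
    show "AE \<omega> in completion P. Z s \<gamma> \<omega> = real_cond_exp (completion P) ?F D \<omega>"
      using char(2) by eventually_elim simp
    show "integrable (completion P) D" by (rule char(1))
  qed (rule level_measurable_Z[OF \<gamma> order_refl])
qed

end

theorem theorem2p6:
  fixes b :: nat
    and p :: "real measure"
    and q :: "nat \<Rightarrow> (nat \<Rightarrow> real) \<Rightarrow> real measure"
    and P :: "(nat list \<Rightarrow> real) measure"
    and L :: "(nat list \<Rightarrow> real) \<Rightarrow> (nat \<Rightarrow> nat) measure"
    and \<nu> :: "(nat list \<Rightarrow> real) \<Rightarrow> ennreal measure"
    and \<kappa> :: "(nat list \<Rightarrow> real) \<Rightarrow> ennreal \<Rightarrow> (nat \<Rightarrow> nat) measure"
    and s :: real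
  assumes "b \<ge> 2"
    and "cascade_generator b p q P"
    and "T_martingale_limit b P cascade L"
    and "AE \<omega> in P. dim_disintegration b (L \<omega>) (\<nu> \<omega>) (\<kappa> \<omega>)"
    and "0 \<le> s" and "s \<le> 1"
  shows "\<exists>Z :: nat list \<Rightarrow> (nat list \<Rightarrow> real) \<Rightarrow> real.
     (\<forall>\<gamma> \<in> tree_words b.
        cond_exp_version (completion P) (level_algebra b (length \<gamma>))
          (\<lambda>\<omega>. enn2real (disint_part (\<nu> \<omega>) (\<kappa> \<omega>) {0..ennreal s} (cyl b \<gamma>))) (Z \<gamma>)) \<and>
     weight_decomposition b P (quotient_weight b Z) \<and>
     (\<exists>LF. T_martingale_limit b P (weighted_cascade (quotient_weight b Z)) LF \<and>
        (AE \<omega> in P. \<forall>B \<in> sets (tree_borel b).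
           emeasure (LF \<omega>) B = disint_part (\<nu> \<omega>) (\<kappa> \<omega>) {0..ennreal s} B))"
proof -
  interpret cascade_limit b p q P L
    by (intro cascade_limit.intro cascade_model.intro cascade_limit_axioms.intro assms)
  have disint: "AE \<omega> in P. regular \<omega> \<and> (\<forall>B\<in>sets (tree_borel b).
      disint_part (\<nu> \<omega>) (\<kappa> \<omega>) {0..ennreal s} B = emeasure (L \<omega>) (B \<inter> heavy_points b s (L \<omega>)))"
    using assms(4) AE_regular
  proof eventually_elim
    case (elim \<omega>)
    then have "finite_measure (L \<omega>)" "sets (L \<omega>) = sets (tree_borel b)" by (auto simp: regular_def)
    with elim assms(1,5) show ?case by (auto intro: disint_part_eq_heavy_points)
  qed
  have "\<forall>\<gamma>\<in>tree_words b. cond_exp_version (completion P) (level_algebra b (length \<gamma>))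
      (\<lambda>\<omega>. enn2real (disint_part (\<nu> \<omega>) (\<kappa> \<omega>) {0..ennreal s} (cyl b \<gamma>))) (heavy_cond_mass b P s \<gamma>)"
  proof
    fix \<gamma> assume \<gamma>: "\<gamma> \<in> tree_words b"
    have "AE \<omega> in P. enn2real (disint_part (\<nu> \<omega>) (\<kappa> \<omega>) {0..ennreal s} (cyl b \<gamma>)) = enn2real (heavy_limit b s \<gamma> \<omega>)"
      using disint by eventually_elim (simp add: regular_heavy_limit)
    with \<gamma> show "cond_exp_version (completion P) (level_algebra b (length \<gamma>))
        (\<lambda>\<omega>. enn2real (disint_part (\<nu> \<omega>) (\<kappa> \<omega>) {0..ennreal s} (cyl b \<gamma>))) (heavy_cond_mass b P s \<gamma>)"
      by (rule cond_exp_version_completion)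
  qed
  moreover have "AE \<omega> in P. \<forall>B\<in>sets (tree_borel b).
      emeasure (heavy_part s \<omega>) B = disint_part (\<nu> \<omega>) (\<kappa> \<omega>) {0..ennreal s} B"
    using disint by eventually_elim (simp add: emeasure_heavy_part)
  ultimately show ?thesis
    using weight_decomposition_weights[of s] T_martingale_limit_weights[of s] by blast
qed

end
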